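(* Let $\alpha\in(0,1)$, $n\ge2$, $J\ge J_0$ with $2^J\le n$, and consider the Gaussian white noise model with $f_0\in B^s_{\infty,\infty}$, a sieve prior $\Pi_\beta$ on $\mathbb R^{2^J}$, the weight sequence $w$, and the Castillo–Nickl band $\mathcal C_w(\hat f_\infty,\hat R_\alpha)$ described in the context. Assume that for some $C_1>0$ $$\pi(\beta_0)\ge n^{2^J/2}\,n^{-C_12^J}\quad\text{and}\quad\phi_{\Pi_\beta}(1/\sqrt n)\le1/2 .$$ Then there exist positive constants $c_1,c_2$ depending only on $C_1$ such that $$|\mathbb P(f_0\in\mathcal C_w(\hat f_\infty,\hat R_\alpha))-(1-\alpha)|\le\phi_{\Pi_\beta}\big(c_1\sqrt{2^J\log n}\big)+c_1n^{-c_22^J}+\mathbb P(Y\notin\tilde H).$$ In addition, there exist positive constants $c_3,c_4$ depending only on $\alpha$ such that the following hold. Assume that $\phi_{\Pi_\beta}(c_1\sqrt{2^J\log n})+c_1n^{-c_22^J}<\min\{\alpha/2,(1-\alpha)/2\}$. Then $$\mathbb P(Y\notin\tilde H)\le c_3\Big(e^{-c_4J(J/\overline w_J^2)u_J^2}+n^{-c_22^J}\Big)$$ for all sufficiently large $J$ depending only on $\alpha$ and $\{w_l\}$; and, for any $B>0$, the $L^\infty$-diameter of $\mathcal C_w^B(\hat f_\infty,\hat R_\alpha):=\mathcal C_w(\hat f_\infty,\hat R_\alpha)\cap\{f:\|f\|_{B^s_{\infty,\infty}}\le B\}$ satisfies $$\sup_{f,g\in\mathcal C_w^B(\hat f_\infty,\hat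 R_\alpha)}\|f-g\|_\infty\le c_3\Big(v_J\sqrt{\frac{2^JJ}{n}}+2^{-Js}B\Big)$$ with probability at least $1-c_1n^{-c_22^J}$.
   Context: Model: $dY(t)=f_0(t)dt+n^{-1/2}dW(t)$, $t\in[0,1]$, with $dW$ canonical white noise. Wavelets and function space (fixed throughout): $s>0$, $S>s$ an integer, $J_0=J_0(S)$ sufficiently large, $\{\phi_{J_0,k}:0\le k\le2^{J_0}-1\}\cup\{\psi_{l,k}:l\ge J_0,0\le k\le2^l-1\}$ an $S$-regular Cohen–Daubechies–Vial wavelet basis of $L^2[0,1]$, with the convention $\psi_{J_0-1,k}:=\phi_{J_0,k}$ for $0\le k\le2^{J_0}-1$. $\langle\cdot,\cdot\rangle$ is the $L^2[0,1]$ inner product. $\|f\|_{B^s_{\infty,\infty}}=\max_{0\le k\le 2^{J_0}-1}|\langle\phi_{J_0,k},f\rangle|+\sup_{l\ge J_0,0\le k\le2^l-1}2^{l(s+1/2)}|\langle\psi_{l,k},f\rangle|$ and $B^s_{\infty,\infty}=\{f:\|f\|_{B^s_{\infty,\infty}}<\infty\}$. At level $l=J_0-1$ the index $k$ ranges over $0\le k\le2^{J_0}-1$. $\mathcal I(J)=\{(l,k):J_0\le l\le J-1,0\le k\le2^l-1\}\cup\{(J_0-1,k):0\le k\le2^{J_0}-1\}$ (so $|\mathcal I(J)|=2^J$) and $\mathcal I_\infty=\bigcup_J\mathcal I(J)$. Sieve prior: $\Pi_\beta(d\beta)=\pi(\beta)d\beta$ on $\mathbb R^{2^J}$ induces a prior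 on $f$ via $\beta\mapsto\sum_{(l,k)\in\mathcal I(J)}\beta_{l,k}\psi_{l,k}$. Let $Y_{l,k}=\int\psi_{l,k}dY$. The posterior $\Pi_\beta(\cdot\mid Y)$ has density proportional to $\pi(\beta)\exp\{-\tfrac n2\sum_{(l,k)\in\mathcal I(J)}(Y_{l,k}-\beta_{l,k})^2\}$. Let $\beta_0=(\langle f_0,\psi_{l,k}\rangle)_{(l,k)\in\mathcal I(J)}$, $B(R)=\{\beta\in\mathbb R^{2^J}:\|\beta-\beta_0\|\le R/\sqrt n\}$ and $\phi_{\Pi_\beta}(R)=1-\inf_{\beta,\tilde\beta\in B(R)}\{\pi(\tilde\beta)/\pi(\beta)\}$. Weights: $w=(w_1,w_2,\dots)$ is positive with $w_l/\sqrt l\uparrow\infty$ as $l\to\infty$ (admissible). $u_J=\inf_{J\le l<\infty}w_l/\sqrt l$, $v_J=\max_{J_0-1\le l\le J-1}w_l/\sqrt l$, $\overline w_J=\max_{J_0-1\le l\le J-1}w_l$. It is assumed that $\sqrt l\le w_l$ for all $l\ge J_0-1$ and that $1\le(J/\overline w_J^2)u_J^2\uparrow\infty$ as $J\to\infty$. Band: the centering estimator is $\hat f_\infty=\sum_{(l,k)\in\mathcal I_\infty}\psi_{l,k}\int\psi_{l,k}dY$, i.e. the (possibly generalized) function with coefficients $\langle\hat f_\infty,\psi_{l,k}\rangle=\int\psi_{l,k}dY$; the series converges almost surely in the space $\mathcal M_0(w)$ of coefficient arrays $(x_{l,k})$ with $\sup_{(l,k)}|x_{l,k}|/w_l<\infty$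 and $\max_k|x_{l,k}|/w_l\to0$. For a centering $\hat f$ and $R>0$, $\mathcal C_w(\hat f,R)=\{f:\sup_{(l,k)\in\mathcal I_\infty}|\langle f-\hat f,\psi_{l,k}\rangle|/w_l\le R\}$. The radius $\hat R_\alpha$ is such that $\Pi_\beta\{\mathcal C_w(\sum_{(l,k)\in\mathcal I(J)}\langle\hat f_\infty,\psi_{l,k}\rangle\psi_{l,k},\hat R_\alpha)\mid Y\}=1-\alpha$. Finally $\tilde H=\{Y:\sup_{J\le l<\infty,0\le k\le2^l-1}|\langle f_0-\hat f_\infty,\psi_{l,k}\rangle|/w_l\le\hat R_\alpha\}$. *)

theory Defs
  imports "HOL-Probability.Probability"
begin

section \<open>The space of square-integrable functions on the unit interval\<close>

text \<open>Functions are total functions on the reals; only their values on the unit interval matter.\<close>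

definition inner_on :: "real set \<Rightarrow> (real \<Rightarrow> real) \<Rightarrow> (real \<Rightarrow> real) \<Rightarrow> real" where
  "inner_on A f g = (LINT x|lebesgue_on A. f x * g x)"

definition L2_unit :: "(real \<Rightarrow> real) set" where
  "L2_unit = {f. f \<in> borel_measurable (lebesgue_on {0..1}) \<and>
                 integrable (lebesgue_on {0..1}) (\<lambda>x. (f x)\<^sup>2)}"

abbreviation inner_unit :: "(real \<Rightarrow> real) \<Rightarrow> (real \<Rightarrow> real) \<Rightarrow> real" where
  "inner_unit \<equiv> inner_on {0..1}"

definition Linf_norm :: "(real \<Rightarrow> real) \<Rightarrow> ereal" where
  "Linf_norm f = esssup (lebesgue_on {0..1}) (\<lambda>x. ereal \<bar>f x\<bar>)"


section \<open>Cohen--Daubechies--Vial wavelets\<close>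

definition C_k :: "nat \<Rightarrow> (real \<Rightarrow> real) \<Rightarrow> bool" where
  "C_k S f \<longleftrightarrow> (\<exists>D. D 0 = f \<and>
      (\<forall>i<S. \<forall>x. (D i has_real_derivative D (Suc i) x) (at x)) \<and> continuous_on UNIV (D S))"

text \<open>
  A Daubechies father/mother pair with \<open>N\<close> vanishing moments, normalised so that both functions
  are supported in \<open>[1 - N, N]\<close>. The phase of the filter \<open>h\<close> (extremal phase,
  least asymmetric, \<dots>) is left open.
\<close>

definition daubechies_pair ::
    "nat \<Rightarrow> (int \<Rightarrow> real) \<Rightarrow> (real \<Rightarrow> real) \<Rightarrow> (real \<Rightarrow> real) \<Rightarrow> bool" where
  "daubechies_pair N h \<phi> \<psi> \<longleftrightarrow>
     (\<forall>k. k \<notin> {1 - int N..int N} \<longrightarrow> h k = 0) \<and>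
     (\<forall>x. \<phi> x = sqrt 2 * (\<Sum>k=1 - int N..int N. h k * \<phi> (2 * x - of_int k))) \<and>
     (\<forall>x. x \<notin> {1 - real N..real N} \<longrightarrow> \<phi> x = 0) \<and>
     (LINT x|lebesgue. \<phi> x) = 1 \<and>
     (\<forall>m::int. inner_on UNIV \<phi> (\<lambda>x. \<phi> (x - of_int m)) = (if m = 0 then 1 else 0)) \<and>
     (\<forall>x. \<psi> x = sqrt 2 * (\<Sum>k=1 - int N..int N.
                 (if even k then 1 else - 1) * h (1 - k) * \<phi> (2 * x - of_int k))) \<and>
     (\<forall>p<N. (LINT x|lebesgue. x ^ p * \<psi> x) = 0)"

text \<open>
  The Cohen--Daubechies--Vial edge functions on the half-line \<open>[0, \<infinity>)\<close>. The functions
  \<open>edge_poly N \<phi> j\<close>, \<open>j < N\<close>, restricted to the half-line, are what has to be added to the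
  interior translates \<open>\<phi>(x - m)\<close>, \<open>m \<ge> N\<close>, to generate the polynomials of degree below \<open>N\<close>.
  The edge scaling functions \<open>\<phi>E\<close> are an orthonormal basis of their span; the edge wavelets
  \<open>\<psi>E\<close> are an orthonormal basis of the orthogonal complement of this span within the sum of it
  with its dilate by 2. Which orthonormal basis is taken is left open.
\<close>

definition edge_poly :: "nat \<Rightarrow> (real \<Rightarrow> real) \<Rightarrow> nat \<Rightarrow> real \<Rightarrow> real" where
  "edge_poly N \<phi> j x = (\<Sum>m=j..2 * N - 2. real (m choose j) * \<phi> (x + real m - real N + 1))"

definition edge_system ::
    "nat \<Rightarrow> (real \<Rightarrow> real) \<Rightarrow> (nat \<Rightarrow> real \<Rightarrow> real) \<Rightarrow> (nat \<Rightarrow> real \<Rightarrow> real) \<Rightarrow> bool" where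
  "edge_system N \<phi> \<phi>E \<psi>E \<longleftrightarrow>
     (\<exists>a :: nat \<Rightarrow> nat \<Rightarrow> real. \<forall>k<N. \<forall>x\<ge>0. \<phi>E k x = (\<Sum>j<N. a k j * edge_poly N \<phi> j x)) \<and>
     (\<exists>(b :: nat \<Rightarrow> nat \<Rightarrow> real) (c :: nat \<Rightarrow> nat \<Rightarrow> real). \<forall>k<N. \<forall>x\<ge>0.
        \<psi>E k x = (\<Sum>j<N. b k j * sqrt 2 * \<phi>E j (2 * x)) + (\<Sum>j<N. c k j * \<phi>E j x)) \<and>
     (\<forall>k<N. \<forall>m<N. inner_on {0..} (\<phi>E k) (\<phi>E m) = (if k = m then 1 else 0)) \<and>
     (\<forall>k<N. \<forall>m<N. inner_on {0..} (\<psi>E k) (\<psi>E m) = (if k = m then 1 else 0)) \<and>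
     (\<forall>k<N. \<forall>m<N. inner_on {0..} (\<psi>E k) (\<phi>E m) = 0)"

text \<open>
  Level \<open>l\<close> consists of \<open>N\<close> dilated left edge functions, \<open>2 ^ l - 2 * N\<close> interior functions and
  \<open>N\<close> dilated right edge functions; the latter live on the half-line reflected at 1.
\<close>

definition cdv_level ::
    "nat \<Rightarrow> (real \<Rightarrow> real) \<Rightarrow> (nat \<Rightarrow> real \<Rightarrow> real) \<Rightarrow> (nat \<Rightarrow> real \<Rightarrow> real) \<Rightarrow> nat \<Rightarrow> nat \<Rightarrow> real \<Rightarrow> real"
where
  "cdv_level N g gL gR l k x = 2 powr (real l / 2) *
     (if k < N then gL k (2 ^ l * x)
      else if k < 2 ^ l - N then g (2 ^ l * x - real k)
      else gR (2 ^ l - 1 - k) (2 ^ l * (1 - x)))"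

definition idx :: "nat \<Rightarrow> nat \<Rightarrow> (nat \<times> nat) set" where
  "idx J0 J = {(l, k). J0 \<le> l \<and> l < J \<and> k < 2 ^ l} \<union> {(l, k). l = J0 - 1 \<and> k < 2 ^ J0}"

definition idx_inf :: "nat \<Rightarrow> (nat \<times> nat) set" where
  "idx_inf J0 = (\<Union>J. idx J0 J)"

definition orthonormal_basis_unit :: "nat \<Rightarrow> (nat \<Rightarrow> nat \<Rightarrow> real \<Rightarrow> real) \<Rightarrow> bool" where
  "orthonormal_basis_unit J0 \<psi> \<longleftrightarrow>
     (\<forall>(l, k) \<in> idx_inf J0. \<psi> l k \<in> L2_unit) \<and>
     (\<forall>(l, k) \<in> idx_inf J0. \<forall>(l', k') \<in> idx_inf J0.
        inner_unit (\<psi> l k) (\<psi> l' k') = (if (l, k) = (l', k') then 1 else 0)) \<and>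
     (\<forall>f\<in>L2_unit. (\<forall>(l, k) \<in> idx_inf J0. inner_unit (\<psi> l k) f = 0) \<longrightarrow>
        (AE x in lebesgue_on {0..1}. f x = 0))"

text \<open>
  \<open>\<psi> (J0 - 1) k\<close> is the scaling function \<open>\<phi>\<^sub>J\<^sub>0\<^sub>,\<^sub>k\<close>. \<open>S\<close>-regularity means at least \<open>S\<close> vanishing
  moments and \<open>S\<close> continuous derivatives. The condition \<open>4 * N \<le> 2 ^ J0\<close> (which forces
  \<open>J0 \<ge> 2\<close> when \<open>S \<ge> 1\<close>) makes \<open>J0\<close> large enough for the left and right edge functions to have
  disjoint supports. Orthonormality and completeness are consequences of the construction
  (the theorem of Cohen, Daubechies and Vial), recorded here as part of the notion of a basis.
\<close>

definition cdv_basis :: "nat \<Rightarrow> nat \<Rightarrow> (nat \<Rightarrow> nat \<Rightarrow> real \<Rightarrow> real) \<Rightarrow> bool" where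
  "cdv_basis S J0 \<psi> \<longleftrightarrow>
     (\<exists>N h father mother fL mL fR mR.
        S \<le> N \<and> 4 * N \<le> 2 ^ J0 \<and>
        daubechies_pair N h father mother \<and> C_k S father \<and> C_k S mother \<and>
        edge_system N father fL mL \<and>
        edge_system N (\<lambda>x. father (1 - x)) fR mR \<and>
        (\<forall>k<2 ^ J0. \<forall>x\<in>{0..1}. \<psi> (J0 - 1) k x = cdv_level N father fL fR J0 k x) \<and>
        (\<forall>l\<ge>J0. \<forall>k<2 ^ l. \<forall>x\<in>{0..1}. \<psi> l k x = cdv_level N mother mL mR l k x)) \<and>
     orthonormal_basis_unit J0 \<psi>"

definition coef :: "(nat \<Rightarrow> nat \<Rightarrow> real \<Rightarrow> real) \<Rightarrow> (real \<Rightarrow> real) \<Rightarrow> nat \<times> nat \<Rightarrow> real" where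
  "coef \<psi> f = (\<lambda>(l, k). inner_unit (\<psi> l k) f)"

definition besov_norm ::
    "nat \<Rightarrow> (nat \<Rightarrow> nat \<Rightarrow> real \<Rightarrow> real) \<Rightarrow> real \<Rightarrow> (real \<Rightarrow> real) \<Rightarrow> ereal" where
  "besov_norm J0 \<psi> s f =
     ereal (MAX k\<in>{..<2 ^ J0}. \<bar>coef \<psi> f (J0 - 1, k)\<bar>) +
     (SUP (l, k) \<in> {(l, k). J0 \<le> l \<and> k < 2 ^ l}.
        ereal (2 powr (real l * (s + 1 / 2)) * \<bar>coef \<psi> f (l, k)\<bar>))"

definition besov :: "nat \<Rightarrow> (nat \<Rightarrow> nat \<Rightarrow> real \<Rightarrow> real) \<Rightarrow> real \<Rightarrow> (real \<Rightarrow> real) set" where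
  "besov J0 \<psi> s = {f \<in> L2_unit. besov_norm J0 \<psi> s f < \<infinity>}"


section \<open>White noise model\<close>

text \<open>\<open>normal_measure v\<close> is \<open>N(0, v)\<close>, including the degenerate case.\<close>

definition normal_measure :: "real \<Rightarrow> real measure" where
  "normal_measure v =
     (if v = 0 then return borel 0 else density lborel (normal_density 0 (sqrt v)))"

text \<open>
  White noise is the centred Gaussian process indexed by square-integrable functions whose
  covariance is the inner product; \<open>W g\<close> is \<open>\<integral> g dW\<close>. Joint Gaussianity and the covariance are
  expressed through the laws of all finite linear combinations.
\<close>

definition white_noise :: "'a measure \<Rightarrow> ((real \<Rightarrow> real) \<Rightarrow> 'a \<Rightarrow> real) \<Rightarrow> bool" where
  "white_noise M W \<longleftrightarrow> prob_space M \<and> (\<forall>g\<in>L2_unit. W g \<in> borel_measurable M) \<and>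
     (\<forall>G a. finite G \<and> G \<subseteq> L2_unit \<longrightarrow>
        distr M borel (\<lambda>\<omega>. \<Sum>g\<in>G. a g * W g \<omega>) =
        normal_measure (inner_unit (\<lambda>x. \<Sum>g\<in>G. a g * g x) (\<lambda>x. \<Sum>g\<in>G. a g * g x)))"

text \<open>\<open>obs n f0 W g\<close> is \<open>\<integral> g dY\<close> for \<open>dY(t) = f0(t) dt + n\<^sup>-\<^sup>1\<^sup>/\<^sup>2 dW(t)\<close>.\<close>

definition obs :: "nat \<Rightarrow> (real \<Rightarrow> real) \<Rightarrow> ((real \<Rightarrow> real) \<Rightarrow> 'a \<Rightarrow> real) \<Rightarrow>
    (real \<Rightarrow> real) \<Rightarrow> 'a \<Rightarrow> real" where
  "obs n f0 W g \<omega> = inner_unit g f0 + W g \<omega> / sqrt (real n)"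

text \<open>
  The array of the \<open>Y\<^sub>l\<^sub>,\<^sub>k\<close>. It is also the coefficient array of the generalised function that
  serves as centering estimator, which is represented by this array.
\<close>

definition obs_coef :: "(nat \<Rightarrow> nat \<Rightarrow> real \<Rightarrow> real) \<Rightarrow> nat \<Rightarrow> (real \<Rightarrow> real) \<Rightarrow>
    ((real \<Rightarrow> real) \<Rightarrow> 'a \<Rightarrow> real) \<Rightarrow> 'a \<Rightarrow> nat \<times> nat \<Rightarrow> real" where
  "obs_coef \<psi> n f0 W \<omega> = (\<lambda>(l, k). obs n f0 W (\<psi> l k) \<omega>)"


section \<open>Sieve prior and posterior\<close>

text \<open>
  \<open>sieve_space J0 J\<close> is Euclidean space with coordinates indexed by \<open>idx J0 J\<close> (of cardinality
  \<open>2 ^ J\<close> for \<open>J \<ge> J0\<close>), carrying Lebesgue measure.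
\<close>

definition sieve_space :: "nat \<Rightarrow> nat \<Rightarrow> (nat \<times> nat \<Rightarrow> real) measure" where
  "sieve_space J0 J = (\<Pi>\<^sub>M i\<in>idx J0 J. lborel)"

definition sieve_prior :: "nat \<Rightarrow> nat \<Rightarrow> ((nat \<times> nat \<Rightarrow> real) \<Rightarrow> real) \<Rightarrow> bool" where
  "sieve_prior J0 J \<pi> \<longleftrightarrow> \<pi> \<in> borel_measurable (sieve_space J0 J) \<and>
     (\<forall>\<beta>\<in>space (sieve_space J0 J). 0 \<le> \<pi> \<beta>) \<and>
     prob_space (density (sieve_space J0 J) (\<lambda>\<beta>. ennreal (\<pi> \<beta>)))"

definition synth :: "nat \<Rightarrow> (nat \<Rightarrow> nat \<Rightarrow> real \<Rightarrow> real) \<Rightarrow> nat \<Rightarrow> (nat \<times> nat \<Rightarrow> real) \<Rightarrow> real \<Rightarrow> real"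
where
  "synth J0 \<psi> J \<beta> x = (\<Sum>(l, k)\<in>idx J0 J. \<beta> (l, k) * \<psi> l k x)"

definition post_weight ::
    "nat \<Rightarrow> nat \<Rightarrow> nat \<Rightarrow> ((nat \<times> nat \<Rightarrow> real) \<Rightarrow> real) \<Rightarrow> (nat \<times> nat \<Rightarrow> real) \<Rightarrow> (nat \<times> nat \<Rightarrow> real) \<Rightarrow> real" where
  "post_weight J0 J n \<pi> y \<beta> = \<pi> \<beta> * exp (- (real n / 2) * (\<Sum>i\<in>idx J0 J. (y i - \<beta> i)\<^sup>2))"

definition posterior ::
    "nat \<Rightarrow> nat \<Rightarrow> nat \<Rightarrow> ((nat \<times> nat \<Rightarrow> real) \<Rightarrow> real) \<Rightarrow> (nat \<times> nat \<Rightarrow> real) \<Rightarrow> (nat \<times> nat \<Rightarrow> real) measure"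
where
  "posterior J0 J n \<pi> y = density (sieve_space J0 J)
     (\<lambda>\<beta>. ennreal (post_weight J0 J n \<pi> y \<beta> /
                    (LINT b|sieve_space J0 J. post_weight J0 J n \<pi> y b)))"

definition sieve_ball :: "nat \<Rightarrow> nat \<Rightarrow> nat \<Rightarrow> (nat \<times> nat \<Rightarrow> real) \<Rightarrow> real \<Rightarrow> (nat \<times> nat \<Rightarrow> real) set" where
  "sieve_ball J0 J n \<beta>0 R = {\<beta> \<in> space (sieve_space J0 J).
     L2_set (\<lambda>i. \<beta> i - \<beta>0 i) (idx J0 J) \<le> R / sqrt (real n)}"

text \<open>
  The local flatness modulus of the prior density. A density vanishing
  somewhere on the ball yields the value 1, in accordance with \<open>x / 0 = 0\<close>.
\<close>

definition prior_modulus ::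
    "nat \<Rightarrow> nat \<Rightarrow> nat \<Rightarrow> ((nat \<times> nat \<Rightarrow> real) \<Rightarrow> real) \<Rightarrow> (nat \<times> nat \<Rightarrow> real) \<Rightarrow> real \<Rightarrow> real" where
  "prior_modulus J0 J n \<pi> \<beta>0 R =
     1 - (INF (\<beta>, \<beta>') \<in> sieve_ball J0 J n \<beta>0 R \<times> sieve_ball J0 J n \<beta>0 R. \<pi> \<beta>' / \<pi> \<beta>)"


section \<open>Weights and credible bands\<close>

definition u_seq :: "(nat \<Rightarrow> real) \<Rightarrow> nat \<Rightarrow> real" where
  "u_seq w J = (INF l\<in>{J..}. w l / sqrt (real l))"

definition v_seq :: "nat \<Rightarrow> (nat \<Rightarrow> real) \<Rightarrow> nat \<Rightarrow> real" where
  "v_seq J0 w J = (MAX l\<in>{J0 - 1..J - 1}. w l / sqrt (real l))"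

definition w_bar :: "nat \<Rightarrow> (nat \<Rightarrow> real) \<Rightarrow> nat \<Rightarrow> real" where
  "w_bar J0 w J = (MAX l\<in>{J0 - 1..J - 1}. w l)"

definition weight_ratio :: "nat \<Rightarrow> (nat \<Rightarrow> real) \<Rightarrow> nat \<Rightarrow> real" where
  "weight_ratio J0 w J = real J / (w_bar J0 w J)\<^sup>2 * (u_seq w J)\<^sup>2"

text \<open>Weight sequences start at index 1; the value \<open>w 0\<close> is never used (\<open>J0 \<ge> 2\<close>).\<close>

definition weights :: "nat \<Rightarrow> (nat \<Rightarrow> real) \<Rightarrow> bool" where
  "weights J0 w \<longleftrightarrow>
     (\<forall>l\<ge>1. 0 < w l) \<and>
     mono_on {1..} (\<lambda>l. w l / sqrt (real l)) \<and>
     filterlim (\<lambda>l. w l / sqrt (real l)) at_top sequentially \<and>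
     (\<forall>l\<ge>J0 - 1. sqrt (real l) \<le> w l) \<and>
     (\<forall>J\<ge>J0. 1 \<le> weight_ratio J0 w J) \<and>
     mono_on {J0..} (weight_ratio J0 w) \<and>
     filterlim (weight_ratio J0 w) at_top sequentially"

definition weighted_sup :: "(nat \<Rightarrow> real) \<Rightarrow> (nat \<times> nat) set \<Rightarrow> (nat \<times> nat \<Rightarrow> real) \<Rightarrow> ereal" where
  "weighted_sup w A x = (SUP (l, k) \<in> A. ereal (\<bar>x (l, k)\<bar> / w l))"

text \<open>The band around the (possibly generalised) function with coefficient array \<open>c\<close>.\<close>

definition band :: "nat \<Rightarrow> (nat \<Rightarrow> nat \<Rightarrow> real \<Rightarrow> real) \<Rightarrow> (nat \<Rightarrow> real) \<Rightarrow>
    (nat \<times> nat \<Rightarrow> real) \<Rightarrow> real \<Rightarrow> (real \<Rightarrow> real) set" where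
  "band J0 \<psi> w c R =
     {f \<in> L2_unit. weighted_sup w (idx_inf J0) (\<lambda>i. coef \<psi> f i - c i) \<le> ereal R}"

text \<open>
  \<open>R\<close> is a measurable choice of the radius for which the band around the truncated centering
  estimator has posterior probability \<open>1 - \<alpha>\<close>; \<open>y \<omega>\<close> is the array of observed coefficients.
\<close>

definition credible_radius ::
    "nat \<Rightarrow> (nat \<Rightarrow> nat \<Rightarrow> real \<Rightarrow> real) \<Rightarrow> (nat \<Rightarrow> real) \<Rightarrow> nat \<Rightarrow> nat \<Rightarrow>
     ((nat \<times> nat \<Rightarrow> real) \<Rightarrow> real) \<Rightarrow> real \<Rightarrow>
     'a measure \<Rightarrow> ('a \<Rightarrow> nat \<times> nat \<Rightarrow> real) \<Rightarrow> ('a \<Rightarrow> real) \<Rightarrow> bool" where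
  "credible_radius J0 \<psi> w J n \<pi> \<alpha> M y R \<longleftrightarrow> R \<in> borel_measurable M \<and>
     (AE \<omega> in M.
        measure (posterior J0 J n \<pi> (y \<omega>))
          {\<beta> \<in> space (sieve_space J0 J).
             synth J0 \<psi> J \<beta> \<in> band J0 \<psi> w (coef \<psi> (synth J0 \<psi> J (y \<omega>))) (R \<omega>)} = 1 - \<alpha>)"

text \<open>The event \<open>H\<close> (with tilde): the radius dominates the noise at the levels \<open>l \<ge> J\<close>.\<close>

definition tail_event :: "(nat \<Rightarrow> nat \<Rightarrow> real \<Rightarrow> real) \<Rightarrow> (nat \<Rightarrow> real) \<Rightarrow> nat \<Rightarrow> (real \<Rightarrow> real) \<Rightarrow>
    'a measure \<Rightarrow> ('a \<Rightarrow> nat \<times> nat \<Rightarrow> real) \<Rightarrow> ('a \<Rightarrow> real) \<Rightarrow> 'a set" where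
  "tail_event \<psi> w J f0 M y R =
     {\<omega> \<in> space M. weighted_sup w {(l, k). J \<le> l \<and> k < 2 ^ l} (\<lambda>i. coef \<psi> f0 i - y \<omega> i) \<le> ereal (R \<omega>)}"

end

theory Submission
  imports Defs
begin

text \<open>
  The proposition rests on a Gaussian approximation of the posterior. The observed coefficients below level \<open>J\<close> are
  independent Gaussians with variance \<open>1 / n\<close> around those of \<open>f0\<close>, and the posterior has density
  proportional to the prior density with respect to the Gaussian measure with the same variance around the observation. The prior
  density is nearly constant on a ball of radius of order \<open>sqrt (2 ^ J * ln n / n)\<close>, and this ball carries
  nearly all the mass of both measures, so the two are close in total variation
  (\<open>bernstein_von_mises\<close>).

  Under the Gaussian approximation the posterior probability of a band of radius \<open>\<rho>\<close> is \<open>box_prob J0 J w n \<rho>\<close>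
  whatever the observation, and this is also the probability that the coefficients of the estimator below level \<open>J\<close> miss
  those of \<open>f0\<close> by at most \<open>\<rho>\<close>, in the weighted maximum norm. A radius of posterior probability \<open>1 - \<alpha>\<close> is
  thus an approximate quantile of the estimation error (\<open>good_event\<close>), which yields the coverage of the coefficients below
  level \<open>J\<close> (\<open>coverage_of_approximate_quantile\<close>, \<open>hit_coverage\<close>); the
  other levels contribute the probability of the complement of the tail event.

  For the remaining claims the random radius is compared with deterministic ones. The maximum of \<open>2 ^ J\<close>
  Gaussians is at least of order \<open>sqrt J\<close>, so the radius is not too small (\<open>box_prob_small\<close>), and a union bound over
  the coefficients of all levels \<open>l \<ge> J\<close> shows that their noise rarely leaves the band (\<open>tail_prob_le\<close>). Because
  the weights dominate \<open>sqrt l\<close>, the radius is at most of order \<open>1 / sqrt n\<close> (\<open>box_prob_large\<close>). Two functions in the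
  band then have close coefficients below level \<open>J\<close>, those of the other levels are small by the Besov bound, and since only
  boundedly many wavelets of each level overlap, both parts sum to the bound for the supremum norm
  (\<open>Linf_norm_le_of_coef\<close>, \<open>Linf_norm_band_diff\<close>).

  The joint law of the observed coefficients has to be derived from the laws of their linear combinations. This is
  done by Kac's characterisation of independence through characteristic functions
  (\<open>distr_eq_PiM_if_char_factorizes\<close>).
\<close>

section \<open>Independence from characteristic functions\<close>

text \<open>
  If a bounded weight \<open>U\<close> is uncorrelated with every \<open>e\<^sup>i\<^sup>t\<^sup>X\<close>, it is uncorrelated with every event \<open>X \<in> A\<close>.
  A constant weight trivially has the property, so \<open>U\<close> may be shifted by \<open>C + 1\<close> to become positive.
  The shifted weight, normalised, is a density under which \<open>X\<close> keeps its characteristic function, and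
  hence, by the uniqueness theorem of Levy, its law.
\<close>

lemma (in prob_space) real_weight_uncorrelated_if_char:
  fixes U X :: "'a \<Rightarrow> real"
  assumes [measurable]: "U \<in> borel_measurable M" "X \<in> borel_measurable M"
    and bound: "\<And>\<omega>. \<bar>U \<omega>\<bar> \<le> C"
    and fac: "\<And>t. (\<integral>\<omega>. of_real (U \<omega>) * iexp (t * X \<omega>) \<partial>M)
                 = of_real (\<integral>\<omega>. U \<omega> \<partial>M) * (\<integral>\<omega>. iexp (t * X \<omega>) \<partial>M)"
    and A [measurable]: "A \<in> sets borel"
  shows "(\<integral>\<omega>. U \<omega> * indicator A (X \<omega>) \<partial>M) = (\<integral>\<omega>. U \<omega> \<partial>M) * prob (X -` A \<inter> space M)"
proof -
  define D where "D \<omega> = U \<omega> + C + 1" for \<omega>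
  have [measurable]: "D \<in> borel_measurable M" unfolding D_def by measurable
  have D1: "1 \<le> D \<omega>" "D \<omega> \<le> 2 * C + 1" for \<omega>
    using bound[of \<omega>] unfolding D_def by auto
  have C0: "0 \<le> C" using bound[of undefined] by linarith
  have intU: "integrable M U"
    by (rule integrable_const_bound[where B=C]) (use bound in auto)
  have intD: "integrable M D"
    unfolding D_def using intU by auto
  define c where "c = (\<integral>\<omega>. D \<omega> \<partial>M)"
  have c_eq: "c = (\<integral>\<omega>. U \<omega> \<partial>M) + C + 1"
    unfolding c_def D_def using intU by (simp add: prob_space)
  have c1: "1 \<le> c"
    unfolding c_def using integral_mono[of M "\<lambda>_. 1" D] intD D1 by (simp add: prob_space)
  define N where "N = density M (\<lambda>\<omega>. ennreal (D \<omega> / c))"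
  have Dc: "0 \<le> D \<omega> / c" for \<omega>
    using D1(1)[of \<omega>] c1 by simp
  have intDc: "integrable M (\<lambda>\<omega>. D \<omega> / c)" using intD by simp
  have "emeasure N (space N) = ennreal (\<integral>\<omega>. D \<omega> / c \<partial>M)"
    unfolding N_def using Dc intDc
    by (simp add: emeasure_density nn_integral_eq_integral cong: nn_integral_cong)
  then have N: "prob_space N"
    using c1 by (intro prob_spaceI) (simp add: c_def)
  have [measurable]: "X \<in> borel_measurable N" "X -` A \<inter> space M \<in> sets M"
    by (simp_all add: N_def)
  interpret N: prob_space N by fact
  interpret XM: real_distribution "distr M borel X" by simp
  interpret XN: real_distribution "distr N borel X" by simp
  have "char (distr N borel X) t = char (distr M borel X) t" for t
  proof -
    have "integrable M (\<lambda>\<omega>. iexp (t * X \<omega>))"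
      by (rule integrable_const_bound[where B=1]) auto
    moreover have "integrable M (\<lambda>\<omega>. of_real (U \<omega>) * iexp (t * X \<omega>))"
      by (rule integrable_const_bound[where B=C]) (use bound in \<open>auto simp: norm_mult\<close>)
    ultimately have "(\<integral>\<omega>. of_real (D \<omega>) * iexp (t * X \<omega>) \<partial>M)
       = (\<integral>\<omega>. of_real (U \<omega>) * iexp (t * X \<omega>) \<partial>M) + of_real (C + 1) * (\<integral>\<omega>. iexp (t * X \<omega>) \<partial>M)"
      unfolding D_def by (subst integral_mult_right_zero[symmetric], subst Bochner_Integration.integral_add[symmetric])
        (auto simp: algebra_simps)
    also have "\<dots> = of_real c * (\<integral>\<omega>. iexp (t * X \<omega>) \<partial>M)"
      unfolding fac c_eq by (simp add: algebra_simps)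
    finally have *: "(\<integral>\<omega>. of_real (D \<omega>) * iexp (t * X \<omega>) \<partial>M) = of_real c * (\<integral>\<omega>. iexp (t * X \<omega>) \<partial>M)" .
    have "char (distr N borel X) t = (\<integral>\<omega>. iexp (t * X \<omega>) \<partial>N)"
      unfolding char_def by (subst integral_distr) auto
    also have "\<dots> = (\<integral>\<omega>. (D \<omega> / c) *\<^sub>R iexp (t * X \<omega>) \<partial>M)"
      unfolding N_def using Dc by (subst integral_density) auto
    also have "\<dots> = (\<integral>\<omega>. of_real (inverse c) * (of_real (D \<omega>) * iexp (t * X \<omega>)) \<partial>M)"
      by (intro Bochner_Integration.integral_cong) (auto simp: scaleR_conv_of_real divide_inverse mult_ac)
    also have "\<dots> = (\<integral>\<omega>. iexp (t * X \<omega>) \<partial>M)"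
      unfolding integral_mult_right_zero * using c1 by (simp flip: of_real_mult mult.assoc)
    also have "\<dots> = char (distr M borel X) t"
      unfolding char_def by (subst integral_distr) auto
    finally show ?thesis .
  qed
  then have "distr N borel X = distr M borel X"
    by (intro Levy_uniqueness) (auto simp: fun_eq_iff)
  then have "measure (distr N borel X) A = measure (distr M borel X) A" by simp
  then have "measure N (X -` A \<inter> space M) = prob (X -` A \<inter> space M)"
    by (simp add: measure_distr N_def)
  moreover have "measure N (X -` A \<inter> space M) = (\<integral>\<omega>. D \<omega> / c * indicator A (X \<omega>) \<partial>M)"
  proof -
    have "measure N (X -` A \<inter> space M) = (\<integral>\<omega>. indicator A (X \<omega>) \<partial>N)"
      by (subst Bochner_Integration.integral_cong[where g="indicator (X -` A \<inter> space M)", OF refl])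
         (auto simp: indicator_def N_def)
    also have "\<dots> = (\<integral>\<omega>. D \<omega> / c * indicator A (X \<omega>) \<partial>M)"
      unfolding N_def using Dc by (subst integral_density) auto
    finally show ?thesis .
  qed
  moreover have "(\<integral>\<omega>. D \<omega> / c * indicator A (X \<omega>) \<partial>M)
      = ((\<integral>\<omega>. U \<omega> * indicator A (X \<omega>) \<partial>M) + (C + 1) * prob (X -` A \<inter> space M)) / c"
  proof -
    have 1: "integrable M (\<lambda>\<omega>. U \<omega> * indicator A (X \<omega>))"
      by (rule integrable_const_bound[where B=C]) (use bound C0 in \<open>auto simp: indicator_def\<close>)
    have 2: "integrable M (\<lambda>\<omega>. indicator A (X \<omega>) :: real)"
      by (rule integrable_const_bound[where B=1]) (auto simp: indicator_def)
    have 3: "prob (X -` A \<inter> space M) = (\<integral>\<omega>. indicator A (X \<omega>) \<partial>M)"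
      by (subst Bochner_Integration.integral_cong[where g="indicator (X -` A \<inter> space M)", OF refl])
         (auto simp: indicator_def)
    have "(\<integral>\<omega>. D \<omega> / c * indicator A (X \<omega>) \<partial>M)
      = (\<integral>\<omega>. inverse c * (U \<omega> * indicator A (X \<omega>) + (C + 1) * indicator A (X \<omega>)) \<partial>M)"
      unfolding D_def by (intro Bochner_Integration.integral_cong) (auto simp: field_simps)
    also have "\<dots> = inverse c * ((\<integral>\<omega>. U \<omega> * indicator A (X \<omega>) \<partial>M) + (C + 1) * (\<integral>\<omega>. indicator A (X \<omega>) \<partial>M))"
      using 1 2 by simp
    finally show ?thesis unfolding 3 by (simp add: divide_inverse mult.commute)
  qed
  ultimately show ?thesis
    using c1 c_eq by (simp add: field_simps)
qed

text \<open>
  Conjugation turns the hypothesis at \<open>-t\<close> into the hypothesis at \<open>t\<close> for the conjugate weight, so both the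
  real and the imaginary part of \<open>V\<close> fall under the preceding lemma.
\<close>

lemma (in prob_space) weight_uncorrelated_if_char:
  fixes V :: "'a \<Rightarrow> complex" and X :: "'a \<Rightarrow> real"
  assumes [measurable]: "V \<in> borel_measurable M" "X \<in> borel_measurable M"
    and bound: "\<And>\<omega>. norm (V \<omega>) \<le> C"
    and fac: "\<And>t. (\<integral>\<omega>. V \<omega> * iexp (t * X \<omega>) \<partial>M)
                 = (\<integral>\<omega>. V \<omega> \<partial>M) * (\<integral>\<omega>. iexp (t * X \<omega>) \<partial>M)"
    and A [measurable]: "A \<in> sets borel"
  shows "(\<integral>\<omega>. V \<omega> * indicator A (X \<omega>) \<partial>M)
       = (\<integral>\<omega>. V \<omega> \<partial>M) * of_real (prob (X -` A \<inter> space M))"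
proof -
  have intV: "integrable M V"
    by (rule integrable_const_bound[where B=C]) (use bound in auto)
  have intVe: "integrable M (\<lambda>\<omega>. V \<omega> * iexp (t * X \<omega>))" for t
    by (rule integrable_const_bound[where B=C]) (use bound in \<open>auto simp: norm_mult\<close>)
  have [measurable]: "cnj \<in> borel_measurable borel"
    by (intro borel_measurable_continuous_onI continuous_intros)
  have intcVe: "integrable M (\<lambda>\<omega>. cnj (V \<omega>) * iexp (t * X \<omega>))" for t
    by (rule integrable_const_bound[where B=C]) (use bound in \<open>auto simp: norm_mult\<close>)
  have fac': "(\<integral>\<omega>. cnj (V \<omega>) * iexp (t * X \<omega>) \<partial>M)
            = cnj (\<integral>\<omega>. V \<omega> \<partial>M) * (\<integral>\<omega>. iexp (t * X \<omega>) \<partial>M)" for t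
  proof -
    have cnj_iexp: "cnj (iexp (- t * x)) = iexp (t * x)" for x :: real
      by (simp add: exp_cnj)
    have "(\<integral>\<omega>. cnj (V \<omega>) * iexp (t * X \<omega>) \<partial>M) = (\<integral>\<omega>. cnj (V \<omega> * iexp (- t * X \<omega>)) \<partial>M)"
      by (simp only: complex_cnj_mult cnj_iexp)
    also have "\<dots> = cnj (\<integral>\<omega>. V \<omega> * iexp (- t * X \<omega>) \<partial>M)"
      by (rule Bochner_Integration.integral_cnj)
    also have "\<dots> = cnj (\<integral>\<omega>. V \<omega> \<partial>M) * (\<integral>\<omega>. cnj (iexp (- t * X \<omega>)) \<partial>M)"
      unfolding fac complex_cnj_mult Bochner_Integration.integral_cnj ..
    finally show ?thesis unfolding cnj_iexp .
  qed
  have re: "complex_of_real (Re z) = (z + cnj z) / 2" and im: "complex_of_real (Im z) = (z - cnj z) / (2 * \<i>)" for z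
    by (auto simp: complex_eq_iff)
  have Re: "(\<integral>\<omega>. Re (V \<omega>) * indicator A (X \<omega>) \<partial>M) = (\<integral>\<omega>. Re (V \<omega>) \<partial>M) * prob (X -` A \<inter> space M)"
  proof (rule real_weight_uncorrelated_if_char)
    show "\<bar>Re (V \<omega>)\<bar> \<le> C" for \<omega> using bound[of \<omega>] abs_Re_le_cmod[of "V \<omega>"] by linarith
    fix t
    have "(\<integral>\<omega>. of_real (Re (V \<omega>)) * iexp (t * X \<omega>) \<partial>M)
       = (\<integral>\<omega>. (V \<omega> * iexp (t * X \<omega>) + cnj (V \<omega>) * iexp (t * X \<omega>)) / 2 \<partial>M)"
      unfolding re by (simp add: algebra_simps)
    also have "\<dots> = ((\<integral>\<omega>. V \<omega> * iexp (t * X \<omega>) \<partial>M) + (\<integral>\<omega>. cnj (V \<omega>) * iexp (t * X \<omega>) \<partial>M)) / 2"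
      by (simp only: integral_divide_zero Bochner_Integration.integral_add[OF intVe intcVe])
    also have "\<dots> = of_real (Re (\<integral>\<omega>. V \<omega> \<partial>M)) * (\<integral>\<omega>. iexp (t * X \<omega>) \<partial>M)"
      unfolding fac fac' re by (simp add: algebra_simps add_divide_distrib)
    finally show "(\<integral>\<omega>. of_real (Re (V \<omega>)) * iexp (t * X \<omega>) \<partial>M)
       = of_real (\<integral>\<omega>. Re (V \<omega>) \<partial>M) * (\<integral>\<omega>. iexp (t * X \<omega>) \<partial>M)"
      using intV by simp
  qed measurable
  have Im: "(\<integral>\<omega>. Im (V \<omega>) * indicator A (X \<omega>) \<partial>M) = (\<integral>\<omega>. Im (V \<omega>) \<partial>M) * prob (X -` A \<inter> space M)"
  proof (rule real_weight_uncorrelated_if_char)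
    show "\<bar>Im (V \<omega>)\<bar> \<le> C" for \<omega> using bound[of \<omega>] abs_Im_le_cmod[of "V \<omega>"] by linarith
    fix t
    have "(\<integral>\<omega>. of_real (Im (V \<omega>)) * iexp (t * X \<omega>) \<partial>M)
       = (\<integral>\<omega>. (V \<omega> * iexp (t * X \<omega>) - cnj (V \<omega>) * iexp (t * X \<omega>)) / (2 * \<i>) \<partial>M)"
      unfolding im by (simp add: algebra_simps diff_divide_distrib)
    also have "\<dots> = ((\<integral>\<omega>. V \<omega> * iexp (t * X \<omega>) \<partial>M) - (\<integral>\<omega>. cnj (V \<omega>) * iexp (t * X \<omega>) \<partial>M)) / (2 * \<i>)"
      by (simp only: integral_divide_zero Bochner_Integration.integral_diff[OF intVe intcVe])
    also have "\<dots> = of_real (Im (\<integral>\<omega>. V \<omega> \<partial>M)) * (\<integral>\<omega>. iexp (t * X \<omega>) \<partial>M)"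
      unfolding fac fac' im by (simp add: algebra_simps diff_divide_distrib)
    finally show "(\<integral>\<omega>. of_real (Im (V \<omega>)) * iexp (t * X \<omega>) \<partial>M)
       = of_real (\<integral>\<omega>. Im (V \<omega>) \<partial>M) * (\<integral>\<omega>. iexp (t * X \<omega>) \<partial>M)"
      using intV by simp
  qed measurable
  have C0: "0 \<le> C" using bound[of undefined] norm_ge_zero order_trans by blast
  have int: "integrable M (\<lambda>\<omega>. V \<omega> * indicator A (X \<omega>))"
    by (rule integrable_const_bound[where B=C]) (use bound C0 in \<open>auto simp: norm_mult indicator_def\<close>)
  have ind: "(indicator A x :: complex) = of_real (indicator A x)" for x :: real
    by (simp add: indicator_def)
  show ?thesis
  proof (rule complex_eqI)
    show "Re (\<integral>\<omega>. V \<omega> * indicator A (X \<omega>) \<partial>M) = Re ((\<integral>\<omega>. V \<omega> \<partial>M) * of_real (prob (X -` A \<inter> space M)))"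
      using Re integral_Re[OF int] integral_Re[OF intV] by (simp add: ind)
    show "Im (\<integral>\<omega>. V \<omega> * indicator A (X \<omega>) \<partial>M) = Im ((\<integral>\<omega>. V \<omega> \<partial>M) * of_real (prob (X -` A \<inter> space M)))"
      using Im integral_Im[OF int] integral_Im[OF intV] by (simp add: ind)
  qed
qed

text \<open>
  Kac's theorem: a factorising joint characteristic function means independence. The coordinates are
  converted one at a time from a factor \<open>e\<^sup>i\<^sup>s\<^sup>X\<close> to an indicator; the product over all the other coordinates
  serves as the weight of the preceding lemma. Thus uniqueness is only needed on the real line.
\<close>

lemma (in prob_space) distr_eq_PiM_if_char_factorizes:
  fixes X :: "'i \<Rightarrow> 'a \<Rightarrow> real"
  assumes I: "finite I" and X: "\<And>i. i \<in> I \<Longrightarrow> X i \<in> borel_measurable M"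
    and fac: "\<And>s. (\<integral>\<omega>. (\<Prod>i\<in>I. iexp (s i * X i \<omega>)) \<partial>M) = (\<Prod>i\<in>I. \<integral>\<omega>. iexp (s i * X i \<omega>) \<partial>M)"
  shows "distr M (\<Pi>\<^sub>M i\<in>I. borel) (\<lambda>\<omega>. \<lambda>i\<in>I. X i \<omega>) = (\<Pi>\<^sub>M i\<in>I. distr M borel (X i))"
proof -
  note X [measurable]
  have norm_ie: "norm (iexp (x::real)) = 1" for x by simp
  have step: "(\<integral>\<omega>. (\<Prod>k\<in>K. indicator (A k) (X k \<omega>)) * (\<Prod>i\<in>I - K. iexp (s i * X i \<omega>)) \<partial>M)
      = (\<Prod>k\<in>K. of_real (prob (X k -` A k \<inter> space M))) * (\<Prod>i\<in>I - K. \<integral>\<omega>. iexp (s i * X i \<omega>) \<partial>M)"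
    if "finite K" "K \<subseteq> I" "\<And>i. A i \<in> sets borel" for K A s
    using that
  proof (induction K arbitrary: s rule: finite_subset_induct')
    case empty
    then show ?case using fac[of s] by simp
  next
    case (insert j K)
    note insert.prems [measurable]
    have [measurable]: "X i \<in> borel_measurable M" if "i \<in> K" for i
      using that \<open>K \<subseteq> I\<close> X by auto
    define V :: "'a \<Rightarrow> complex" where
      "V \<omega> = (\<Prod>k\<in>K. indicator (A k) (X k \<omega>)) * (\<Prod>i\<in>I - insert j K. iexp (s i * X i \<omega>))" for \<omega>
    define Q :: complex where
      "Q = (\<Prod>k\<in>K. of_real (prob (X k -` A k \<inter> space M))) * (\<Prod>i\<in>I - insert j K. \<integral>\<omega>. iexp (s i * X i \<omega>) \<partial>M)"
    have IK: "I - K = insert j (I - insert j K)" using insert.hyps by auto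
    have fin: "finite (I - insert j K)" using I by auto
    have V_e: "(\<integral>\<omega>. V \<omega> * iexp (t * X j \<omega>) \<partial>M) = Q * (\<integral>\<omega>. iexp (t * X j \<omega>) \<partial>M)" for t
    proof -
      have upd: "(\<Prod>i\<in>I - insert j K. g (if i = j then t else s i) i) = (\<Prod>i\<in>I - insert j K. g (s i) i)"
        for g :: "real \<Rightarrow> 'i \<Rightarrow> complex"
        by (rule prod.cong) auto
      show ?thesis
        using insert.IH[of "s(j := t)", OF insert.prems]
        unfolding IK V_def Q_def fun_upd_def using fin
        by (simp add: upd[of "\<lambda>u i. iexp (u * X i _)"] upd[of "\<lambda>u i. \<integral>\<omega>. iexp (u * X i \<omega>) \<partial>M"] mult_ac)
    qed
    have EV: "(\<integral>\<omega>. V \<omega> \<partial>M) = Q"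
      using V_e[of 0] by (simp add: prob_space)
    have "(\<integral>\<omega>. V \<omega> * indicator (A j) (X j \<omega>) \<partial>M) = (\<integral>\<omega>. V \<omega> \<partial>M) * of_real (prob (X j -` A j \<inter> space M))"
    proof (rule weight_uncorrelated_if_char)
      show "norm (V \<omega>) \<le> 1" for \<omega>
        unfolding V_def norm_mult prod_norm[symmetric] norm_ie
        by (auto intro!: prod_le_1 simp: indicator_def)
      show "V \<in> borel_measurable M" unfolding V_def by measurable
      show "X j \<in> borel_measurable M" using insert.hyps X by auto
      show "(\<integral>\<omega>. V \<omega> * iexp (t * X j \<omega>) \<partial>M) = (\<integral>\<omega>. V \<omega> \<partial>M) * (\<integral>\<omega>. iexp (t * X j \<omega>) \<partial>M)" for t
        unfolding V_e EV ..
    qed (rule insert.prems)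
    then show ?case
      unfolding EV unfolding Q_def V_def
      using insert.hyps by (simp add: mult_ac)
  qed
  interpret PP: product_prob_space "\<lambda>i. distr M borel (if i \<in> I then X i else (\<lambda>_. 0))" I
    by (intro product_prob_spaceI) (auto intro!: prob_space_distr prob_space_return)
  have "distr M (\<Pi>\<^sub>M i\<in>I. borel) (\<lambda>\<omega>. \<lambda>i\<in>I. X i \<omega>) = (\<Pi>\<^sub>M i\<in>I. distr M borel (if i \<in> I then X i else (\<lambda>_. 0)))"
  proof (rule PP.PiM_eqI[OF I])
    show "sets (distr M (\<Pi>\<^sub>M i\<in>I. borel) (\<lambda>\<omega>. \<lambda>i\<in>I. X i \<omega>))
        = sets (\<Pi>\<^sub>M i\<in>I. distr M borel (if i \<in> I then X i else (\<lambda>_. 0)))"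
      by (simp cong: sets_PiM_cong)
    fix A assume "\<And>i. i \<in> I \<Longrightarrow> A i \<in> sets (distr M borel (if i \<in> I then X i else (\<lambda>_. 0)))"
    then have A: "\<And>i. i \<in> I \<Longrightarrow> A i \<in> sets borel" by simp
    define A' where "A' i = (if i \<in> I then A i else {})" for i
    have A': "A' i \<in> sets borel" for i using A by (auto simp: A'_def)
    have box: "(\<lambda>\<omega>. \<lambda>i\<in>I. X i \<omega>) -` Pi\<^sub>E I A \<inter> space M = {\<omega> \<in> space M. \<forall>i\<in>I. X i \<omega> \<in> A i}"
      by auto
    have [measurable]: "{\<omega> \<in> space M. \<forall>i\<in>I. X i \<omega> \<in> A i} \<in> sets M"
      using A I X by (intro sets.sets_Collect_finite_All) auto
    have "complex_of_real (prob {\<omega> \<in> space M. \<forall>i\<in>I. X i \<omega> \<in> A i})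
        = (\<integral>\<omega>. (\<Prod>k\<in>I. indicator (A' k) (X k \<omega>)) \<partial>M)"
    proof -
      have "(\<integral>\<omega>. (\<Prod>k\<in>I. indicator (A' k) (X k \<omega>)) \<partial>M)
          = (\<integral>\<omega>. complex_of_real (indicator {\<omega> \<in> space M. \<forall>i\<in>I. X i \<omega> \<in> A i} \<omega>) \<partial>M)"
      proof (intro Bochner_Integration.integral_cong refl)
        fix \<omega> assume \<omega>: "\<omega> \<in> space M"
        show "(\<Prod>k\<in>I. indicator (A' k) (X k \<omega>))
            = complex_of_real (indicator {\<omega> \<in> space M. \<forall>i\<in>I. X i \<omega> \<in> A i} \<omega>)"
        proof (cases "\<forall>i\<in>I. X i \<omega> \<in> A i")
          case False
          then obtain i where "i \<in> I" "X i \<omega> \<notin> A' i" by (auto simp: A'_def)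
          then show ?thesis using I False by (subst prod_zero) (auto intro!: bexI[of _ i])
        qed (use \<omega> in \<open>simp add: A'_def\<close>)
      qed
      also have "\<dots> = of_real (prob {\<omega> \<in> space M. \<forall>i\<in>I. X i \<omega> \<in> A i})"
        by (simp add: Int_absorb1)
      finally show ?thesis ..
    qed
    also have "\<dots> = (\<Prod>k\<in>I. of_real (prob (X k -` A' k \<inter> space M)))"
      using step[of I A' "\<lambda>_. 0", OF I order_refl A'] by simp
    also have "\<dots> = complex_of_real (\<Prod>i\<in>I. prob (X i -` A i \<inter> space M))"
      unfolding of_real_prod by (intro prod.cong) (auto simp: A'_def)
    finally have *: "prob {\<omega> \<in> space M. \<forall>i\<in>I. X i \<omega> \<in> A i} = (\<Prod>i\<in>I. prob (X i -` A i \<inter> space M))"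
      by (simp only: of_real_eq_iff)
    have "emeasure (distr M (\<Pi>\<^sub>M i\<in>I. borel) (\<lambda>\<omega>. \<lambda>i\<in>I. X i \<omega>)) (Pi\<^sub>E I A)
        = ennreal (prob {\<omega> \<in> space M. \<forall>i\<in>I. X i \<omega> \<in> A i})"
      using A I by (subst emeasure_distr) (auto simp: box emeasure_eq_measure intro!: sets_PiM_I_finite)
    also have "\<dots> = (\<Prod>i\<in>I. ennreal (prob (X i -` A i \<inter> space M)))"
      unfolding * by (simp add: prod_ennreal)
    also have "\<dots> = (\<Prod>i\<in>I. emeasure (distr M borel (if i \<in> I then X i else (\<lambda>_. 0))) (A i))"
      using A X by (intro prod.cong) (auto simp: emeasure_distr emeasure_eq_measure)
    finally show "emeasure (distr M (\<Pi>\<^sub>M i\<in>I. borel) (\<lambda>\<omega>. \<lambda>i\<in>I. X i \<omega>)) (Pi\<^sub>E I A)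
        = (\<Prod>i\<in>I. emeasure (distr M borel (if i \<in> I then X i else (\<lambda>_. 0))) (A i))" .
  qed
  also have "\<dots> = (\<Pi>\<^sub>M i\<in>I. distr M borel (X i))"
    by (intro PiM_cong) auto
  finally show ?thesis .
qed

section \<open>Gaussian product measures\<close>

lemma normal_distribution_affine:
  assumes "0 < \<sigma>"
  shows "density lborel (normal_density m \<sigma>) = distr std_normal_distribution borel (\<lambda>x. m + \<sigma> * x)"
proof -
  interpret prob_space std_normal_distribution by (rule prob_space_normal_density) simp
  have "distributed std_normal_distribution lborel (\<lambda>x. x) std_normal_density"
    unfolding distributed_def by (auto simp: distr_id2 intro!: measurable_ident_sets)
  from normal_density_affine[OF this, of \<sigma> m]
  have "distr std_normal_distribution lborel (\<lambda>x. m + \<sigma> * x) = density lborel (normal_density m \<sigma>)"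
    using assms by (auto simp: distributed_def)
  then show ?thesis by (simp cong: distr_cong)
qed

definition normal_prob :: "real \<Rightarrow> real" where
  "normal_prob t = measure std_normal_distribution {x. \<bar>x\<bar> \<le> t}"

lemma measure_normal_centered:
  assumes "0 < \<sigma>"
  shows "measure (density lborel (normal_density m \<sigma>)) {x. \<bar>x - m\<bar> \<le> r} = normal_prob (r / \<sigma>)"
proof -
  have "(\<lambda>x. m + \<sigma> * x) -` {x. \<bar>x - m\<bar> \<le> r} = {x. \<bar>x\<bar> \<le> r / \<sigma>}"
    using assms by (auto simp: abs_mult field_simps)
  then show ?thesis
    unfolding normal_distribution_affine[OF assms] normal_prob_def
    by (subst measure_distr) auto
qed

text \<open>
  The exponential halves the precision: the integrand is \<open>sqrt 2\<close> times the density with variance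
  \<open>2 \<sigma>\<^sup>2\<close>. This one moment yields all Gaussian tail bounds below.
\<close>

lemma nn_integral_normal_exp_square:
  assumes "0 < \<sigma>"
  shows "(\<integral>\<^sup>+x. ennreal (exp ((x - m)\<^sup>2 / (4 * \<sigma>\<^sup>2))) \<partial>density lborel (normal_density m \<sigma>)) = ennreal (sqrt 2)"
proof -
  have *: "normal_density m \<sigma> x * exp ((x - m)\<^sup>2 / (4 * \<sigma>\<^sup>2)) = sqrt 2 * normal_density m (sqrt 2 * \<sigma>) x" for x
  proof -
    have "- (x - m)\<^sup>2 / (2 * \<sigma>\<^sup>2) + (x - m)\<^sup>2 / (4 * \<sigma>\<^sup>2) = - (x - m)\<^sup>2 / (2 * (sqrt 2 * \<sigma>)\<^sup>2)"
      using assms by (simp add: power_mult_distrib field_simps)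
    moreover have "sqrt (2 * pi * (sqrt 2 * \<sigma>)\<^sup>2) = sqrt 2 * sqrt (2 * pi * \<sigma>\<^sup>2)"
      by (simp add: real_sqrt_mult power_mult_distrib)
    then have "1 / sqrt (2 * pi * \<sigma>\<^sup>2) = sqrt 2 * (1 / sqrt (2 * pi * (sqrt 2 * \<sigma>)\<^sup>2))"
      by simp
    ultimately show ?thesis
      unfolding normal_density_def by (metis (no_types, lifting) exp_add mult.assoc)
  qed
  have "(\<integral>\<^sup>+x. ennreal (exp ((x - m)\<^sup>2 / (4 * \<sigma>\<^sup>2))) \<partial>density lborel (normal_density m \<sigma>))
     = (\<integral>\<^sup>+x. ennreal (normal_density m \<sigma> x * exp ((x - m)\<^sup>2 / (4 * \<sigma>\<^sup>2))) \<partial>lborel)"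
    by (subst nn_integral_density) (auto simp: ennreal_mult)
  also have "\<dots> = (\<integral>\<^sup>+x. ennreal (sqrt 2 * normal_density m (sqrt 2 * \<sigma>) x) \<partial>lborel)"
    unfolding * ..
  also have "\<dots> = ennreal (sqrt 2)"
    using assms by (subst nn_integral_eq_integral) auto
  finally show ?thesis .
qed

interpretation std_normal: real_distribution std_normal_distribution
  by (rule real_dist_normal_dist)

lemma normal_prob_nonneg: "0 \<le> normal_prob t" and normal_prob_le_1: "normal_prob t \<le> 1"
  unfolding normal_prob_def by simp_all

lemma normal_prob_mono: "s \<le> t \<Longrightarrow> normal_prob s \<le> normal_prob t"
  unfolding normal_prob_def by (intro std_normal.finite_measure_mono) auto

lemma normal_prob_tail: "std_normal.prob {x. t < \<bar>x\<bar>} = 1 - normal_prob t"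
proof -
  have "{x::real. t < \<bar>x\<bar>} = UNIV - {x. \<bar>x\<bar> \<le> t}" by auto
  then show ?thesis
    unfolding normal_prob_def using std_normal.prob_compl[of "{x. \<bar>x\<bar> \<le> t}"] by simp
qed

text \<open>
  Seen as the distribution function of \<open>\<bar>Z\<bar>\<close>, \<open>normal_prob\<close> inherits continuity and its limit from the
  theory of distribution functions.
\<close>

lemma normal_prob_eq_cdf: "normal_prob = cdf (distr std_normal_distribution borel abs)"
proof
  fix t :: real
  have "abs -` {..t} = {x::real. \<bar>x\<bar> \<le> t}" by auto
  then show "normal_prob t = cdf (distr std_normal_distribution borel abs) t"
    unfolding normal_prob_def cdf_def by (subst measure_distr) auto
qed

lemma std_normal_null_sets: "A \<in> null_sets lborel \<Longrightarrow> std_normal.prob A = 0"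
  using absolutely_continuousI_density[of "\<lambda>x. ennreal (std_normal_density x)" lborel]
  by (auto simp: absolutely_continuous_def null_sets_def measure_def)

lemma isCont_normal_prob: "isCont normal_prob t"
proof -
  interpret real_distribution "distr std_normal_distribution borel abs" by simp
  have "abs -` {t} \<subseteq> {t, - t}" by auto
  then have "finite (abs -` {t})" by (rule finite_subset) simp
  then have "std_normal.prob (abs -` {t}) = 0"
    by (intro std_normal_null_sets finite_imp_null_set_lborel)
  then have "measure (distr std_normal_distribution borel abs) {t} = 0"
    by (subst measure_distr) auto
  then show ?thesis
    unfolding normal_prob_eq_cdf isCont_cdf .
qed

lemma tendsto_normal_prob: "(normal_prob \<longlongrightarrow> 1) at_top"
proof -
  interpret real_distribution "distr std_normal_distribution borel abs" by simp
  show ?thesis unfolding normal_prob_eq_cdf by (rule cdf_lim_at_top_prob)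
qed

lemma normal_prob_0: "normal_prob 0 = 0"
proof -
  have "{x::real. \<bar>x\<bar> \<le> 0} = {0}" by auto
  then show ?thesis unfolding normal_prob_def by (simp add: std_normal_null_sets finite_imp_null_set_lborel)
qed

text \<open>
  The density exceeds its value at \<open>t + 1\<close> on the two unit intervals next to \<open>\<plusminus>t\<close>.
\<close>

lemma normal_prob_tail_lower:
  assumes "0 \<le> t"
  shows "2 * std_normal_density (t + 1) \<le> 1 - normal_prob t"
proof -
  have dens: "std_normal_density (t + 1) \<le> std_normal_density x" if "\<bar>x\<bar> \<le> t + 1" for x
  proof -
    have "x\<^sup>2 \<le> (t + 1)\<^sup>2" using that assms by (metis abs_le_square_iff abs_of_nonneg add_nonneg_nonneg zero_le_one)
    then show ?thesis unfolding std_normal_density_def by (intro mult_left_mono) auto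
  qed
  let ?A = "{- (t + 1) ..< - t} \<union> {t <.. t + 1}"
  have "ennreal (2 * std_normal_density (t + 1)) = (\<integral>\<^sup>+x. ennreal (std_normal_density (t + 1)) * indicator ?A x \<partial>lborel)"
  proof -
    have "emeasure lborel ?A = emeasure lborel {- (t + 1) ..< - t} + emeasure lborel {t <.. t + 1}"
      using assms by (intro plus_emeasure[symmetric]) auto
    also have "\<dots> = 2" by simp
    finally show ?thesis by (subst nn_integral_cmult_indicator) (auto simp: ennreal_mult'' mult.commute)
  qed
  also have "\<dots> \<le> (\<integral>\<^sup>+x. ennreal (std_normal_density x) * indicator {x. t < \<bar>x\<bar>} x \<partial>lborel)"
    using assms by (intro nn_integral_mono) (auto simp: indicator_def intro!: ennreal_leI dens)
  also have "\<dots> = emeasure std_normal_distribution {x. t < \<bar>x\<bar>}"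
    by (subst emeasure_density) auto
  finally show ?thesis
    unfolding std_normal.emeasure_eq_measure normal_prob_tail
    using normal_prob_le_1[of t] by (subst (asm) ennreal_le_iff) auto
qed

definition gauss :: "'i set \<Rightarrow> ('i \<Rightarrow> real) \<Rightarrow> real \<Rightarrow> ('i \<Rightarrow> real) measure" where
  "gauss I m \<sigma> = (\<Pi>\<^sub>M i\<in>I. density lborel (normal_density (m i) \<sigma>))"

lemma sets_gauss [measurable_cong]: "sets (gauss I m \<sigma>) = sets (\<Pi>\<^sub>M i\<in>I. lborel)"
  unfolding gauss_def by (intro sets_PiM_cong) auto

lemma space_gauss: "space (gauss I m \<sigma>) = space (\<Pi>\<^sub>M i\<in>I. lborel)"
  by (rule sets_eq_imp_space_eq[OF sets_gauss])

lemma prob_space_gauss: "0 < \<sigma> \<Longrightarrow> prob_space (gauss I m \<sigma>)"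
  unfolding gauss_def by (intro prob_space_PiM prob_space_normal_density)

lemma product_prob_space_normal: "0 < \<sigma> \<Longrightarrow> product_prob_space (\<lambda>i. density lborel (normal_density (m i) \<sigma>))"
  by (intro product_prob_spaceI prob_space_normal_density)

lemma gauss_density:
  assumes "finite I" "0 < \<sigma>"
  shows "gauss I m \<sigma> = density (\<Pi>\<^sub>M i\<in>I. lborel) (\<lambda>x. ennreal (\<Prod>i\<in>I. normal_density (m i) \<sigma> (x i)))"
proof -
  interpret N: product_prob_space "\<lambda>i. density lborel (normal_density (m i) \<sigma>)" I
    by (rule product_prob_space_normal) fact
  interpret L: product_sigma_finite "\<lambda>_. lborel :: real measure"
    by unfold_locales
  have "density (\<Pi>\<^sub>M i\<in>I. lborel) (\<lambda>x. ennreal (\<Prod>i\<in>I. normal_density (m i) \<sigma> (x i))) = gauss I m \<sigma>"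
    unfolding gauss_def
  proof (rule N.PiM_eqI[OF \<open>finite I\<close>])
    show "sets (density (\<Pi>\<^sub>M i\<in>I. lborel) (\<lambda>x. ennreal (\<Prod>i\<in>I. normal_density (m i) \<sigma> (x i))))
      = sets (\<Pi>\<^sub>M i\<in>I. density lborel (normal_density (m i) \<sigma>))"
      using sets_gauss[of I m \<sigma>] unfolding gauss_def by simp
    fix A assume "\<And>i. i \<in> I \<Longrightarrow> A i \<in> sets (density lborel (normal_density (m i) \<sigma>))"
    then have A: "\<And>i. i \<in> I \<Longrightarrow> A i \<in> sets borel" by simp
    have "emeasure (density (\<Pi>\<^sub>M i\<in>I. lborel) (\<lambda>x. ennreal (\<Prod>i\<in>I. normal_density (m i) \<sigma> (x i)))) (Pi\<^sub>E I A)
       = (\<integral>\<^sup>+x. ennreal (\<Prod>i\<in>I. normal_density (m i) \<sigma> (x i)) * indicator (Pi\<^sub>E I A) x \<partial>(\<Pi>\<^sub>M i\<in>I. lborel))"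
      using A assms by (intro emeasure_density) (auto intro!: sets_PiM_I_finite)
    also have "\<dots> = (\<integral>\<^sup>+x. (\<Prod>i\<in>I. ennreal (normal_density (m i) \<sigma> (x i)) * indicator (A i) (x i)) \<partial>(\<Pi>\<^sub>M i\<in>I. lborel))"
    proof (rule nn_integral_cong)
      fix x assume x: "x \<in> space (\<Pi>\<^sub>M i\<in>I. lborel :: real measure)"
      have "indicator (Pi\<^sub>E I A) x = (\<Prod>i\<in>I. indicator (A i) (x i) :: ennreal)"
      proof (cases "x \<in> Pi\<^sub>E I A")
        case False
        then obtain i where "i \<in> I" "x i \<notin> A i" using x by (auto simp: space_PiM PiE_def Pi_def)
        then have "(\<Prod>i\<in>I. indicator (A i) (x i) :: ennreal) = 0"
          using assms(1) by (intro prod_zero) (auto intro!: bexI[of _ i])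
        with False show ?thesis by simp
      qed (auto simp: PiE_def Pi_def)
      then show "ennreal (\<Prod>i\<in>I. normal_density (m i) \<sigma> (x i)) * indicator (Pi\<^sub>E I A) x
        = (\<Prod>i\<in>I. ennreal (normal_density (m i) \<sigma> (x i)) * indicator (A i) (x i))"
        by (simp add: prod.distrib prod_ennreal)
    qed
    also have "\<dots> = (\<Prod>i\<in>I. \<integral>\<^sup>+x. ennreal (normal_density (m i) \<sigma> x) * indicator (A i) x \<partial>lborel)"
      using A assms(1) by (intro L.product_nn_integral_prod) auto
    also have "\<dots> = (\<Prod>i\<in>I. emeasure (density lborel (normal_density (m i) \<sigma>)) (A i))"
      using A by (intro prod.cong refl emeasure_density[symmetric]) auto
    finally show "emeasure (density (\<Pi>\<^sub>M i\<in>I. lborel) (\<lambda>x. ennreal (\<Prod>i\<in>I. normal_density (m i) \<sigma> (x i)))) (Pi\<^sub>E I A)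
       = (\<Prod>i\<in>I. emeasure (density lborel (normal_density (m i) \<sigma>)) (A i))" .
  qed
  then show ?thesis ..
qed

lemma prod_normal_density:
  assumes "finite I" "0 < \<sigma>"
  shows "(\<Prod>i\<in>I. normal_density (m i) \<sigma> (x i))
       = (1 / sqrt (2 * pi * \<sigma>\<^sup>2)) ^ card I * exp (- (\<Sum>i\<in>I. (x i - m i)\<^sup>2) / (2 * \<sigma>\<^sup>2))"
proof -
  have "(\<Prod>i\<in>I. exp (- (x i - m i)\<^sup>2 / (2 * \<sigma>\<^sup>2))) = exp (- (\<Sum>i\<in>I. (x i - m i)\<^sup>2) / (2 * \<sigma>\<^sup>2))"
    using assms by (simp add: sum_divide_distrib sum_negf flip: exp_sum)
  then show ?thesis
    unfolding normal_density_def by (simp only: prod.distrib prod_constant)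
qed

lemma gauss_box:
  assumes I: "finite I" and \<sigma>: "0 < \<sigma>"
  shows "measure (gauss I m \<sigma>) {x \<in> space (gauss I m \<sigma>). \<forall>i\<in>I. \<bar>x i - m i\<bar> \<le> r i}
       = (\<Prod>i\<in>I. normal_prob (r i / \<sigma>))"
proof -
  interpret N: product_prob_space "\<lambda>i. density lborel (normal_density (m i) \<sigma>)" I
    by (rule product_prob_space_normal) fact
  interpret N: finite_product_prob_space "\<lambda>i. density lborel (normal_density (m i) \<sigma>)" I
    by unfold_locales fact
  have "{x \<in> space (gauss I m \<sigma>). \<forall>i\<in>I. \<bar>x i - m i\<bar> \<le> r i} = (\<Pi>\<^sub>E i\<in>I. {x. \<bar>x - m i\<bar> \<le> r i})"
    by (auto simp: space_gauss space_PiM PiE_def Pi_def)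
  then show ?thesis
    unfolding gauss_def
    by (simp add: N.prob_times measure_normal_centered[OF \<sigma>])
qed

text \<open>
  A Chernoff bound: the exponential moments of the squared coordinates multiply to \<open>(sqrt 2) ^ card I\<close>.
  Taken at a multiple of \<open>card I * ln n\<close>, the bound produces the probabilities \<open>n\<close> to the power \<open>-2\<^sup>J\<close>.
\<close>

lemma gauss_square_tail:
  assumes I: "finite I" and \<sigma>: "0 < \<sigma>"
  shows "measure (gauss I m \<sigma>) {x \<in> space (gauss I m \<sigma>). t * \<sigma>\<^sup>2 \<le> (\<Sum>i\<in>I. (x i - m i)\<^sup>2)}
       \<le> sqrt 2 ^ card I * exp (- t / 4)"
proof -
  interpret N: product_prob_space "\<lambda>i. density lborel (normal_density (m i) \<sigma>)" I
    by (rule product_prob_space_normal) fact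
  interpret G: prob_space "gauss I m \<sigma>" by (rule prob_space_gauss) fact
  define u where "u x = (\<Prod>i\<in>I. ennreal (exp ((x i - m i)\<^sup>2 / (4 * \<sigma>\<^sup>2))))" for x :: "'a \<Rightarrow> real"
  have u_eq: "u x = ennreal (exp ((\<Sum>i\<in>I. (x i - m i)\<^sup>2) / (4 * \<sigma>\<^sup>2)))" for x
    unfolding u_def using I by (simp add: prod_ennreal exp_sum sum_divide_distrib)
  have [measurable]: "u \<in> borel_measurable (gauss I m \<sigma>)"
    unfolding u_def using I by measurable
  have Eu: "(\<integral>\<^sup>+x. u x \<partial>gauss I m \<sigma>) = ennreal (sqrt 2 ^ card I)"
  proof -
    have "(\<integral>\<^sup>+x. u x \<partial>gauss I m \<sigma>)
        = (\<Prod>i\<in>I. \<integral>\<^sup>+x. ennreal (exp ((x - m i)\<^sup>2 / (4 * \<sigma>\<^sup>2))) \<partial>density lborel (normal_density (m i) \<sigma>))"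
      unfolding gauss_def u_def using I by (intro N.product_nn_integral_prod) auto
    also have "\<dots> = ennreal (sqrt 2 ^ card I)"
      unfolding nn_integral_normal_exp_square[OF \<sigma>] by (simp add: ennreal_power)
    finally show ?thesis .
  qed
  have "{x \<in> space (gauss I m \<sigma>). t * \<sigma>\<^sup>2 \<le> (\<Sum>i\<in>I. (x i - m i)\<^sup>2)}
      = {x \<in> space (gauss I m \<sigma>). 1 \<le> ennreal (exp (- t / 4)) * u x}"
    using \<sigma> unfolding u_eq
    by (auto simp: field_simps simp flip: ennreal_mult ennreal_1 exp_add)
  then have "emeasure (gauss I m \<sigma>) {x \<in> space (gauss I m \<sigma>). t * \<sigma>\<^sup>2 \<le> (\<Sum>i\<in>I. (x i - m i)\<^sup>2)}
      \<le> ennreal (exp (- t / 4)) * (\<integral>\<^sup>+x. u x * indicator (space (gauss I m \<sigma>)) x \<partial>gauss I m \<sigma>)"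
    using nn_integral_Markov_inequality[of u "space (gauss I m \<sigma>)" "gauss I m \<sigma>" "ennreal (exp (- t / 4))"] by simp
  also have "\<dots> = ennreal (exp (- t / 4)) * (\<integral>\<^sup>+x. u x \<partial>gauss I m \<sigma>)"
    by (intro arg_cong2[where f="(*)"] refl nn_integral_cong) auto
  also have "\<dots> = ennreal (sqrt 2 ^ card I * exp (- t / 4))"
    unfolding Eu by (simp add: ennreal_mult mult.commute)
  finally show ?thesis
    by (simp add: G.emeasure_eq_measure)
qed

lemma normal_prob_tail_upper: "0 \<le> t \<Longrightarrow> 1 - normal_prob t \<le> sqrt 2 * exp (- t\<^sup>2 / 4)"
proof -
  assume t: "0 \<le> t"
  interpret G: prob_space "gauss {()} (\<lambda>_. 0) 1" by (rule prob_space_gauss) simp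
  have "1 - normal_prob t = 1 - G.prob {x \<in> space (gauss {()} (\<lambda>_. 0) 1). \<forall>i\<in>{()}. \<bar>x i - 0\<bar> \<le> t}"
    by (subst gauss_box) auto
  also have "\<dots> = G.prob (space (gauss {()} (\<lambda>_. 0) 1) - {x \<in> space (gauss {()} (\<lambda>_. 0) 1). \<forall>i\<in>{()}. \<bar>x i - 0\<bar> \<le> t})"
    by (subst G.prob_compl) auto
  also have "\<dots> \<le> G.prob {x \<in> space (gauss {()} (\<lambda>_. 0) 1). t\<^sup>2 * 1\<^sup>2 \<le> (\<Sum>i\<in>{()}. (x i - 0)\<^sup>2)}"
    using t by (intro G.finite_measure_mono) (auto intro!: power2_le_iff_abs_le[THEN iffD2] simp: abs_le_square_iff[symmetric])
  also have "\<dots> \<le> sqrt 2 ^ card {()} * exp (- t\<^sup>2 / 4)"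
    by (rule gauss_square_tail) auto
  finally show ?thesis by simp
qed

lemma char_normal_measure:
  assumes "0 \<le> v"
  shows "(\<integral>x. iexp x \<partial>normal_measure v) = of_real (exp (- v / 2))"
proof (cases "v = 0")
  case True
  then show ?thesis by (simp add: normal_measure_def integral_return)
next
  case False
  with assms have v: "0 < sqrt v" by simp
  have "(\<integral>x. iexp x \<partial>normal_measure v) = (\<integral>x. iexp (sqrt v * x) \<partial>std_normal_distribution)"
    using False unfolding normal_measure_def
    by (simp add: normal_distribution_affine[OF v] integral_distr)
  also have "\<dots> = char std_normal_distribution (sqrt v)"
    unfolding char_def ..
  also have "\<dots> = of_real (exp (- v / 2))"
    unfolding char_std_normal_distribution using assms by simp
  finally show ?thesis .
qed

text \<open>
  A Cramer--Wold argument: the laws of all linear combinations determine the joint characteristic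
  function, which factorises.
\<close>

lemma (in prob_space) distr_gaussian_vector:
  fixes Z :: "'i \<Rightarrow> 'a \<Rightarrow> real"
  assumes I: "finite I" and \<sigma>: "0 < \<sigma>" and Z: "\<And>i. i \<in> I \<Longrightarrow> Z i \<in> borel_measurable M"
    and law: "\<And>s. distr M borel (\<lambda>\<omega>. \<Sum>i\<in>I. s i * Z i \<omega>) = normal_measure (\<Sum>i\<in>I. (s i)\<^sup>2)"
  shows "distr M (\<Pi>\<^sub>M i\<in>I. borel) (\<lambda>\<omega>. \<lambda>i\<in>I. m i + \<sigma> * Z i \<omega>) = gauss I m \<sigma>"
proof -
  note Z [measurable]
  define X where "X i \<omega> = m i + \<sigma> * Z i \<omega>" for i \<omega>
  have X [measurable]: "X i \<in> borel_measurable M" if "i \<in> I" for i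
    using that unfolding X_def by measurable
  have char_lin: "(\<integral>\<omega>. iexp (\<Sum>i\<in>I. s i * Z i \<omega>) \<partial>M) = of_real (exp (- (\<Sum>i\<in>I. (s i)\<^sup>2) / 2))" for s
  proof -
    have "(\<integral>\<omega>. iexp (\<Sum>i\<in>I. s i * Z i \<omega>) \<partial>M) = (\<integral>x. iexp x \<partial>distr M borel (\<lambda>\<omega>. \<Sum>i\<in>I. s i * Z i \<omega>))"
      using I by (subst integral_distr) auto
    also have "\<dots> = of_real (exp (- (\<Sum>i\<in>I. (s i)\<^sup>2) / 2))"
      unfolding law by (rule char_normal_measure) (simp add: sum_nonneg)
    finally show ?thesis .
  qed
  have char_X: "(\<integral>\<omega>. iexp (s * X i \<omega>) \<partial>M) = iexp (s * m i) * of_real (exp (- (s * \<sigma>)\<^sup>2 / 2))" if "i \<in> I" for i s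
  proof -
    have "(\<integral>\<omega>. iexp (s * X i \<omega>) \<partial>M)
        = (\<integral>\<omega>. iexp (s * m i) * iexp (\<Sum>j\<in>I. (if j = i then s * \<sigma> else 0) * Z j \<omega>) \<partial>M)"
    proof (intro Bochner_Integration.integral_cong refl)
      fix \<omega>
      have "(\<Sum>j\<in>I. (if j = i then s * \<sigma> else 0) * Z j \<omega>) = s * \<sigma> * Z i \<omega>"
        using I that by (simp add: if_distrib[of "\<lambda>x. x * _"] cong: if_cong)
      then show "iexp (s * X i \<omega>) = iexp (s * m i) * iexp (\<Sum>j\<in>I. (if j = i then s * \<sigma> else 0) * Z j \<omega>)"
        unfolding X_def by (simp add: algebra_simps flip: exp_add)
    qed
    also have "\<dots> = iexp (s * m i) * of_real (exp (- (\<Sum>j\<in>I. (if j = i then s * \<sigma> else 0)\<^sup>2) / 2))"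
      unfolding integral_mult_right_zero char_lin ..
    also have "(\<Sum>j\<in>I. (if j = i then s * \<sigma> else 0)\<^sup>2) = (s * \<sigma>)\<^sup>2"
      using I that by (simp add: if_distrib[of "\<lambda>x. x\<^sup>2"] cong: if_cong)
    finally show ?thesis .
  qed
  have fac: "(\<integral>\<omega>. (\<Prod>i\<in>I. iexp (s i * X i \<omega>)) \<partial>M) = (\<Prod>i\<in>I. \<integral>\<omega>. iexp (s i * X i \<omega>) \<partial>M)" for s
  proof -
    have "(\<Prod>i\<in>I. iexp (s i * X i \<omega>)) = iexp (\<Sum>i\<in>I. s i * m i) * iexp (\<Sum>i\<in>I. (s i * \<sigma>) * Z i \<omega>)" for \<omega>
      unfolding X_def using I
      by (simp add: algebra_simps sum.distrib sum_distrib_left flip: exp_sum exp_add)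
    then have "(\<integral>\<omega>. (\<Prod>i\<in>I. iexp (s i * X i \<omega>)) \<partial>M)
        = iexp (\<Sum>i\<in>I. s i * m i) * of_real (exp (- (\<Sum>i\<in>I. (s i * \<sigma>)\<^sup>2) / 2))"
      by (simp only: integral_mult_right_zero char_lin)
    also have "\<dots> = (\<Prod>i\<in>I. iexp (s i * m i)) * (\<Prod>i\<in>I. of_real (exp (- (s i * \<sigma>)\<^sup>2 / 2)))"
      using I by (simp add: sum_distrib_left sum_negf sum_divide_distrib flip: exp_sum of_real_prod)
    also have "\<dots> = (\<Prod>i\<in>I. \<integral>\<omega>. iexp (s i * X i \<omega>) \<partial>M)"
      unfolding prod.distrib[symmetric] by (intro prod.cong refl char_X[symmetric])
    finally show ?thesis .
  qed
  have marg: "distr M borel (X i) = density lborel (normal_density (m i) \<sigma>)" if i: "i \<in> I" for i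
  proof -
    have "distr M borel (Z i) = distr M borel (\<lambda>\<omega>. \<Sum>j\<in>I. (if j = i then 1 else 0) * Z j \<omega>)"
      using I i by (intro distr_cong) (auto simp: if_distrib[of "\<lambda>x. x * _"] cong: if_cong)
    also have "\<dots> = normal_measure (\<Sum>j\<in>I. (if j = i then 1 else 0)\<^sup>2)"
      by (rule law)
    also have "(\<Sum>j\<in>I. (if j = i then 1 else 0)\<^sup>2) = (1::real)"
      using I i by (simp add: if_distrib[of "\<lambda>x. x\<^sup>2"] cong: if_cong)
    finally have "distr M borel (Z i) = std_normal_distribution"
      by (simp add: normal_measure_def)
    moreover have "distr M borel (X i) = distr (distr M borel (Z i)) borel (\<lambda>x. m i + \<sigma> * x)"
      using i by (subst distr_distr) (auto simp: X_def[abs_def] comp_def)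
    ultimately show ?thesis
      by (simp add: normal_distribution_affine[OF \<sigma>])
  qed
  have "distr M (\<Pi>\<^sub>M i\<in>I. borel) (\<lambda>\<omega>. \<lambda>i\<in>I. X i \<omega>) = (\<Pi>\<^sub>M i\<in>I. distr M borel (X i))"
    by (rule distr_eq_PiM_if_char_factorizes[OF I X fac])
  also have "\<dots> = gauss I m \<sigma>"
    unfolding gauss_def by (intro PiM_cong) (auto simp: marg)
  finally show ?thesis unfolding X_def .
qed

section \<open>The Gaussian approximation of the posterior\<close>

text \<open>
  Restricted to \<open>S\<close>, the density \<open>f\<close> stays within the factor \<open>\<theta>\<close> of its average over \<open>S\<close>, so the two
  measures conditioned on \<open>S\<close> differ by at most \<open>1 - \<theta>\<close>; leaving \<open>S\<close> costs its complement under both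
  measures. It suffices to bound \<open>prob B - measure D B\<close> for every \<open>B\<close>, since passing to complements reverses the
  sign; this is why \<open>1 - \<theta>\<close> enters with the factor 1.
\<close>

lemma (in prob_space) density_total_variation_le:
  fixes f :: "'a \<Rightarrow> real"
  assumes f [measurable]: "f \<in> borel_measurable M" and f0: "\<And>x. x \<in> space M \<Longrightarrow> 0 \<le> f x"
    and P: "prob_space (density M (\<lambda>x. ennreal (f x)))"
    and S [measurable]: "S \<in> sets M"
    and \<theta>: "0 \<le> \<theta>" "\<theta> \<le> 1"
    and flat: "\<And>x y. x \<in> S \<Longrightarrow> y \<in> S \<Longrightarrow> \<theta> * f x \<le> f y"
    and A [measurable]: "A \<in> sets M"
  shows "\<bar>measure (density M (\<lambda>x. ennreal (f x))) A - prob A\<bar>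
     \<le> (1 - \<theta>) + measure (density M (\<lambda>x. ennreal (f x))) (space M - S) + prob (space M - S)"
proof -
  define D where "D = density M (\<lambda>x. ennreal (f x))"
  have sets_D: "sets D = sets M" and space_D: "space D = space M" by (simp_all add: D_def)
  interpret D: prob_space D unfolding D_def by (rule P)
  have D_int: "measure D B = (\<integral>x. f x * indicator B x \<partial>M)" if [measurable]: "B \<in> sets M" for B
  proof -
    have "measure D B = (\<integral>x. indicator B x \<partial>D)"
      using sets.sets_into_space[OF that] by (simp add: space_D Int_absorb2 sets_D)
    also have "\<dots> = (\<integral>x. f x * indicator B x \<partial>M)"
      unfolding D_def using f0 by (subst integral_density) auto
    finally show ?thesis .
  qed
  have intf: "integrable M f"
  proof (rule integrableI_nonneg)
    have "(\<integral>\<^sup>+x. ennreal (f x) \<partial>M) = emeasure D (space D)"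
      unfolding D_def by (simp add: emeasure_density cong: nn_integral_cong)
    then show "(\<integral>\<^sup>+x. ennreal (f x) \<partial>M) < \<infinity>" by (simp add: D.emeasure_space_1)
  qed (use f0 in auto)
  have intfB: "integrable M (\<lambda>x. f x * indicator B x)" if [measurable]: "B \<in> sets M" for B
    using intf by (intro integrable_real_mult_indicator) auto
  have half: "prob B - measure D B \<le> (1 - \<theta>) + measure D (space M - S) + prob (space M - S)"
    if B [measurable]: "B \<in> sets M" for B
  proof -
    have pointwise: "\<theta> * measure D S \<le> f y * prob S" if y: "y \<in> S" for y
    proof -
      have "\<theta> * measure D S = (\<integral>x. \<theta> * (f x * indicator S x) \<partial>M)"
        by (simp add: D_int)
      also have "\<dots> \<le> (\<integral>x. f y * indicator S x \<partial>M)"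
        using flat[OF _ y] by (intro integral_mono intfB integrable_mult_right integrable_real_indicator) (auto simp: indicator_def less_top[symmetric])
      also have "\<dots> = f y * prob S"
        by simp
      finally show ?thesis .
    qed
    have "\<theta> * measure D S * prob (B \<inter> S) = (\<integral>x. \<theta> * measure D S * indicator (B \<inter> S) x \<partial>M)"
      by simp
    also have "\<dots> \<le> (\<integral>x. prob S * (f x * indicator (B \<inter> S) x) \<partial>M)"
      using pointwise by (intro integral_mono intfB integrable_mult_right integrable_real_indicator) (auto simp: indicator_def mult.commute less_top[symmetric])
    also have "\<dots> = prob S * measure D (B \<inter> S)"
      by (simp add: D_int)
    also have "\<dots> \<le> measure D (B \<inter> S)"
      by (simp add: mult_left_le_one_le)
    also have "\<dots> \<le> measure D B"
      by (intro D.finite_measure_mono) (auto simp: sets_D)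
    finally have 1: "\<theta> * measure D S * prob (B \<inter> S) \<le> measure D B" .
    have 2: "measure D S = 1 - measure D (space M - S)"
      using D.prob_compl[of S] by (simp add: sets_D space_D)
    have "prob B \<le> prob ((B \<inter> S) \<union> (space M - S))"
      using sets.sets_into_space[OF B] by (intro finite_measure_mono) auto
    also have "\<dots> \<le> prob (B \<inter> S) + prob (space M - S)"
      by (intro measure_Un_le) auto
    finally have 3: "prob B \<le> prob (B \<inter> S) + prob (space M - S)" .
    define q where "q = measure D (space M - S)"
    have q: "0 \<le> q" "q \<le> 1" unfolding q_def by simp_all
    have "(1 - \<theta> * (1 - q)) * prob (B \<inter> S) \<le> (1 - \<theta> * (1 - q)) * 1"
      using \<theta> q by (intro mult_left_mono) (auto intro: mult_le_one)
    also have "\<dots> \<le> (1 - \<theta>) + q"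
      using mult_right_mono[OF \<theta>(2) q(1)] by (simp add: algebra_simps)
    finally have "prob (B \<inter> S) - \<theta> * (1 - q) * prob (B \<inter> S) \<le> (1 - \<theta>) + q"
      by (simp add: algebra_simps)
    then show ?thesis using 1 3 unfolding 2 q_def[symmetric] by linarith
  qed
  have "measure D A - prob A = prob (space M - A) - measure D (space M - A)"
    using prob_compl[OF A] D.prob_compl[of A] by (simp add: sets_D space_D)
  then show ?thesis
    using half[OF A] half[of "space M - A"] unfolding D_def[symmetric] by (simp add: abs_le_iff)
qed

lemma finite_idx [simp]: "finite (idx J0 J)"
proof -
  have "idx J0 J \<subseteq> (\<Union>l<J. {l} \<times> {..<2 ^ l}) \<union> {J0 - 1} \<times> {..<2 ^ J0}"
    by (auto simp: idx_def)
  then show ?thesis by (rule finite_subset) auto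
qed

text \<open>
  The level \<open>J0 - 1\<close> carries the \<open>2 ^ J0\<close> scaling functions, hence its separate weight.
\<close>

lemma sum_idx:
  fixes g :: "nat \<Rightarrow> 'b::semiring_1"
  assumes "1 \<le> J0" "J0 \<le> J"
  shows "(\<Sum>i\<in>idx J0 J. g (fst i)) = 2 ^ J0 * g (J0 - 1) + (\<Sum>l=J0..<J. 2 ^ l * g l)"
proof -
  have "idx J0 J = {J0 - 1} \<times> {..<(2::nat) ^ J0} \<union> (SIGMA l:{J0..<J}. {..<(2::nat) ^ l})"
    by (auto simp: idx_def)
  moreover have "({J0 - 1} \<times> {..<(2::nat) ^ J0}) \<inter> (SIGMA l:{J0..<J}. {..<(2::nat) ^ l}) = {}"
    using assms by auto
  ultimately have "(\<Sum>i\<in>idx J0 J. g (fst i))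
     = (\<Sum>i\<in>{J0 - 1} \<times> {..<(2::nat) ^ J0}. g (fst i)) + (\<Sum>i\<in>(SIGMA l:{J0..<J}. {..<(2::nat) ^ l}). g (fst i))"
    by (simp add: sum.union_disjoint)
  also have "(\<Sum>i\<in>{J0 - 1} \<times> {..<(2::nat) ^ J0}. g (fst i)) = 2 ^ J0 * g (J0 - 1)"
    by (simp add: sum.cartesian_product' flip: sum.cartesian_product)
  also have "(\<Sum>i\<in>(SIGMA l:{J0..<J}. {..<(2::nat) ^ l}). g (fst i)) = (\<Sum>l=J0..<J. \<Sum>k<(2::nat) ^ l. g l)"
    by (subst sum.Sigma) (auto simp: case_prod_beta)
  also have "\<dots> = (\<Sum>l=J0..<J. 2 ^ l * g l)" by simp
  finally show ?thesis .
qed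

lemma card_idx:
  assumes "1 \<le> J0" "J0 \<le> J"
  shows "card (idx J0 J) = 2 ^ J"
proof -
  have "card (idx J0 J) = (2::nat) ^ J0 + (\<Sum>l=J0..<J. 2 ^ l)"
    using sum_idx[OF assms, of "\<lambda>_. 1::nat"] by simp
  also have "\<dots> = 2 ^ J"
    using assms(2) by (induction J rule: dec_induct) auto
  finally show ?thesis .
qed

text \<open>
  Where the density vanishes at \<open>\<beta>\<close>, the flatness inequality is trivial, so the convention for division
  by zero is harmless.
\<close>

lemma prior_modulus_flat:
  assumes prior: "sieve_prior J0 J \<pi>"
    and \<beta>: "\<beta> \<in> sieve_ball J0 J n \<beta>0 R" "\<beta>' \<in> sieve_ball J0 J n \<beta>0 R"
  shows "(1 - prior_modulus J0 J n \<pi> \<beta>0 R) * \<pi> \<beta> \<le> \<pi> \<beta>'"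
    and "0 \<le> prior_modulus J0 J n \<pi> \<beta>0 R" and "prior_modulus J0 J n \<pi> \<beta>0 R \<le> 1"
proof -
  let ?S = "sieve_ball J0 J n \<beta>0 R"
  let ?f = "\<lambda>(\<beta>, \<beta>'). \<pi> \<beta>' / \<pi> \<beta>"
  have \<pi>0: "0 \<le> \<pi> b" if "b \<in> ?S" for b
    using prior that unfolding sieve_prior_def sieve_ball_def by auto
  have bdd: "bdd_below (?f ` (?S \<times> ?S))"
    by (intro bdd_belowI2[where m=0]) (auto intro!: divide_nonneg_nonneg \<pi>0)
  have inf: "(INF z\<in>?S \<times> ?S. ?f z) \<le> \<pi> b' / \<pi> b" if "b \<in> ?S" "b' \<in> ?S" for b b'
    using cINF_lower[OF bdd, of "(b, b')"] that by simp
  show "(1 - prior_modulus J0 J n \<pi> \<beta>0 R) * \<pi> \<beta> \<le> \<pi> \<beta>'"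
  proof (cases "\<pi> \<beta> = 0")
    case False
    then have "0 < \<pi> \<beta>" using \<pi>0[OF \<beta>(1)] by simp
    then show ?thesis
      using inf[OF \<beta>] unfolding prior_modulus_def by (simp add: pos_le_divide_eq)
  qed (use \<pi>0[OF \<beta>(2)] in simp)
  have "(INF z\<in>?S \<times> ?S. ?f z) \<le> 1"
    using inf[OF \<beta>(1) \<beta>(1)] by (cases "\<pi> \<beta> = 0") auto
  then show "0 \<le> prior_modulus J0 J n \<pi> \<beta>0 R"
    unfolding prior_modulus_def by simp
  have "0 \<le> (INF z\<in>?S \<times> ?S. ?f z)"
    using \<beta> by (intro cINF_greatest) (auto intro!: divide_nonneg_nonneg \<pi>0)
  then show "prior_modulus J0 J n \<pi> \<beta>0 R \<le> 1"
    unfolding prior_modulus_def by simp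
qed

lemma sieve_ball_sets [measurable]: "sieve_ball J0 J n \<beta>0 R \<in> sets (sieve_space J0 J)"
  unfolding sieve_ball_def L2_set_def sieve_space_def by measurable

lemma sets_gauss_idx: "sets (gauss (idx J0 J) m \<sigma>) = sets (sieve_space J0 J)"
  unfolding sieve_space_def by (rule sets_gauss)

lemma space_gauss_idx: "space (gauss (idx J0 J) m \<sigma>) = space (sieve_space J0 J)"
  unfolding sieve_space_def by (rule space_gauss)

lemma sqrt2_power_exp_le:
  assumes "2 \<le> (n::nat)"
  shows "sqrt 2 ^ p * exp (- (6 * real p * ln n) / 4) \<le> real n powr (- real p)"
proof -
  have "sqrt 2 \<le> exp (ln n / 2)"
  proof -
    have "exp (ln (real n) / 2) ^ 2 = real n"
      using assms by (simp flip: exp_double)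
    then have "exp (ln (real n) / 2) = sqrt n"
      by (metis exp_ge_zero real_sqrt_unique)
    then show ?thesis using assms by simp
  qed
  then have "sqrt 2 ^ p \<le> exp (ln n / 2) ^ p" by (intro power_mono) auto
  also have "\<dots> = exp (real p * ln n / 2)" by (simp flip: exp_of_nat_mult)
  finally have "sqrt 2 ^ p * exp (- (6 * real p * ln n) / 4)
      \<le> exp (real p * ln n / 2) * exp (- (6 * real p * ln n) / 4)"
    by (intro mult_right_mono) auto
  also have "\<dots> = real n powr (- real p)"
    using assms by (simp add: powr_def flip: exp_add)
  finally show ?thesis .
qed

text \<open>
  The observation lies within \<open>3 * sqrt (L / n)\<close> of the truth, so the triangle inequality takes 3 off the
  radius \<open>C1 + 10\<close>.
\<close>

lemma outside_ball_far_from_observation: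
  assumes n: "2 \<le> (n::nat)" and C1: "0 < C1" and "0 \<le> (L::real)"
    and y: "real n * (\<Sum>i\<in>idx J0 J. (y i - \<beta>0 i)\<^sup>2) \<le> 6 * L"
    and \<beta>: "\<beta> \<in> space (sieve_space J0 J) - sieve_ball J0 J n \<beta>0 ((C1 + 10) * sqrt L)"
  shows "(C1 + 7)\<^sup>2 * L \<le> real n * (\<Sum>i\<in>idx J0 J. (y i - \<beta> i)\<^sup>2)"
proof -
  let ?I = "idx J0 J"
  have n0: "0 < sqrt (real n)" using n by simp
  have "sqrt (real n) * L2_set (\<lambda>i. y i - \<beta>0 i) ?I = sqrt (real n * (\<Sum>i\<in>?I. (y i - \<beta>0 i)\<^sup>2))"
    unfolding L2_set_def by (simp add: real_sqrt_mult)
  also have "\<dots> \<le> sqrt (9 * L)"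
    using y \<open>0 \<le> L\<close> by (intro real_sqrt_le_mono) auto
  also have "\<dots> = 3 * sqrt L" by (simp add: real_sqrt_mult)
  finally have 1: "sqrt (real n) * L2_set (\<lambda>i. y i - \<beta>0 i) ?I \<le> 3 * sqrt L" .
  have "(C1 + 10) * sqrt L / sqrt (real n) \<le> L2_set (\<lambda>i. \<beta> i - \<beta>0 i) ?I"
    using \<beta> unfolding sieve_ball_def by auto
  also have "\<dots> = L2_set (\<lambda>i. (\<beta> i - y i) + (y i - \<beta>0 i)) ?I" by simp
  also have "\<dots> \<le> L2_set (\<lambda>i. \<beta> i - y i) ?I + L2_set (\<lambda>i. y i - \<beta>0 i) ?I"
    by (rule L2_set_triangle_ineq)
  finally have "(C1 + 10) * sqrt L \<le> sqrt (real n) * (L2_set (\<lambda>i. \<beta> i - y i) ?I + L2_set (\<lambda>i. y i - \<beta>0 i) ?I)"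
    using n0 by (simp add: pos_divide_le_eq mult.commute)
  then have "(C1 + 7) * sqrt L \<le> sqrt (real n) * L2_set (\<lambda>i. \<beta> i - y i) ?I"
    using 1 by (simp add: algebra_simps)
  then have "((C1 + 7) * sqrt L)\<^sup>2 \<le> (sqrt (real n) * L2_set (\<lambda>i. \<beta> i - y i) ?I)\<^sup>2"
    using C1 \<open>0 \<le> L\<close> by (intro power_mono) auto
  then show ?thesis
    using \<open>0 \<le> L\<close> unfolding L2_set_def
    by (simp add: power_mult_distrib sum_nonneg power2_commute)
qed

lemma integrable_prior:
  assumes "sieve_prior J0 J \<pi>"
  shows "integrable (sieve_space J0 J) \<pi>" "(\<integral>\<beta>. \<pi> \<beta> \<partial>sieve_space J0 J) = 1"
proof -
  interpret P: prob_space "density (sieve_space J0 J) (\<lambda>\<beta>. ennreal (\<pi> \<beta>))"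
    using assms by (simp add: sieve_prior_def)
  have \<pi> [measurable]: "\<pi> \<in> borel_measurable (sieve_space J0 J)"
    and \<pi>0: "\<And>\<beta>. \<beta> \<in> space (sieve_space J0 J) \<Longrightarrow> 0 \<le> \<pi> \<beta>"
    using assms by (auto simp: sieve_prior_def)
  have "(\<integral>\<^sup>+\<beta>. ennreal (\<pi> \<beta>) \<partial>sieve_space J0 J) = 1"
    using P.emeasure_space_1 by (simp add: emeasure_density cong: nn_integral_cong)
  moreover from this show "integrable (sieve_space J0 J) \<pi>"
    using \<pi>0 by (intro integrableI_nonneg) auto
  ultimately show "(\<integral>\<beta>. \<pi> \<beta> \<partial>sieve_space J0 J) = 1"
    using \<pi>0 by (subst integral_eq_nn_integral) auto
qed

lemma post_weight_props:
  assumes "sieve_prior J0 J \<pi>"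
  shows borel_measurable_post_weight: "post_weight J0 J n \<pi> y \<in> borel_measurable (sieve_space J0 J)"
    and post_weight_nonneg: "\<And>\<beta>. \<beta> \<in> space (sieve_space J0 J) \<Longrightarrow> 0 \<le> post_weight J0 J n \<pi> y \<beta>"
    and integrable_post_weight: "integrable (sieve_space J0 J) (post_weight J0 J n \<pi> y)"
proof -
  have \<pi> [measurable]: "\<pi> \<in> borel_measurable (sieve_space J0 J)"
    and \<pi>0: "\<And>\<beta>. \<beta> \<in> space (sieve_space J0 J) \<Longrightarrow> 0 \<le> \<pi> \<beta>"
    using assms by (auto simp: sieve_prior_def)
  have [measurable]: "(\<lambda>\<beta>. exp (- (real n / 2) * (\<Sum>i\<in>idx J0 J. (y i - \<beta> i)\<^sup>2))) \<in> borel_measurable (sieve_space J0 J)"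
    unfolding sieve_space_def by measurable
  show meas [measurable]: "post_weight J0 J n \<pi> y \<in> borel_measurable (sieve_space J0 J)"
    unfolding post_weight_def[abs_def] by measurable
  show nonneg: "0 \<le> post_weight J0 J n \<pi> y \<beta>" if "\<beta> \<in> space (sieve_space J0 J)" for \<beta>
    using \<pi>0[OF that] by (simp add: post_weight_def)
  have le: "post_weight J0 J n \<pi> y \<beta> \<le> \<pi> \<beta>" if "\<beta> \<in> space (sieve_space J0 J)" for \<beta>
    unfolding post_weight_def using \<pi>0[OF that] by (intro mult_left_le) (auto intro!: mult_nonneg_nonneg sum_nonneg)
  show "integrable (sieve_space J0 J) (post_weight J0 J n \<pi> y)"
    using nonneg le \<pi>0
    by (intro Bochner_Integration.integrable_bound[OF integrable_prior(1)[OF assms]] AE_I2) auto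
qed

text \<open>
  The prior is at least half its value at the truth on the ball of radius \<open>1 / n\<close>, which contains a cube
  of side \<open>2 / (n * sqrt (2 ^ J)) \<ge> 2 * n powr (- 3 / 2)\<close>. On this cube the Gaussian weight loses at
  most the factor \<open>n\<close> to the power \<open>-7 \<cdot> 2\<^sup>J\<close>. Together with the prior mass condition the exponents add up to
  \<open>1/2 - C1 - 7 - 3/2 = -(C1 + 8)\<close>.
\<close>

lemma normalizer_lower_bound:
  fixes C1 :: real
  assumes J: "1 \<le> J0" "J0 \<le> J" and n: "2 \<le> n" "2 ^ J \<le> n"
    and prior: "sieve_prior J0 J \<pi>"
    and \<beta>0: "\<beta>0 \<in> space (sieve_space J0 J)"
    and mass: "\<pi> \<beta>0 \<ge> real n powr (2 ^ J / 2) * real n powr (- C1 * 2 ^ J)"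
    and small: "prior_modulus J0 J n \<pi> \<beta>0 (1 / sqrt (real n)) \<le> 1 / 2"
    and y: "real n * (\<Sum>i\<in>idx J0 J. (y i - \<beta>0 i)\<^sup>2) \<le> 6 * (2 ^ J * ln n)"
  shows "real n powr (- (C1 + 8) * 2 ^ J) \<le> (\<integral>\<beta>. post_weight J0 J n \<pi> y \<beta> \<partial>sieve_space J0 J)"
proof -
  let ?I = "idx J0 J" and ?L = "sieve_space J0 J"
  interpret L: product_sigma_finite "\<lambda>_. lborel :: real measure" by unfold_locales
  define p where "p = card ?I"
  have p: "p = 2 ^ J" "real p = 2 ^ J" unfolding p_def using J by (simp_all add: card_idx)
  have p1: "1 \<le> real p" unfolding p by simp
  have pn: "real p \<le> real n" using n(2) unfolding p(1) by (simp flip: of_nat_le_iff)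
  have n0: "0 < real n" "1 < real n" using n by auto
  \<comment> \<open>Half the side of the cube: its diagonal equals the diameter of the ball of radius \<open>1 / n\<close>.\<close>
  define h where "h = 1 / (real n * sqrt (real p))"
  have h0: "0 < h" unfolding h_def using n0 p1 by simp
  define Q where "Q = (\<Pi>\<^sub>E i\<in>?I. {\<beta>0 i - h..\<beta>0 i + h})"
  have Q_sets [measurable]: "Q \<in> sets ?L"
    unfolding Q_def sieve_space_def by (intro sets_PiM_I_finite) auto
  have Q_vol: "measure ?L Q = (2 * h) ^ p"
    unfolding Q_def sieve_space_def measure_def using h0
    by (subst L.emeasure_PiM) (auto simp: p_def ennreal_power)
  have Q_fin: "emeasure ?L Q < \<infinity>"
    unfolding Q_def sieve_space_def using h0
    by (subst L.emeasure_PiM) (auto simp: ennreal_power)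
  have Q_close: "(\<Sum>i\<in>?I. (\<beta> i - \<beta>0 i)\<^sup>2) \<le> 1 / (real n)\<^sup>2" if "\<beta> \<in> Q" for \<beta>
  proof -
    have "(\<Sum>i\<in>?I. (\<beta> i - \<beta>0 i)\<^sup>2) \<le> (\<Sum>i\<in>?I. h\<^sup>2)"
    proof (rule sum_mono)
      fix i assume "i \<in> ?I"
      then have "\<beta> i \<in> {\<beta>0 i - h..\<beta>0 i + h}" using that unfolding Q_def by (rule PiE_mem[rotated])
      then have "\<bar>\<beta> i - \<beta>0 i\<bar> \<le> h" by (simp add: abs_le_iff)
      then show "(\<beta> i - \<beta>0 i)\<^sup>2 \<le> h\<^sup>2" using h0 by (simp add: abs_le_square_iff[symmetric])
    qed
    also have "\<dots> = 1 / (real n)\<^sup>2"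
      using p1 n0 unfolding h_def by (simp add: p_def[symmetric] power_divide power_mult_distrib)
    finally show ?thesis .
  qed
  have Q_space: "Q \<subseteq> space ?L" using Q_sets by (rule sets.sets_into_space)
  have L2: "L2_set (\<lambda>i. \<beta> i - \<beta>0 i) ?I \<le> 1 / sqrt (real n) / sqrt (real n)" if "\<beta> \<in> Q" for \<beta>
  proof -
    have "L2_set (\<lambda>i. \<beta> i - \<beta>0 i) ?I \<le> sqrt (1 / (real n)\<^sup>2)"
      unfolding L2_set_def by (intro real_sqrt_le_mono Q_close that)
    also have "\<dots> = 1 / sqrt (real n) / sqrt (real n)"
      using n0 by (simp add: real_sqrt_divide)
    finally show ?thesis .
  qed
  have Q_ball: "Q \<subseteq> sieve_ball J0 J n \<beta>0 (1 / sqrt (real n))"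
    unfolding sieve_ball_def using L2 Q_space by auto
  have \<beta>0_ball: "\<beta>0 \<in> sieve_ball J0 J n \<beta>0 (1 / sqrt (real n))"
    unfolding sieve_ball_def using \<beta>0 by (simp add: L2_set_def)
  have lnn: "1 / 2 \<le> real p * ln n"
  proof -
    have "1 / 2 \<le> ln (2::real)" using ln2_ge_two_thirds by simp
    also have "\<dots> \<le> ln (real n)" using n by simp
    also have "\<dots> \<le> real p * ln n" using p1 n0 by (simp add: mult_le_cancel_right1)
    finally show ?thesis .
  qed
  have W: "\<pi> \<beta>0 / 2 * exp (- (7 * (real p * ln n))) \<le> post_weight J0 J n \<pi> y \<beta>" if \<beta>: "\<beta> \<in> Q" for \<beta>
  proof -
    have "\<pi> \<beta>0 / 2 \<le> (1 - prior_modulus J0 J n \<pi> \<beta>0 (1 / sqrt (real n))) * \<pi> \<beta>0"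
      using small mult_right_mono[of "1/2" "1 - prior_modulus J0 J n \<pi> \<beta>0 (1 / sqrt (real n))" "\<pi> \<beta>0"]
        prior \<beta>0 by (simp add: sieve_prior_def)
    also have "\<dots> \<le> \<pi> \<beta>"
      using Q_ball \<beta> by (intro prior_modulus_flat(1)[OF prior \<beta>0_ball]) auto
    finally have 1: "\<pi> \<beta>0 / 2 \<le> \<pi> \<beta>" .
    have "(\<Sum>i\<in>?I. (y i - \<beta> i)\<^sup>2) \<le> (\<Sum>i\<in>?I. 2 * (y i - \<beta>0 i)\<^sup>2 + 2 * (\<beta> i - \<beta>0 i)\<^sup>2)"
    proof (rule sum_mono)
      fix i
      show "(y i - \<beta> i)\<^sup>2 \<le> 2 * (y i - \<beta>0 i)\<^sup>2 + 2 * (\<beta> i - \<beta>0 i)\<^sup>2"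
        using zero_le_power2[of "(y i - \<beta>0 i) + (\<beta> i - \<beta>0 i)"] by (simp add: power2_eq_square algebra_simps)
    qed
    also have "\<dots> \<le> 2 * (\<Sum>i\<in>?I. (y i - \<beta>0 i)\<^sup>2) + 2 * (1 / (real n)\<^sup>2)"
      using Q_close[OF \<beta>] by (simp add: sum.distrib flip: sum_distrib_left)
    finally have "real n / 2 * (\<Sum>i\<in>?I. (y i - \<beta> i)\<^sup>2)
       \<le> real n / 2 * (2 * (\<Sum>i\<in>?I. (y i - \<beta>0 i)\<^sup>2) + 2 * (1 / (real n)\<^sup>2))"
      using n0 by (intro mult_left_mono) auto
    also have "\<dots> = real n * (\<Sum>i\<in>?I. (y i - \<beta>0 i)\<^sup>2) + 1 / real n"
      using n0 by (simp add: field_simps power2_eq_square)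
    also have "\<dots> \<le> 6 * (real p * ln n) + 1 / 2"
      using y n unfolding p(2) by (intro add_mono) (auto simp: field_simps)
    also have "\<dots> \<le> 7 * (real p * ln n)" using lnn by simp
    finally have 2: "real n / 2 * (\<Sum>i\<in>?I. (y i - \<beta> i)\<^sup>2) \<le> 7 * (real p * ln n)" .
    have \<pi>\<beta>0: "0 \<le> \<pi> \<beta>0" using prior \<beta>0 by (simp add: sieve_prior_def)
    show ?thesis
      unfolding post_weight_def using 1 2 \<pi>\<beta>0 by (intro mult_mono) auto
  qed
  have \<pi>\<beta>0: "0 \<le> \<pi> \<beta>0" using prior \<beta>0 by (simp add: sieve_prior_def)
  \<comment> \<open>One factor 2 of \<open>2 ^ p\<close> is kept to cancel the loss of one half in the prior density.\<close>
  have vol: "real n powr (- 3 / 2 * real p) * 2 \<le> (2 * h) ^ p"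
  proof -
    have "real n powr (- 3 / 2) \<le> h"
    proof -
      have "sqrt (real p) \<le> sqrt (real n)" using pn by simp
      then have "1 / (real n * sqrt (real n)) \<le> h"
        unfolding h_def using n0 p1 by (intro divide_left_mono mult_left_mono) auto
      moreover have "real n powr (3 / 2) = real n powr (1 + 1 / 2)" by simp
      then have "real n powr (3 / 2) = real n * sqrt (real n)"
        unfolding powr_add using n0 by (simp add: powr_half_sqrt)
      ultimately show ?thesis by (simp add: powr_minus_divide)
    qed
    then have "(real n powr (- 3 / 2)) ^ p \<le> h ^ p" by (intro power_mono) auto
    moreover have "(real n powr (- 3 / 2)) ^ p = real n powr (- 3 / 2 * real p)"
      using n0 by (simp add: powr_powr flip: powr_realpow)
    moreover have "(2::real) ^ 1 \<le> 2 ^ p" using p1 by (intro power_increasing) auto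
    ultimately have "2 * real n powr (- 3 / 2 * real p) \<le> 2 ^ p * h ^ p" by (intro mult_mono) auto
    then show ?thesis by (simp add: power_mult_distrib mult.commute)
  qed
  have "real n powr (- (C1 + 8) * 2 ^ J)
      = real n powr (2 ^ J / 2) * real n powr (- C1 * 2 ^ J) * real n powr (- 7 * 2 ^ J) * real n powr (- 3 / 2 * 2 ^ J)"
    unfolding powr_add[symmetric] by (rule arg_cong[where f="(powr) (real n)"]) (simp add: algebra_simps)
  also have "\<dots> \<le> \<pi> \<beta>0 * real n powr (- 7 * 2 ^ J) * real n powr (- 3 / 2 * 2 ^ J)"
    using mass by (intro mult_right_mono) auto
  also have "\<dots> = \<pi> \<beta>0 / 2 * exp (- (7 * (real p * ln n))) * (real n powr (- 3 / 2 * real p) * 2)"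
    using n0 unfolding p(2) by (simp add: powr_def mult_ac)
  also have "\<dots> \<le> \<pi> \<beta>0 / 2 * exp (- (7 * (real p * ln n))) * (2 * h) ^ p"
    using \<pi>\<beta>0 vol by (intro mult_left_mono) auto
  also have "\<dots> = (\<integral>\<beta>. \<pi> \<beta>0 / 2 * exp (- (7 * (real p * ln n))) * indicator Q \<beta> \<partial>?L)"
    using Q_space by (simp add: Q_vol Int_absorb2)
  also have "\<dots> \<le> (\<integral>\<beta>. post_weight J0 J n \<pi> y \<beta> \<partial>?L)"
    using W Q_fin post_weight_nonneg[OF prior] integrable_post_weight[OF prior]
    by (intro integral_mono integrable_mult_right integrable_real_indicator) (auto simp: indicator_def)
  finally show ?thesis .
qed

lemma posterior_eq_density_gauss:
  assumes n: "2 \<le> n" and prior: "sieve_prior J0 J \<pi>"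
  shows "posterior J0 J n \<pi> y = density (gauss (idx J0 J) y (1 / sqrt (real n)))
     (\<lambda>\<beta>. ennreal (\<pi> \<beta> / ((1 / sqrt (2 * pi / real n)) ^ card (idx J0 J) *
        (\<integral>b. post_weight J0 J n \<pi> y b \<partial>sieve_space J0 J))))"
proof -
  let ?I = "idx J0 J" and ?L = "sieve_space J0 J" and ?\<sigma> = "1 / sqrt (real n)"
  define Z where "Z = (\<integral>b. post_weight J0 J n \<pi> y b \<partial>?L)"
  define c where "c = (1 / sqrt (2 * pi / real n)) ^ card ?I"
  have n0: "0 < real n" using n by simp
  have c0: "0 < c" unfolding c_def using n0 by (intro zero_less_power) auto
  have Z0: "0 \<le> Z" unfolding Z_def using post_weight_nonneg[OF prior] by (intro integral_nonneg_AE) auto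
  have \<pi> [measurable]: "\<pi> \<in> borel_measurable ?L" and \<pi>0: "\<And>\<beta>. \<beta> \<in> space ?L \<Longrightarrow> 0 \<le> \<pi> \<beta>"
    using prior by (auto simp: sieve_prior_def)
  have [measurable]: "(\<lambda>x. \<Prod>i\<in>?I. normal_density (y i) ?\<sigma> (x i)) \<in> borel_measurable ?L"
    unfolding sieve_space_def by measurable
  have g: "(\<Prod>i\<in>?I. normal_density (y i) ?\<sigma> (x i)) = c * exp (- (real n / 2) * (\<Sum>i\<in>?I. (y i - x i)\<^sup>2))" for x
    using n0 by (subst prod_normal_density) (auto simp: c_def power_divide power2_commute[of "x _"])
  have "density (gauss ?I y ?\<sigma>) (\<lambda>\<beta>. ennreal (\<pi> \<beta> / (c * Z)))
     = density ?L (\<lambda>\<beta>. ennreal (\<Prod>i\<in>?I. normal_density (y i) ?\<sigma> (\<beta> i)) * ennreal (\<pi> \<beta> / (c * Z)))"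
    using n0 by (subst gauss_density) (auto simp: sieve_space_def[symmetric] intro!: density_density_eq)
  also have "\<dots> = density ?L (\<lambda>\<beta>. ennreal (post_weight J0 J n \<pi> y \<beta> / Z))"
  proof (intro density_cong AE_I2)
    fix \<beta> assume "\<beta> \<in> space ?L"
    then show "ennreal (\<Prod>i\<in>?I. normal_density (y i) ?\<sigma> (\<beta> i)) * ennreal (\<pi> \<beta> / (c * Z))
        = ennreal (post_weight J0 J n \<pi> y \<beta> / Z)"
      using c0 Z0 \<pi>0[of \<beta>] by (subst ennreal_mult[symmetric]) (auto simp: g prod_nonneg post_weight_def field_simps)
  qed (use borel_measurable_post_weight[OF prior] in measurable)
  finally show ?thesis unfolding posterior_def Z_def c_def by simp
qed

text \<open>
  A nonasymptotic Bernstein--von Mises theorem in total variation. The posterior has density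
  proportional to the prior with respect to the Gaussian measure centred at the observation; by
  \<open>prior_modulus_flat\<close> that density is nearly constant on the ball of radius proportional to \<open>C1 + 10\<close>. Outside the
  ball the Gaussian measure is small by \<open>gauss_square_tail\<close>. The posterior is small there because the
  Gaussian weight is at most \<open>n\<close> to the power \<open>-(C1 + 9) \<cdot> 2\<^sup>J\<close>, which beats the lower bound for the
  normalising constant by the required factor.
\<close>

lemma bernstein_von_mises:
  assumes J: "1 \<le> J0" "J0 \<le> J" and n: "2 \<le> n" "2 ^ J \<le> n" and C1: "0 < C1"
    and prior: "sieve_prior J0 J \<pi>"
    and \<beta>0: "\<beta>0 \<in> space (sieve_space J0 J)"
    and mass: "\<pi> \<beta>0 \<ge> real n powr (2 ^ J / 2) * real n powr (- C1 * 2 ^ J)"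
    and small: "prior_modulus J0 J n \<pi> \<beta>0 (1 / sqrt (real n)) \<le> 1 / 2"
    and y: "real n * (\<Sum>i\<in>idx J0 J. (y i - \<beta>0 i)\<^sup>2) \<le> 6 * (2 ^ J * ln n)"
    and A: "A \<in> sets (sieve_space J0 J)"
  shows "\<bar>measure (posterior J0 J n \<pi> y) A - measure (gauss (idx J0 J) y (1 / sqrt (real n))) A\<bar>
     \<le> prior_modulus J0 J n \<pi> \<beta>0 ((C1 + 10) * sqrt (2 ^ J * ln n)) + 2 * real n powr (- (2 ^ J))"
proof -
  let ?I = "idx J0 J" and ?L = "sieve_space J0 J" and ?\<sigma> = "1 / sqrt (real n)"
  let ?R = "(C1 + 10) * sqrt (2 ^ J * ln n)"
  define S where "S = sieve_ball J0 J n \<beta>0 ?R"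
  define W where "W = post_weight J0 J n \<pi> y"
  define Z where "Z = (\<integral>b. W b \<partial>?L)"
  define f where "f \<beta> = \<pi> \<beta> / ((1 / sqrt (2 * pi / real n)) ^ card ?I * Z)" for \<beta>
  define \<theta> where "\<theta> = 1 - prior_modulus J0 J n \<pi> \<beta>0 ?R"
  have n0: "0 < real n" "1 < real n" using n by auto
  have lnn: "0 < ln (real n)" using n0 by simp
  have L0: "0 \<le> 2 ^ J * ln (real n)" using lnn by simp
  have card: "card ?I = 2 ^ J" using J by (simp add: card_idx)
  have Z_lower: "real n powr (- (C1 + 8) * 2 ^ J) \<le> Z"
    unfolding Z_def W_def by (rule normalizer_lower_bound[OF J n prior \<beta>0 mass small y])
  have Z0: "0 < Z" using n0 by (intro less_le_trans[OF _ Z_lower]) simp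
  have W [measurable]: "W \<in> borel_measurable ?L" and W0: "\<And>\<beta>. \<beta> \<in> space ?L \<Longrightarrow> 0 \<le> W \<beta>"
    and intW: "integrable ?L W"
    unfolding W_def using post_weight_props[OF prior] by auto
  have S [measurable]: "S \<in> sets ?L" unfolding S_def by measurable
  have \<beta>0S: "\<beta>0 \<in> S"
    unfolding S_def sieve_ball_def using \<beta>0 C1 L0 by (simp add: L2_set_def)
  have \<theta>: "0 \<le> \<theta>" "\<theta> \<le> 1"
    using prior_modulus_flat(2,3)[OF prior \<beta>0S[unfolded S_def] \<beta>0S[unfolded S_def]] unfolding \<theta>_def by auto
  interpret G: prob_space "gauss ?I y ?\<sigma>" using n0 by (intro prob_space_gauss) auto
  have post: "posterior J0 J n \<pi> y = density (gauss ?I y ?\<sigma>) (\<lambda>\<beta>. ennreal (f \<beta>))"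
    unfolding f_def Z_def W_def by (rule posterior_eq_density_gauss[OF n(1) prior])
  have post': "posterior J0 J n \<pi> y = density ?L (\<lambda>\<beta>. ennreal (W \<beta> / Z))"
    unfolding posterior_def W_def Z_def ..
  have far: "(C1 + 7)\<^sup>2 * (2 ^ J * ln n) \<le> real n * (\<Sum>i\<in>?I. (y i - \<beta> i)\<^sup>2)" if "\<beta> \<in> space ?L - S" for \<beta>
    using outside_ball_far_from_observation[OF n(1) C1 L0 y] that unfolding S_def by auto
  have measure_post: "measure (posterior J0 J n \<pi> y) B = (\<integral>\<beta>. W \<beta> * indicator B \<beta> \<partial>?L) / Z"
    if [measurable]: "B \<in> sets ?L" for B
  proof -
    have "measure (posterior J0 J n \<pi> y) B = (\<integral>\<beta>. indicator B \<beta> \<partial>posterior J0 J n \<pi> y)"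
      unfolding post' using sets.sets_into_space[OF that] by (simp add: Int_absorb2)
    also have "\<dots> = (\<integral>\<beta>. W \<beta> / Z * indicator B \<beta> \<partial>?L)"
      unfolding post' using W0 Z0 by (subst integral_density) auto
    also have "\<dots> = (\<integral>\<beta>. W \<beta> * indicator B \<beta> \<partial>?L) / Z" by simp
    finally show ?thesis .
  qed
  have prob_post: "prob_space (posterior J0 J n \<pi> y)"
  proof
    have "emeasure (posterior J0 J n \<pi> y) (space (posterior J0 J n \<pi> y)) = (\<integral>\<^sup>+\<beta>. ennreal (W \<beta> / Z) \<partial>?L)"
      unfolding post' by (simp add: emeasure_density cong: nn_integral_cong)
    also have "\<dots> = ennreal (\<integral>\<beta>. W \<beta> / Z \<partial>?L)"
      using W0 Z0 intW by (intro nn_integral_eq_integral) auto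
    also have "\<dots> = 1" using Z0 by (simp add: Z_def[symmetric])
    finally show "emeasure (posterior J0 J n \<pi> y) (space (posterior J0 J n \<pi> y)) = 1" .
  qed
  have outside_post: "measure (posterior J0 J n \<pi> y) (space ?L - S) \<le> real n powr (- (2 ^ J))"
  proof -
    have "(\<integral>\<beta>. W \<beta> * indicator (space ?L - S) \<beta> \<partial>?L)
        \<le> (\<integral>\<beta>. exp (- ((C1 + 7)\<^sup>2 * (2 ^ J * ln n)) / 2) * \<pi> \<beta> \<partial>?L)"
    proof (rule integral_mono)
      show "integrable ?L (\<lambda>\<beta>. W \<beta> * indicator (space ?L - S) \<beta>)"
        using intW by (intro integrable_real_mult_indicator) auto
      show "integrable ?L (\<lambda>\<beta>. exp (- ((C1 + 7)\<^sup>2 * (2 ^ J * ln n)) / 2) * \<pi> \<beta>)"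
        using integrable_prior(1)[OF prior] by simp
      fix \<beta> assume \<beta>: "\<beta> \<in> space ?L"
      have \<pi>0: "0 \<le> \<pi> \<beta>" using prior \<beta> by (simp add: sieve_prior_def)
      show "W \<beta> * indicator (space ?L - S) \<beta> \<le> exp (- ((C1 + 7)\<^sup>2 * (2 ^ J * ln n)) / 2) * \<pi> \<beta>"
      proof (cases "\<beta> \<in> S")
        case False
        then show ?thesis
          using far[of \<beta>] \<beta> \<pi>0 unfolding W_def post_weight_def by (simp add: mult.commute mult_left_mono)
      qed (use \<pi>0 in simp)
    qed
    also have "\<dots> = exp (- ((C1 + 7)\<^sup>2 * (2 ^ J * ln n)) / 2)"
      by (simp add: integrable_prior(2)[OF prior])
    also have "\<dots> \<le> exp (- ((C1 + 9) * (2 ^ J * ln n)))"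
    proof -
      \<comment> \<open>This inequality is what the constant \<open>C1 + 10\<close> of the radius is chosen for.\<close>
      have "(C1 + 9) * 2 \<le> (C1 + 7)\<^sup>2" using C1 by (simp add: power2_eq_square algebra_simps)
      from mult_right_mono[OF this L0] show ?thesis by (simp add: algebra_simps)
    qed
    also have "\<dots> = real n powr (- (2 ^ J)) * real n powr (- (C1 + 8) * 2 ^ J)"
      using n0 by (simp add: powr_def algebra_simps flip: exp_add)
    also have "\<dots> \<le> real n powr (- (2 ^ J)) * Z"
      using Z_lower by (intro mult_left_mono) auto
    finally show ?thesis
      using Z0 by (subst measure_post) (auto simp: pos_divide_le_eq)
  qed
  have outside_gauss: "G.prob (space ?L - S) \<le> real n powr (- (2 ^ J))"
  proof -
    have "G.prob (space ?L - S)
      \<le> G.prob {x \<in> space (gauss ?I y ?\<sigma>). 6 * real (card ?I) * ln n * ?\<sigma>\<^sup>2 \<le> (\<Sum>i\<in>?I. (x i - y i)\<^sup>2)}"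
    proof (rule G.finite_measure_mono)
      show "space ?L - S \<subseteq> {x \<in> space (gauss ?I y ?\<sigma>). 6 * real (card ?I) * ln n * ?\<sigma>\<^sup>2 \<le> (\<Sum>i\<in>?I. (x i - y i)\<^sup>2)}"
      proof
        fix \<beta> assume \<beta>: "\<beta> \<in> space ?L - S"
        have "6 \<le> (C1 + 7)\<^sup>2" using C1 by (simp add: power2_eq_square algebra_simps)
        from mult_right_mono[OF this L0]
        have "6 * (2 ^ J * ln n) \<le> real n * (\<Sum>i\<in>?I. (y i - \<beta> i)\<^sup>2)"
          using far[OF \<beta>] by linarith
        then have "6 * real (card ?I) * ln n * ?\<sigma>\<^sup>2 \<le> (\<Sum>i\<in>?I. (\<beta> i - y i)\<^sup>2)"
          using n0 unfolding card by (simp add: power_divide pos_divide_le_eq mult_ac power2_commute)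
        then show "\<beta> \<in> {x \<in> space (gauss ?I y ?\<sigma>). 6 * real (card ?I) * ln n * ?\<sigma>\<^sup>2 \<le> (\<Sum>i\<in>?I. (x i - y i)\<^sup>2)}"
          using \<beta> by (simp add: space_gauss_idx)
      qed
      show "{x \<in> space (gauss ?I y ?\<sigma>). 6 * real (card ?I) * ln n * ?\<sigma>\<^sup>2 \<le> (\<Sum>i\<in>?I. (x i - y i)\<^sup>2)} \<in> G.events"
        by measurable
    qed
    also have "\<dots> \<le> sqrt 2 ^ card ?I * exp (- (6 * real (card ?I) * ln n) / 4)"
      using n0 by (intro gauss_square_tail) auto
    also have "\<dots> \<le> real n powr (- real (card ?I))"
      by (rule sqrt2_power_exp_le[OF n(1)])
    finally show ?thesis by (simp add: card)
  qed
  have "\<bar>measure (density (gauss ?I y ?\<sigma>) (\<lambda>\<beta>. ennreal (f \<beta>))) A - G.prob A\<bar>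
     \<le> (1 - \<theta>) + measure (density (gauss ?I y ?\<sigma>) (\<lambda>\<beta>. ennreal (f \<beta>))) (space (gauss ?I y ?\<sigma>) - S)
        + G.prob (space (gauss ?I y ?\<sigma>) - S)"
  proof (rule G.density_total_variation_le)
    show "f \<in> borel_measurable (gauss ?I y ?\<sigma>)"
    proof -
      have [measurable]: "\<pi> \<in> borel_measurable ?L" using prior by (simp add: sieve_prior_def)
      have "f \<in> borel_measurable ?L" unfolding f_def[abs_def] by measurable
      then show ?thesis by (simp cong: measurable_cong_sets add: sets_gauss_idx)
    qed
    show "0 \<le> f \<beta>" if "\<beta> \<in> space (gauss ?I y ?\<sigma>)" for \<beta>
      using that prior Z0 unfolding f_def sieve_prior_def by (auto simp: space_gauss_idx)
    show "\<theta> * f x \<le> f z" if "x \<in> S" "z \<in> S" for x z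
    proof -
      have "\<theta> * \<pi> x \<le> \<pi> z"
        unfolding \<theta>_def using that unfolding S_def by (intro prior_modulus_flat(1)[OF prior])
      then show ?thesis
        unfolding f_def using Z0 by (simp add: mult.assoc[symmetric] mult_right_mono divide_right_mono)
    qed
  qed (use A S \<theta> prob_post in \<open>auto simp: sets_gauss_idx post\<close>)
  then show ?thesis
    using outside_post outside_gauss unfolding post[symmetric] space_gauss_idx \<theta>_def by simp
qed

section \<open>Wavelet expansions and the supremum norm\<close>

abbreviation unit_measure :: "real measure" where
  "unit_measure \<equiv> lebesgue_on {0..1}"

interpretation unit: prob_space unit_measure
  by (rule prob_spaceI) (simp add: emeasure_restrict_space)

lemma L2_unitI:
  "f \<in> borel_measurable unit_measure \<Longrightarrow> integrable unit_measure (\<lambda>x. (f x)\<^sup>2) \<Longrightarrow> f \<in> L2_unit"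
  unfolding L2_unit_def by (rule CollectI) (rule conjI)

lemma L2_unitD:
  assumes "f \<in> L2_unit"
  shows L2_unit_measurable: "f \<in> borel_measurable unit_measure"
    and L2_unit_square: "integrable unit_measure (\<lambda>x. (f x)\<^sup>2)"
proof -
  have *: "f \<in> borel_measurable unit_measure \<and> integrable unit_measure (\<lambda>x. (f x)\<^sup>2)"
    using assms unfolding L2_unit_def by (rule CollectD)
  show "f \<in> borel_measurable unit_measure" using * by (rule conjunct1)
  show "integrable unit_measure (\<lambda>x. (f x)\<^sup>2)" using * by (rule conjunct2)
qed

lemma L2_unit_mult_integrable:
  assumes "f \<in> L2_unit" "g \<in> L2_unit"
  shows "integrable unit_measure (\<lambda>x. f x * g x)"
proof (rule Bochner_Integration.integrable_bound)
  show "integrable unit_measure (\<lambda>x. (f x)\<^sup>2 + (g x)\<^sup>2)"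
    by (intro Bochner_Integration.integrable_add L2_unit_square assms)
  show "(\<lambda>x. f x * g x) \<in> borel_measurable unit_measure"
    by (intro borel_measurable_times L2_unit_measurable assms)
  have "\<bar>a * b\<bar> \<le> a\<^sup>2 + b\<^sup>2" for a b :: real
  proof -
    have "(\<bar>a\<bar> - \<bar>b\<bar>)\<^sup>2 = a\<^sup>2 + b\<^sup>2 - 2 * \<bar>a * b\<bar>"
      by (simp add: power2_diff abs_mult)
    then show ?thesis
      using zero_le_power2[of "\<bar>a\<bar> - \<bar>b\<bar>"] abs_ge_zero[of "a * b"] by linarith
  qed
  then show "AE x in unit_measure. norm (f x * g x) \<le> norm ((f x)\<^sup>2 + (g x)\<^sup>2)"
    by (intro AE_I2) simp
qed

lemma L2_unit_scale:
  assumes "f \<in> L2_unit"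
  shows "(\<lambda>x. c * f x) \<in> L2_unit"
proof (rule L2_unitI)
  show "(\<lambda>x. c * f x) \<in> borel_measurable unit_measure"
    by (intro borel_measurable_times borel_measurable_const L2_unit_measurable assms)
  show "integrable unit_measure (\<lambda>x. (c * f x)\<^sup>2)"
    unfolding power_mult_distrib by (intro integrable_mult_right L2_unit_square assms)
qed

lemma L2_unit_add:
  assumes "f \<in> L2_unit" "g \<in> L2_unit"
  shows "(\<lambda>x. f x + g x) \<in> L2_unit"
proof (rule L2_unitI)
  show "(\<lambda>x. f x + g x) \<in> borel_measurable unit_measure"
    by (intro borel_measurable_add L2_unit_measurable assms)
  have "(\<lambda>x. (f x + g x)\<^sup>2) = (\<lambda>x. (f x)\<^sup>2 + (g x)\<^sup>2 + 2 * (f x * g x))"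
    by (simp add: power2_sum mult.assoc)
  then show "integrable unit_measure (\<lambda>x. (f x + g x)\<^sup>2)"
    by (simp only:) (intro Bochner_Integration.integrable_add integrable_mult_right L2_unit_square
      L2_unit_mult_integrable assms)
qed

lemma L2_unit_diff:
  assumes "f \<in> L2_unit" "g \<in> L2_unit"
  shows "(\<lambda>x. f x - g x) \<in> L2_unit"
  using L2_unit_add[OF assms(1) L2_unit_scale[OF assms(2), of "-1"]] by simp

lemma L2_unit_0: "(\<lambda>x. 0) \<in> L2_unit"
  by (rule L2_unitI) simp_all

lemma L2_unit_sum:
  assumes "\<And>i. i \<in> A \<Longrightarrow> f i \<in> L2_unit"
  shows "(\<lambda>x. \<Sum>i\<in>A. a i * f i x) \<in> L2_unit"
  using assms
proof (induction A rule: infinite_finite_induct)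
  case (insert j A)
  then show ?case using L2_unit_add[OF L2_unit_scale[of "f j" "a j"]] by simp
qed (simp_all add: L2_unit_0)

lemma inner_unit_sum_right:
  assumes "\<And>i. i \<in> A \<Longrightarrow> f i \<in> L2_unit" "g \<in> L2_unit"
  shows "inner_unit g (\<lambda>x. \<Sum>i\<in>A. a i * f i x) = (\<Sum>i\<in>A. a i * inner_unit g (f i))"
proof -
  have "inner_unit g (\<lambda>x. \<Sum>i\<in>A. a i * f i x) = (\<integral>x. (\<Sum>i\<in>A. a i * (g x * f i x)) \<partial>unit_measure)"
    unfolding inner_on_def by (simp add: sum_distrib_left mult_ac)
  also have "\<dots> = (\<Sum>i\<in>A. a i * inner_unit g (f i))"
    unfolding inner_on_def using assms by (subst Bochner_Integration.integral_sum) (auto intro: L2_unit_mult_integrable)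
  finally show ?thesis .
qed

lemma inner_unit_commute: "inner_unit f g = inner_unit g f"
  unfolding inner_on_def by (simp add: mult.commute)

lemma coef_diff:
  assumes "\<psi> (fst i) (snd i) \<in> L2_unit" "f \<in> L2_unit" "g \<in> L2_unit"
  shows "coef \<psi> (\<lambda>x. f x - g x) i = coef \<psi> f i - coef \<psi> g i"
  unfolding coef_def inner_on_def case_prod_beta
  using assms by (simp add: right_diff_distrib L2_unit_mult_integrable)

lemma idx_inf_iff:
  "(l, k) \<in> idx_inf J0 \<longleftrightarrow> J0 - 1 \<le> l \<and> k < 2 ^ max l J0"
proof
  assume "(l, k) \<in> idx_inf J0"
  then show "J0 - 1 \<le> l \<and> k < 2 ^ max l J0"
    unfolding idx_inf_def idx_def by (auto simp: max_def)
next
  assume "J0 - 1 \<le> l \<and> k < 2 ^ max l J0"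
  then have "(l, k) \<in> idx J0 (Suc l)"
    unfolding idx_def by (cases "J0 \<le> l") (auto simp: max_def split: if_splits)
  then show "(l, k) \<in> idx_inf J0"
    unfolding idx_inf_def by blast
qed

lemma idx_subset_idx_inf: "idx J0 J \<subseteq> idx_inf J0"
  unfolding idx_inf_def by blast

lemma orthonormal_basisD:
  assumes "orthonormal_basis_unit J0 \<psi>"
  shows "(l, k) \<in> idx_inf J0 \<Longrightarrow> \<psi> l k \<in> L2_unit"
    and "(l, k) \<in> idx_inf J0 \<Longrightarrow> (l', k') \<in> idx_inf J0 \<Longrightarrow>
      inner_unit (\<psi> l k) (\<psi> l' k') = (if (l, k) = (l', k') then 1 else 0)"
    and "f \<in> L2_unit \<Longrightarrow> (\<And>l k. (l, k) \<in> idx_inf J0 \<Longrightarrow> inner_unit (\<psi> l k) f = 0) \<Longrightarrow>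
      AE x in unit_measure. f x = 0"
  using assms unfolding orthonormal_basis_unit_def by (fastforce, fastforce, fastforce)

lemma synth_L2:
  assumes "orthonormal_basis_unit J0 \<psi>"
  shows "synth J0 \<psi> J \<beta> \<in> L2_unit"
proof -
  have "(\<lambda>x. \<Sum>i\<in>idx J0 J. \<beta> i * (case i of (l, k) \<Rightarrow> \<psi> l k) x) \<in> L2_unit"
    using orthonormal_basisD(1)[OF assms] idx_subset_idx_inf[of J0 J]
    by (intro L2_unit_sum) (auto split: prod.splits)
  then show ?thesis
    unfolding synth_def[abs_def] by (simp add: case_prod_beta)
qed

lemma coef_synth:
  assumes ob: "orthonormal_basis_unit J0 \<psi>" and fin: "finite (idx J0 J)" and i: "i \<in> idx_inf J0"
  shows "coef \<psi> (synth J0 \<psi> J \<beta>) i = (if i \<in> idx J0 J then \<beta> i else 0)"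
proof -
  obtain l k where lk: "i = (l, k)" by force
  have sub: "j \<in> idx_inf J0" if "j \<in> idx J0 J" for j using that idx_subset_idx_inf by auto
  have "coef \<psi> (synth J0 \<psi> J \<beta>) i = inner_unit (\<psi> l k) (\<lambda>x. \<Sum>j\<in>idx J0 J. \<beta> j * \<psi> (fst j) (snd j) x)"
    unfolding coef_def lk synth_def[abs_def] by (simp add: case_prod_beta)
  also have "\<dots> = (\<Sum>j\<in>idx J0 J. \<beta> j * inner_unit (\<psi> l k) (\<psi> (fst j) (snd j)))"
    using i sub by (intro inner_unit_sum_right orthonormal_basisD(1)[OF ob]) (auto simp: lk)
  also have "\<dots> = (\<Sum>j\<in>idx J0 J. if i = j then \<beta> j else 0)"
    using i sub by (intro sum.cong refl) (auto simp: lk orthonormal_basisD(2)[OF ob])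
  also have "\<dots> = (if i \<in> idx J0 J then \<beta> i else 0)"
    using fin by simp
  finally show ?thesis .
qed

lemma bounded_of_compact_support:
  fixes f :: "real \<Rightarrow> real"
  assumes "continuous_on UNIV f" and "\<And>x. x \<notin> {a..b} \<Longrightarrow> f x = 0"
  shows "\<exists>G\<ge>0. \<forall>x. \<bar>f x\<bar> \<le> G"
proof -
  have "bounded (f ` {a..b})"
    using assms(1) by (intro compact_imp_bounded compact_continuous_image) (auto intro: continuous_on_subset)
  then have "\<exists>G. \<forall>x\<in>{a..b}. \<bar>f x\<bar> \<le> G"
    unfolding bounded_iff by simp
  then obtain G where G: "\<And>x. x \<in> {a..b} \<Longrightarrow> \<bar>f x\<bar> \<le> G"
    by blast
  have "\<bar>f x\<bar> \<le> max G 0" for x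
    using G[of x] assms(2)[of x] by (cases "x \<in> {a..b}") auto
  then show ?thesis by (intro exI[of _ "max G 0"]) auto
qed

lemma C_k_continuous:
  assumes "C_k S f" "1 \<le> S"
  shows "continuous_on UNIV f"
proof -
  obtain D where D: "D 0 = f" "\<forall>i<S. \<forall>x. (D i has_real_derivative D (Suc i) x) (at x)"
    using assms(1) unfolding C_k_def by blast
  have "(f has_real_derivative D (Suc 0) x) (at x)" for x
    using D(2) assms(2) unfolding D(1)[symmetric] by auto
  then show ?thesis
    by (meson DERIV_isCont continuous_at_imp_continuous_on)
qed

text \<open>
  Edge functions and wavelets are finite linear combinations of one another, so boundedness propagates
  from the father function through this lemma.
\<close>

lemma bounded_sum_abs:
  fixes f :: "'i \<Rightarrow> 'b \<Rightarrow> real"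
  assumes "finite A" "\<And>i. i \<in> A \<Longrightarrow> \<exists>G\<ge>0. \<forall>x\<in>X. \<bar>f i x\<bar> \<le> G"
  shows "\<exists>G\<ge>0. \<forall>x\<in>X. \<bar>\<Sum>i\<in>A. a i * f i x\<bar> \<le> G"
proof -
  from assms(2) obtain G where G: "\<And>i. i \<in> A \<Longrightarrow> 0 \<le> G i" "\<And>i x. i \<in> A \<Longrightarrow> x \<in> X \<Longrightarrow> \<bar>f i x\<bar> \<le> G i"
    by metis
  have "\<bar>\<Sum>i\<in>A. a i * f i x\<bar> \<le> (\<Sum>i\<in>A. \<bar>a i\<bar> * G i)" if "x \<in> X" for x
    using G(2) that by (intro order_trans[OF sum_abs] sum_mono) (auto simp: abs_mult intro!: mult_left_mono)
  moreover have "0 \<le> (\<Sum>i\<in>A. \<bar>a i\<bar> * G i)" using G(1) by (intro sum_nonneg) auto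
  ultimately show ?thesis by blast
qed

lemma edge_system_bounded:
  assumes edge: "edge_system N \<phi> \<phi>E \<psi>E" and \<phi>: "\<And>x. \<bar>\<phi> x\<bar> \<le> G"
  shows "\<exists>G\<ge>0. \<forall>k<N. \<forall>x\<ge>0. \<bar>\<phi>E k x\<bar> \<le> G \<and> \<bar>\<psi>E k x\<bar> \<le> G"
proof -
  note edge' = edge[unfolded edge_system_def]
  from edge'[THEN conjunct1] obtain a :: "nat \<Rightarrow> nat \<Rightarrow> real"
    where a: "\<forall>k<N. \<forall>x\<ge>0. \<phi>E k x = (\<Sum>j<N. a k j * edge_poly N \<phi> j x)"
    by (elim exE)
  from edge'[THEN conjunct2, THEN conjunct1] obtain b c :: "nat \<Rightarrow> nat \<Rightarrow> real"
    where b: "\<forall>k<N. \<forall>x\<ge>0.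
        \<psi>E k x = (\<Sum>j<N. b k j * sqrt 2 * \<phi>E j (2 * x)) + (\<Sum>j<N. c k j * \<phi>E j x)"
    by (elim exE)
  have G0: "0 \<le> G" using \<phi>[of 0] by linarith
  have ep: "\<exists>G\<ge>0. \<forall>x\<in>UNIV. \<bar>edge_poly N \<phi> j x\<bar> \<le> G" for j
    unfolding edge_poly_def by (intro bounded_sum_abs exI[of _ G] conjI ballI G0 \<phi>) simp
  have ph: "\<exists>G\<ge>0. \<forall>x\<in>{0..}. \<bar>\<phi>E k x\<bar> \<le> G" if "k < N" for k
  proof -
    have "\<exists>G\<ge>0. \<forall>x\<in>{0..}. \<bar>\<Sum>j<N. a k j * edge_poly N \<phi> j x\<bar> \<le> G"
      using ep by (intro bounded_sum_abs) (simp, meson UNIV_I)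
    then show ?thesis using a that by simp
  qed
  have ps: "\<exists>G\<ge>0. \<forall>x\<in>{0..}. \<bar>\<psi>E k x\<bar> \<le> G" if k: "k < N" for k
  proof -
    have "\<exists>G\<ge>0. \<forall>x\<in>{0..}. \<bar>\<Sum>j<N. b k j * sqrt 2 * \<phi>E j (2 * x)\<bar> \<le> G"
    proof (intro bounded_sum_abs)
      fix j assume "j \<in> {..<N}"
      then obtain G where "G \<ge> 0" "\<forall>x\<in>{0..}. \<bar>\<phi>E j x\<bar> \<le> G" using ph by auto
      then show "\<exists>G\<ge>0. \<forall>x\<in>{0..}. \<bar>\<phi>E j (2 * x)\<bar> \<le> G" by (intro exI[of _ G]) auto
    qed simp
    then obtain G1 where G1: "0 \<le> G1" "\<And>x. 0 \<le> x \<Longrightarrow> \<bar>\<Sum>j<N. b k j * sqrt 2 * \<phi>E j (2 * x)\<bar> \<le> G1" by auto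
    have "\<exists>G\<ge>0. \<forall>x\<in>{0..}. \<bar>\<Sum>j<N. c k j * \<phi>E j x\<bar> \<le> G"
      using ph by (intro bounded_sum_abs) auto
    then obtain G2 where G2: "0 \<le> G2" "\<And>x. 0 \<le> x \<Longrightarrow> \<bar>\<Sum>j<N. c k j * \<phi>E j x\<bar> \<le> G2" by auto
    have "\<bar>\<psi>E k x\<bar> \<le> G1 + G2" if "0 \<le> x" for x
      using b k that G1(2)[OF that] G2(2)[OF that] by simp
    then show ?thesis using G1(1) G2(1) by (intro exI[of _ "G1 + G2"]) auto
  qed
  have "\<exists>A. \<forall>k\<in>{..<N}. 0 \<le> A k \<and> (\<forall>x\<in>{0..}. \<bar>\<phi>E k x\<bar> \<le> A k)"
    using ph by (intro bchoice) blast
  then obtain A where A: "\<And>k. k < N \<Longrightarrow> 0 \<le> A k" "\<And>k x. k < N \<Longrightarrow> 0 \<le> x \<Longrightarrow> \<bar>\<phi>E k x\<bar> \<le> A k"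
    by (metis atLeast_iff lessThan_iff)
  have "\<exists>B. \<forall>k\<in>{..<N}. 0 \<le> B k \<and> (\<forall>x\<in>{0..}. \<bar>\<psi>E k x\<bar> \<le> B k)"
    using ps by (intro bchoice) blast
  then obtain B where B: "\<And>k. k < N \<Longrightarrow> 0 \<le> B k" "\<And>k x. k < N \<Longrightarrow> 0 \<le> x \<Longrightarrow> \<bar>\<psi>E k x\<bar> \<le> B k"
    by (metis atLeast_iff lessThan_iff)
  have "A k \<le> (\<Sum>j<N. A j + B j)" "B k \<le> (\<Sum>j<N. A j + B j)" if "k < N" for k
  proof -
    have "A k + B k \<le> (\<Sum>j<N. A j + B j)"
      using that A(1) B(1) by (intro member_le_sum) auto
    then show "A k \<le> (\<Sum>j<N. A j + B j)" "B k \<le> (\<Sum>j<N. A j + B j)"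
      using A(1)[OF that] B(1)[OF that] by auto
  qed
  moreover have "0 \<le> (\<Sum>j<N. A j + B j)" using A(1) B(1) by (intro sum_nonneg) auto
  ultimately show ?thesis
    using A(2) B(2) by (intro exI[of _ "\<Sum>j<N. A j + B j"] conjI allI impI) (assumption | blast intro: order_trans)+
qed

text \<open>
  At a given point at most \<open>2 * N\<close> interior functions do not vanish, besides the \<open>N\<close> functions at each edge;
  thus the sum has at most \<open>4 * N\<close> terms of size \<open>2 powr (l / 2)\<close>, at whatever level.
\<close>

lemma cdv_level_sum_bound:
  assumes g: "\<And>x. \<bar>g x\<bar> \<le> G" "\<And>x. x \<notin> {1 - real N..real N} \<Longrightarrow> g x = 0"
    and gL: "\<And>k x. k < N \<Longrightarrow> 0 \<le> x \<Longrightarrow> \<bar>gL k x\<bar> \<le> G"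
    and gR: "\<And>k x. k < N \<Longrightarrow> 0 \<le> x \<Longrightarrow> \<bar>gR k x\<bar> \<le> G"
    and x: "x \<in> {0..1}"
  shows "(\<Sum>k<2 ^ l. \<bar>cdv_level N g gL gR l k x\<bar>) \<le> 4 * real N * G * 2 powr (real l / 2)"
proof -
  let ?t = "\<lambda>k. cdv_level N g gL gR l k x"
  have G0: "0 \<le> G" using g(1)[of 0] by linarith
  have term_le: "\<bar>?t k\<bar> \<le> 2 powr (real l / 2) * G" if "k < 2 ^ l" for k
  proof -
    have "2 ^ l - 1 - k < N" if "\<not> k < 2 ^ l - N" using that \<open>k < 2 ^ l\<close> by linarith
    then show ?thesis
      unfolding cdv_level_def using x
      by (auto simp: abs_mult intro!: mult_left_mono g(1) gL gR)
  qed
  \<comment> \<open>The interior functions that do not vanish at \<open>x\<close> have indices in the window of length \<open>2 * N\<close> from \<open>a\<close>.\<close>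
  define a where "a = nat \<lceil>2 ^ l * x - real N\<rceil>"
  let ?B = "{..<N} \<union> {2 ^ l - N..<2 ^ l} \<union> {a..<a + 2 * N}"
  have zero: "?t k = 0" if k: "k < 2 ^ l" "k \<notin> ?B" for k
  proof -
    have "2 ^ l * x - real k \<notin> {1 - real N..real N}"
    proof
      assume "2 ^ l * x - real k \<in> {1 - real N..real N}"
      then have 1: "2 ^ l * x - real N \<le> real k" "real k \<le> 2 ^ l * x + real N - 1" by auto
      then have "a \<le> k" unfolding a_def by (simp add: nat_le_iff ceiling_le_iff)
      moreover have "2 ^ l * x - real N \<le> real a" unfolding a_def by linarith
      then have "real k < real (a + 2 * N)" using 1(2) by simp
      then have "k < a + 2 * N" by (simp only: of_nat_less_iff)
      ultimately show False using k by simp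
    qed
    then show ?thesis
      using k g(2) unfolding cdv_level_def by auto
  qed
  have "(\<Sum>k<2 ^ l. \<bar>?t k\<bar>) \<le> (\<Sum>k<2 ^ l. if k \<in> ?B then 2 powr (real l / 2) * G else 0)"
    using term_le zero by (intro sum_mono) (auto simp del: Un_iff)
  also have "\<dots> = (\<Sum>k\<in>{..<2 ^ l} \<inter> ?B. 2 powr (real l / 2) * G)"
    by (subst sum.inter_restrict) simp_all
  also have "\<dots> = real (card ({..<2 ^ l} \<inter> ?B)) * (2 powr (real l / 2) * G)"
    by simp
  also have "\<dots> \<le> real (4 * N) * (2 powr (real l / 2) * G)"
  proof (intro mult_right_mono of_nat_mono)
    have "card ({..<2 ^ l} \<inter> ?B) \<le> card ?B" by (intro card_mono) auto
    also have "\<dots> \<le> card {..<N} + card {2 ^ l - N..<2 ^ l} + card {a..<a + 2 * N}"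
      by (meson card_Un_le add_le_mono1 le_trans)
    also have "\<dots> \<le> N + N + 2 * N" by (intro add_mono) auto
    finally show "card ({..<2 ^ l} \<inter> ?B) \<le> 4 * N" by simp
  qed (use G0 in auto)
  finally show ?thesis by (simp add: mult_ac)
qed

text \<open>
  The scaling functions are attached to the level \<open>J0 - 1\<close> but dilated as at level \<open>J0\<close>; the maximum with \<open>J0\<close>
  gives their number and the constant absorbs the extra factor \<open>sqrt 2\<close>.
\<close>

lemma cdv_basis_sup_bound:
  assumes cdv: "cdv_basis S J0 \<psi>" and S: "1 \<le> S"
  shows "2 \<le> J0"
    and "\<exists>C>0. \<forall>l\<ge>J0 - 1. \<forall>x\<in>{0..1}. (\<Sum>k<2 ^ max l J0. \<bar>\<psi> l k x\<bar>) \<le> C * 2 powr (real l / 2)"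
proof -
  obtain N h father mother fL mL fR mR where
    N: "S \<le> N" "4 * N \<le> 2 ^ J0"
    and pair: "daubechies_pair N h father mother" and Cf: "C_k S father"
    and eL: "edge_system N father fL mL"
    and eR: "edge_system N (\<lambda>x. father (1 - x)) fR mR"
    and \<psi>f: "\<And>k x. k < 2 ^ J0 \<Longrightarrow> x \<in> {0..1} \<Longrightarrow> \<psi> (J0 - 1) k x = cdv_level N father fL fR J0 k x"
    and \<psi>m: "\<And>l k x. J0 \<le> l \<Longrightarrow> k < 2 ^ l \<Longrightarrow> x \<in> {0..1} \<Longrightarrow> \<psi> l k x = cdv_level N mother mL mR l k x"
    using cdv unfolding cdv_basis_def by blast
  have N1: "1 \<le> N" using N S by simp
  show J0: "2 \<le> J0"
  proof (rule ccontr)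
    assume "\<not> 2 \<le> J0"
    then have "(2::nat) ^ J0 \<le> 2 ^ 1" by (intro power_increasing) auto
    then show False using N N1 by simp
  qed
  have f_supp: "father x = 0" if "x \<notin> {1 - real N..real N}" for x
    using pair that unfolding daubechies_pair_def by blast
  have m_eq: "mother x = sqrt 2 * (\<Sum>k=1 - int N..int N.
                 (if even k then 1 else - 1) * h (1 - k) * father (2 * x - of_int k))" for x
    using pair unfolding daubechies_pair_def by blast
  have m_supp: "mother x = 0" if "x \<notin> {1 - real N..real N}" for x
  proof -
    have "father (2 * x - of_int k) = 0" if k: "k \<in> {1 - int N..int N}" for k
    proof (rule f_supp)
      have "1 - real N \<le> of_int k" "of_int k \<le> real N"
        using k by (auto simp flip: of_int_le_iff[where 'a=real])
      then show "2 * x - of_int k \<notin> {1 - real N..real N}"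
        using \<open>x \<notin> {1 - real N..real N}\<close> by auto
    qed
    then show ?thesis unfolding m_eq by simp
  qed
  obtain G1 where G1: "0 \<le> G1" "\<And>x. \<bar>father x\<bar> \<le> G1"
    using bounded_of_compact_support[OF C_k_continuous[OF Cf S] f_supp] by metis
  have "\<exists>G\<ge>0. \<forall>x\<in>UNIV. \<bar>\<Sum>k=1 - int N..int N.
      (sqrt 2 * ((if even k then 1 else - 1) * h (1 - k))) * father (2 * x - of_int k)\<bar> \<le> G"
    using G1 by (intro bounded_sum_abs) auto
  then obtain G2 where G2: "0 \<le> G2" "\<And>x. \<bar>mother x\<bar> \<le> G2"
    unfolding m_eq by (auto simp: sum_distrib_left mult.assoc)
  obtain G3 where G3: "0 \<le> G3" "\<forall>k<N. \<forall>x\<ge>0. \<bar>fL k x\<bar> \<le> G3 \<and> \<bar>mL k x\<bar> \<le> G3"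
    using edge_system_bounded[OF eL G1(2)] by blast
  obtain G4 where G4: "0 \<le> G4" "\<forall>k<N. \<forall>x\<ge>0. \<bar>fR k x\<bar> \<le> G4 \<and> \<bar>mR k x\<bar> \<le> G4"
    using edge_system_bounded[OF eR, of G1] G1(2) by auto
  define G where "G = G1 + G2 + G3 + G4 + 1"
  have G: "G1 \<le> G" "G2 \<le> G" "G3 \<le> G" "G4 \<le> G" "0 < G"
    using G1(1) G2(1) G3(1) G4(1) unfolding G_def by auto
  have "\<bar>father x\<bar> \<le> G" "\<bar>mother x\<bar> \<le> G" for x
    using G1(2)[of x] G2(2)[of x] G by linarith+
  moreover have "\<bar>fL k x\<bar> \<le> G" "\<bar>mL k x\<bar> \<le> G" "\<bar>fR k x\<bar> \<le> G" "\<bar>mR k x\<bar> \<le> G" if "k < N" "0 \<le> x" for k x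
    using G3(2)[rule_format, OF that] G4(2)[rule_format, OF that] G by linarith+
  ultimately have
    level_f: "(\<Sum>k<2 ^ l. \<bar>cdv_level N father fL fR l k x\<bar>) \<le> 4 * real N * G * 2 powr (real l / 2)" and
    level_m: "(\<Sum>k<2 ^ l. \<bar>cdv_level N mother mL mR l k x\<bar>) \<le> 4 * real N * G * 2 powr (real l / 2)"
    if "x \<in> {0..1}" for l x
    using that by (intro cdv_level_sum_bound f_supp m_supp; blast)+
  have "(\<Sum>k<2 ^ max l J0. \<bar>\<psi> l k x\<bar>) \<le> 8 * real N * G * 2 powr (real l / 2)"
    if l: "J0 - 1 \<le> l" and x: "x \<in> {0..1}" for l x
  proof (cases "J0 \<le> l")
    case True
    then have "(\<Sum>k<2 ^ max l J0. \<bar>\<psi> l k x\<bar>) \<le> 4 * real N * G * 2 powr (real l / 2)"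
      using level_m[OF x, of l] \<psi>m[OF True _ x] by (simp add: max_def)
    also have "\<dots> \<le> 8 * real N * G * 2 powr (real l / 2)" using G by (intro mult_right_mono) auto
    finally show ?thesis .
  next
    case False
    then have l: "l = J0 - 1" using l by simp
    have "(\<Sum>k<2 ^ max l J0. \<bar>\<psi> l k x\<bar>) \<le> 4 * real N * G * 2 powr (real J0 / 2)"
      using level_f[OF x, of J0] \<psi>f[OF _ x] unfolding l by (simp add: max_def)
    also have "\<dots> \<le> 4 * real N * G * (2 * 2 powr (real l / 2))"
    proof (rule mult_left_mono)
      have "2 powr (real J0 / 2) \<le> 2 powr (1 + real l / 2)"
        using J0 unfolding l by (intro powr_mono) (auto simp: field_simps)
      then show "2 powr (real J0 / 2) \<le> 2 * 2 powr (real l / 2)" by (simp add: powr_add)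
    qed (use G in auto)
    finally show ?thesis by simp
  qed
  moreover have "0 < 8 * real N * G" using N1 G by simp
  ultimately show "\<exists>C>0. \<forall>l\<ge>J0 - 1. \<forall>x\<in>{0..1}. (\<Sum>k<2 ^ max l J0. \<bar>\<psi> l k x\<bar>) \<le> C * 2 powr (real l / 2)"
    by blast
qed

text \<open>
  The wavelet series of \<open>h\<close> converges uniformly by the level bounds. Its sum \<open>H\<close> has the same
  coefficients as \<open>h\<close>, so completeness of the basis gives \<open>h = H\<close> almost everywhere.
\<close>

lemma Linf_norm_le_of_coef:
  assumes ob: "orthonormal_basis_unit J0 \<psi>"
    and C: "\<And>l x. J0 - 1 \<le> l \<Longrightarrow> x \<in> {0..1} \<Longrightarrow> (\<Sum>k<2 ^ max l J0. \<bar>\<psi> l k x\<bar>) \<le> C * 2 powr (real l / 2)"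
    and h: "h \<in> L2_unit"
    and b: "\<And>l k. (l, k) \<in> idx_inf J0 \<Longrightarrow> \<bar>coef \<psi> h (l, k)\<bar> \<le> b l" "\<And>l. 0 \<le> b l"
    and sums: "(\<lambda>l. if J0 - 1 \<le> l then 2 powr (real l / 2) * b l else 0) sums s"
  shows "Linf_norm h \<le> ereal (C * s)"
proof -
  define t where "t l = (if J0 - 1 \<le> l then 2 powr (real l / 2) * b l else 0)" for l
  define T where "T l x = (if J0 - 1 \<le> l then \<Sum>k<2 ^ max l J0. coef \<psi> h (l, k) * \<psi> l k x else 0)" for l x
  have ob1: "\<psi> l k \<in> L2_unit" if "J0 - 1 \<le> l" "k < 2 ^ max l J0" for l k
    using that by (intro orthonormal_basisD(1)[OF ob]) (simp add: idx_inf_iff)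
  have T_L2: "T l \<in> L2_unit" for l
    unfolding T_def[abs_def] using ob1 by (cases "J0 - 1 \<le> l") (auto intro!: L2_unit_sum L2_unit_0)
  have T_bound: "\<bar>T l x\<bar> \<le> C * t l" if x: "x \<in> {0..1}" for l x
  proof (cases "J0 - 1 \<le> l")
    case True
    have "\<bar>T l x\<bar> \<le> (\<Sum>k<2 ^ max l J0. b l * \<bar>\<psi> l k x\<bar>)"
      unfolding T_def using True b(1)
      by (auto simp: abs_mult idx_inf_iff intro!: order_trans[OF sum_abs] sum_mono mult_right_mono)
    also have "\<dots> = b l * (\<Sum>k<2 ^ max l J0. \<bar>\<psi> l k x\<bar>)" by (simp add: sum_distrib_left)
    also have "\<dots> \<le> b l * (C * 2 powr (real l / 2))" using C[OF True x] b(2) by (intro mult_left_mono) auto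
    finally show ?thesis using True by (simp add: t_def mult_ac)
  qed (simp add: T_def t_def)
  have "t sums s" using sums unfolding t_def[abs_def] .
  then have Ct: "(\<lambda>l. C * t l) sums (C * s)" by (rule sums_mult)
  have T_summable: "summable (\<lambda>l. \<bar>T l x\<bar>)" if "x \<in> {0..1}" for x
    using T_bound[OF that] by (intro summable_comparison_test'[OF sums_summable[OF Ct], of 0]) auto
  define H where "H x = (\<Sum>l. T l x)" for x
  have H_bound: "\<bar>H x\<bar> \<le> C * s" if x: "x \<in> {0..1}" for x
  proof -
    have "\<bar>H x\<bar> \<le> (\<Sum>l. \<bar>T l x\<bar>)" unfolding H_def by (rule summable_rabs[OF T_summable[OF x]])
    also have "\<dots> \<le> (\<Sum>l. C * t l)" using T_bound[OF x] T_summable[OF x] Ct by (intro suminf_le) (auto simp: sums_iff)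
    finally show ?thesis using Ct by (simp add: sums_iff)
  qed
  have [measurable]: "T l \<in> borel_measurable unit_measure" for l
    using T_L2 by (rule L2_unit_measurable)
  have H_meas [measurable]: "H \<in> borel_measurable unit_measure"
    unfolding H_def[abs_def] by measurable
  have H_L2: "H \<in> L2_unit"
    unfolding L2_unit_def
  proof (safe intro!: H_meas unit.integrable_const_bound[where B="(C * s)\<^sup>2"] AE_I2)
    fix x assume "x \<in> space unit_measure"
    then have "\<bar>H x\<bar> \<le> \<bar>C * s\<bar>" using H_bound[of x] by (auto simp del: abs_mult)
    then show "norm ((H x)\<^sup>2) \<le> (C * s)\<^sup>2" by (simp add: abs_le_square_iff)
  qed measurable
  have H_coef: "inner_unit (\<psi> l' k') H = coef \<psi> h (l', k')" if lk: "(l', k') \<in> idx_inf J0" for l' k'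
  proof -
    have \<psi>L2: "\<psi> l' k' \<in> L2_unit" by (rule orthonormal_basisD(1)[OF ob lk])
    note [measurable] = L2_unit_measurable[OF \<psi>L2]
    have bnd: "\<bar>\<psi> l' k' x\<bar> \<le> C * 2 powr (real l' / 2)" if x: "x \<in> {0..1}" for x
    proof -
      have "\<bar>\<psi> l' k' x\<bar> \<le> (\<Sum>k<2 ^ max l' J0. \<bar>\<psi> l' k x\<bar>)"
        using lk by (intro member_le_sum) (auto simp: idx_inf_iff)
      also have "\<dots> \<le> C * 2 powr (real l' / 2)" using lk x by (intro C) (auto simp: idx_inf_iff)
      finally show ?thesis .
    qed
    define B where "B = C * 2 powr (real l' / 2)"
    have B0: "0 \<le> B" using bnd[of 0] unfolding B_def by auto
    have int: "integrable unit_measure (\<lambda>x. \<psi> l' k' x * T l x)" for l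
      by (rule L2_unit_mult_integrable[OF \<psi>L2 T_L2])
    have le: "\<bar>\<psi> l' k' x * T l x\<bar> \<le> B * (C * t l)" if "x \<in> {0..1}" for x l
      unfolding abs_mult B_def using bnd[OF that] T_bound[OF that] B0[unfolded B_def] by (intro mult_mono) auto
    have "inner_unit (\<psi> l' k') H = (\<integral>x. (\<Sum>l. \<psi> l' k' x * T l x) \<partial>unit_measure)"
      unfolding inner_on_def H_def
    proof (intro Bochner_Integration.integral_cong refl)
      fix x assume "x \<in> space unit_measure"
      then have "x \<in> {0..1}" by simp
      from summable_rabs_cancel[OF T_summable[OF this]]
      show "\<psi> l' k' x * (\<Sum>l. T l x) = (\<Sum>l. \<psi> l' k' x * T l x)" by (rule suminf_mult[symmetric])
    qed
    also have "\<dots> = (\<Sum>l. \<integral>x. \<psi> l' k' x * T l x \<partial>unit_measure)"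
    proof (rule integral_suminf[OF int])
      show "AE x in unit_measure. summable (\<lambda>l. norm (\<psi> l' k' x * T l x))"
      proof (rule AE_I2)
        fix x assume "x \<in> space unit_measure"
        then have "x \<in> {0..1}" by simp
        from le[OF this] show "summable (\<lambda>l. norm (\<psi> l' k' x * T l x))"
          by (intro summable_comparison_test'[OF summable_mult[OF sums_summable[OF Ct], of B], of 0]) auto
      qed
      show "summable (\<lambda>l. \<integral>x. norm (\<psi> l' k' x * T l x) \<partial>unit_measure)"
      proof (rule summable_comparison_test'[OF summable_mult[OF sums_summable[OF Ct], of B], of 0])
        fix l
        have "(\<integral>x. norm (\<psi> l' k' x * T l x) \<partial>unit_measure) \<le> (\<integral>x. B * (C * t l) \<partial>unit_measure)"
          using le int by (intro integral_mono) auto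
        then show "norm (\<integral>x. norm (\<psi> l' k' x * T l x) \<partial>unit_measure) \<le> B * (C * t l)"
          using unit.prob_space by simp
      qed
    qed
    also have "\<dots> = (\<Sum>l. if l = l' then coef \<psi> h (l', k') else 0)"
    proof (rule suminf_cong)
      fix l
      show "(\<integral>x. \<psi> l' k' x * T l x \<partial>unit_measure) = (if l = l' then coef \<psi> h (l', k') else 0)"
      proof (cases "J0 - 1 \<le> l")
        case True
        have "(\<integral>x. \<psi> l' k' x * T l x \<partial>unit_measure)
            = inner_unit (\<psi> l' k') (\<lambda>x. \<Sum>k<2 ^ max l J0. coef \<psi> h (l, k) * \<psi> l k x)"
          unfolding inner_on_def T_def using True by simp
        also have "\<dots> = (\<Sum>k<2 ^ max l J0. coef \<psi> h (l, k) * inner_unit (\<psi> l' k') (\<psi> l k))"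
          using ob1[OF True] \<psi>L2 by (intro inner_unit_sum_right) auto
        also have "\<dots> = (\<Sum>k<2 ^ max l J0. if k = k' then (if l = l' then coef \<psi> h (l', k') else 0) else 0)"
          using True by (intro sum.cong refl) (auto simp: orthonormal_basisD(2)[OF ob lk] idx_inf_iff)
        also have "\<dots> = (if l = l' then coef \<psi> h (l', k') else 0)"
          using lk by (auto simp: idx_inf_iff)
        finally show ?thesis .
      next
        case False
        then show ?thesis using lk by (auto simp: T_def idx_inf_iff)
      qed
    qed
    also have "\<dots> = coef \<psi> h (l', k')"
      using sums_single[of l' "\<lambda>_. coef \<psi> h (l', k')"] by (simp add: sums_iff)
    finally show ?thesis .
  qed
  have "AE x in unit_measure. h x - H x = 0"
  proof (rule orthonormal_basisD(3)[OF ob L2_unit_diff[OF h H_L2]])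
    fix l k assume lk: "(l, k) \<in> idx_inf J0"
    have "inner_unit (\<psi> l k) (\<lambda>x. h x - H x) = coef \<psi> h (l, k) - coef \<psi> H (l, k)"
      using coef_diff[of \<psi> "(l, k)" h H] orthonormal_basisD(1)[OF ob lk] h H_L2 by (simp add: coef_def)
    then show "inner_unit (\<psi> l k) (\<lambda>x. h x - H x) = 0"
      using H_coef[OF lk] by (simp add: coef_def)
  qed
  then have "AE x in unit_measure. ereal \<bar>h x\<bar> \<le> ereal (C * s)"
    using AE_space by eventually_elim (use H_bound in auto)
  then show ?thesis
    unfolding Linf_norm_def using L2_unit_measurable[OF h] by (intro esssup_I) auto
qed

section \<open>Coverage of approximate quantiles\<close>

text \<open>
  A radius with \<open>F (R \<omega>) \<approx> c\<close> is an approximate quantile of \<open>T\<close>, even if \<open>R\<close> and \<open>T\<close> are dependent: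
  \<open>R \<omega>\<close> lies between deterministic radii of \<open>F\<close>-value slightly below \<open>c - \<epsilon>\<close> and slightly above \<open>c + \<epsilon>\<close>,
  and for those the coverage is known exactly.
\<close>

lemma (in prob_space) coverage_of_approximate_quantile:
  fixes T R :: "'a \<Rightarrow> real" and F :: "real \<Rightarrow> real"
  assumes [measurable]: "T \<in> borel_measurable M" "R \<in> borel_measurable M" "A \<in> sets M"
    and T: "\<And>\<rho>. prob {\<omega> \<in> space M. T \<omega> \<le> \<rho>} = F \<rho>"
    and F: "mono F" "\<And>u. 0 < u \<Longrightarrow> u < 1 \<Longrightarrow> \<exists>\<rho>. F \<rho> = u"
    and c: "0 < c" "c < 1" and \<epsilon>: "0 \<le> \<epsilon>"
    and A: "1 - r \<le> prob A" "\<And>\<omega>. \<omega> \<in> A \<Longrightarrow> \<bar>F (R \<omega>) - c\<bar> \<le> \<epsilon>"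
  shows "\<bar>prob {\<omega> \<in> space M. T \<omega> \<le> R \<omega>} - c\<bar> \<le> \<epsilon> + r"
proof -
  define G where "G = {\<omega> \<in> space M. T \<omega> \<le> R \<omega>}"
  have [measurable]: "G \<in> sets M" unfolding G_def by measurable
  have bad: "prob (space M - A) \<le> r" using A(1) prob_compl[of A] by simp
  have r0: "0 \<le> r" using bad measure_nonneg order_trans by blast
  have split: "prob B \<le> prob D + r" if "B \<in> sets M" "D \<in> sets M" "B \<inter> A \<subseteq> D" for B D
  proof -
    have "prob B \<le> prob (D \<union> (space M - A))"
      using that sets.sets_into_space[OF that(1)] by (intro finite_measure_mono) auto
    also have "\<dots> \<le> prob D + prob (space M - A)"
      using that by (intro measure_Un_le) auto
    finally show ?thesis using bad by linarith
  qed
  have upper: "prob G \<le> c + \<epsilon> + r"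
  proof (cases "c + \<epsilon> < 1")
    case True
    have above: "prob G - r \<le> u" if u: "c + \<epsilon> < u" "u < 1" for u
    proof -
      obtain \<rho> where \<rho>: "F \<rho> = u" using F(2)[of u] u c \<epsilon> by auto
      have "G \<inter> A \<subseteq> {\<omega> \<in> space M. T \<omega> \<le> \<rho>}"
      proof safe
        fix \<omega> assume \<omega>: "\<omega> \<in> G" "\<omega> \<in> A"
        show "\<omega> \<in> space M" using \<omega>(1) by (simp add: G_def)
        have "F (R \<omega>) < F \<rho>" using A(2)[OF \<omega>(2)] u \<rho> by auto
        then have "R \<omega> < \<rho>" using monoD[OF F(1), of \<rho> "R \<omega>"] by (meson not_le)
        then show "T \<omega> \<le> \<rho>" using \<omega>(1) by (simp add: G_def)
      qed
      then show ?thesis using split[of G "{\<omega> \<in> space M. T \<omega> \<le> \<rho>}"] T[of \<rho>] \<rho> by simp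
    qed
    have "prob G - r \<le> c + \<epsilon>"
      by (rule dense_ge_bounded[OF True above])
    then show ?thesis by linarith
  next
    case False
    then show ?thesis using r0 prob_le_1[of G] by linarith
  qed
  have lower: "c - \<epsilon> - r \<le> prob G"
  proof (cases "0 < c - \<epsilon>")
    case True
    have below: "u \<le> prob G + r" if u: "0 < u" "u < c - \<epsilon>" for u
    proof -
      obtain \<rho> where \<rho>: "F \<rho> = u" using F(2)[of u] u c \<epsilon> by auto
      have "{\<omega> \<in> space M. T \<omega> \<le> \<rho>} \<inter> A \<subseteq> G"
      proof safe
        fix \<omega> assume \<omega>: "\<omega> \<in> space M" "T \<omega> \<le> \<rho>" "\<omega> \<in> A"
        have "F \<rho> < F (R \<omega>)" using A(2)[OF \<omega>(3)] u \<rho> by auto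
        then have "\<rho> < R \<omega>" using monoD[OF F(1), of "R \<omega>" \<rho>] by (meson not_le)
        then show "\<omega> \<in> G" using \<omega> by (simp add: G_def)
      qed
      then show ?thesis using split[of "{\<omega> \<in> space M. T \<omega> \<le> \<rho>}" G] T[of \<rho>] \<rho> by simp
    qed
    have "c - \<epsilon> \<le> prob G + r"
      by (rule dense_le_bounded[OF True below])
    then show ?thesis by linarith
  next
    case False
    then show ?thesis using r0 measure_nonneg[of M G] by linarith
  qed
  show ?thesis using upper lower unfolding G_def by (simp add: abs_le_iff)
qed

section \<open>Weighted maxima of Gaussian coordinates\<close>

lemma prod_ge_one_minus_sum:
  fixes a :: "'i \<Rightarrow> real"
  assumes "finite I" "\<And>i. i \<in> I \<Longrightarrow> 0 \<le> a i \<and> a i \<le> 1"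
  shows "1 - (\<Sum>i\<in>I. 1 - a i) \<le> (\<Prod>i\<in>I. a i)"
  using assms
proof (induction I rule: finite_induct)
  case (insert j I)
  have "0 \<le> (\<Prod>i\<in>I. a i)" "(\<Prod>i\<in>I. a i) \<le> 1" using insert.prems by (auto intro!: prod_nonneg prod_le_1)
  then have "(1 - a j) * (\<Prod>i\<in>I. a i) \<le> (1 - a j) * 1" using insert.prems by (intro mult_left_mono) auto
  then have "(\<Prod>i\<in>I. a i) - (1 - a j) \<le> a j * (\<Prod>i\<in>I. a i)" by (simp add: algebra_simps)
  then show ?case using insert by simp
qed simp

text \<open>
  The probability that centred Gaussian coordinates of variance \<open>1 / n\<close> have weighted maximum at most
  \<open>\<rho>\<close>. It is at the same time the distribution function of the error of the truncated estimator and,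
  for every observation, the Gaussian approximation to the posterior probability of the band of radius \<open>\<rho>\<close>.
\<close>

definition box_prob :: "nat \<Rightarrow> nat \<Rightarrow> (nat \<Rightarrow> real) \<Rightarrow> nat \<Rightarrow> real \<Rightarrow> real" where
  "box_prob J0 J w n \<rho> = (\<Prod>i\<in>idx J0 J. normal_prob (\<rho> * w (fst i) * sqrt (real n)))"

lemma idx_level:
  assumes "i \<in> idx J0 J"
  shows "J0 - 1 \<le> fst i" "J0 \<le> J \<Longrightarrow> fst i \<le> J - 1"
proof -
  obtain l k where i: "i = (l, k)" by (cases i)
  then have "J0 \<le> l \<and> l < J \<or> l = J0 - 1"
    using assms unfolding idx_def by blast
  then show "J0 - 1 \<le> fst i" "J0 \<le> J \<Longrightarrow> fst i \<le> J - 1"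
    unfolding i fst_conv by linarith+
qed

lemma weightsD:
  assumes "weights J0 w"
  shows weights_pos: "2 \<le> J0 \<Longrightarrow> J0 - 1 \<le> l \<Longrightarrow> 0 < w l"
    and weights_square: "J0 - 1 \<le> l \<Longrightarrow> real l \<le> (w l)\<^sup>2"
    and weight_ratio_tendsto: "filterlim (weight_ratio J0 w) at_top sequentially"
proof -
  have pos: "\<forall>l\<ge>1. 0 < w l" and ge: "\<forall>l\<ge>J0 - 1. sqrt (real l) \<le> w l"
    and lim: "filterlim (weight_ratio J0 w) at_top sequentially"
    by (insert assms[unfolded weights_def], (elim conjE, assumption)+)
  show "filterlim (weight_ratio J0 w) at_top sequentially" by (rule lim)
  show "0 < w l" if "2 \<le> J0" "J0 - 1 \<le> l"
  proof -
    have "1 \<le> l" using that by linarith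
    then show ?thesis using pos by blast
  qed
  show "real l \<le> (w l)\<^sup>2" if "J0 - 1 \<le> l"
  proof -
    have "(sqrt (real l))\<^sup>2 \<le> (w l)\<^sup>2" using ge that by (intro power_mono) auto
    then show ?thesis by simp
  qed
qed

context
  fixes J0 J n :: nat and w :: "nat \<Rightarrow> real"
  assumes J0: "2 \<le> J0" and J: "J0 \<le> J" and n: "2 \<le> n" and w: "weights J0 w"
begin

lemma mono_box_prob: "mono (box_prob J0 J w n)"
proof (rule monoI)
  fix x y :: real assume xy: "x \<le> y"
  show "box_prob J0 J w n x \<le> box_prob J0 J w n y"
    unfolding box_prob_def
  proof (intro prod_mono conjI normal_prob_nonneg normal_prob_mono mult_right_mono xy)
    fix i assume "i \<in> idx J0 J"
    show "0 \<le> w (fst i)" using weights_pos[OF w J0 idx_level(1)[OF \<open>i \<in> idx J0 J\<close>]] by simp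
  qed simp
qed

lemma box_prob_surj:
  assumes u: "0 < u" "u < 1"
  shows "\<exists>\<rho>. box_prob J0 J w n \<rho> = u"
proof -
  have cont: "isCont (box_prob J0 J w n) \<rho>" for \<rho>
    unfolding box_prob_def[abs_def]
    by (intro continuous_intros isCont_o2[OF _ isCont_normal_prob])
  have ne: "idx J0 J \<noteq> {}"
  proof
    assume "idx J0 J = {}"
    then show False using card_idx[of J0 J] J0 J by simp
  qed
  have "box_prob J0 J w n 0 = 0"
    unfolding box_prob_def using ne by (simp add: normal_prob_0 card_gt_0_iff)
  moreover have "(box_prob J0 J w n \<longlongrightarrow> (\<Prod>i\<in>idx J0 J. 1)) at_top"
    unfolding box_prob_def[abs_def]
  proof (intro tendsto_prod filterlim_compose[OF tendsto_normal_prob])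
    fix i assume i: "i \<in> idx J0 J"
    have "0 < w (fst i) * sqrt (real n)" using weights_pos[OF w J0 idx_level(1)[OF i]] n by simp
    then show "filterlim (\<lambda>x. x * w (fst i) * sqrt (real n)) at_top at_top"
      unfolding mult.assoc by (rule filterlim_at_top_mult_tendsto_pos[OF tendsto_const _ filterlim_ident])
  qed
  then have "eventually (\<lambda>\<rho>. u < box_prob J0 J w n \<rho>) at_top"
    using u by (intro order_tendstoD(1)) auto
  then have "eventually (\<lambda>\<rho>. u < box_prob J0 J w n \<rho> \<and> 0 \<le> \<rho>) at_top"
    using eventually_ge_at_top[of 0] by eventually_elim simp
  then obtain b where "u < box_prob J0 J w n b" "0 \<le> b"
    unfolding eventually_at_top_linorder by blast
  ultimately have "\<exists>\<rho>. 0 \<le> \<rho> \<and> \<rho> \<le> b \<and> box_prob J0 J w n \<rho> = u"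
    using cont u by (intro IVT) simp_all
  then show ?thesis by blast
qed

text \<open>
  Radii of order \<open>1 / sqrt n\<close> capture the weighted maximum with probability close to 1. By \<open>w l \<ge> sqrt l\<close>
  each of the roughly \<open>2 ^ l\<close> coordinates of level \<open>l\<close> exceeds the radius with probability at most \<open>sqrt 2 * x ^ l\<close>,
  where \<open>x = \<alpha> / 32\<close>, and the union bound is a geometric series dominated by its first term, which is at most of order \<open>x\<close>.
\<close>

lemma box_prob_large:
  assumes \<alpha>: "0 < \<alpha>" "\<alpha> < 1"
  shows "1 - \<alpha> / 2 < box_prob J0 J w n (2 * sqrt (ln (32 / \<alpha>)) / sqrt (real n))"
proof -
  let ?K = "2 * sqrt (ln (32 / \<alpha>))"
  define x where "x = \<alpha> / 32"
  have x: "0 < x" "x < 1 / 32" using \<alpha> by (auto simp: x_def)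
  have ln0: "0 < ln (32 / \<alpha>)" using \<alpha> by (intro ln_gt_zero) auto
  have tail: "1 - normal_prob (?K * w (fst i)) \<le> sqrt 2 * x ^ fst i" if i: "i \<in> idx J0 J" for i
  proof -
    have "1 - normal_prob (?K * w (fst i)) \<le> sqrt 2 * exp (- (?K * w (fst i))\<^sup>2 / 4)"
      using weights_pos[OF w J0 idx_level(1)[OF i]] ln0 by (intro normal_prob_tail_upper) auto
    also have "\<dots> = sqrt 2 * exp (- (ln (32 / \<alpha>) * (w (fst i))\<^sup>2))"
      using ln0 by (simp add: power_mult_distrib)
    also have "\<dots> \<le> sqrt 2 * exp (- (ln (32 / \<alpha>) * real (fst i)))"
      using weights_square[OF w idx_level(1)[OF i]] ln0 by simp
    also have "exp (- (ln (32 / \<alpha>) * real (fst i))) = exp (ln x) ^ fst i"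
      using \<alpha> by (simp add: x_def ln_div mult.commute algebra_simps flip: exp_of_nat_mult)
    finally show ?thesis using x by simp
  qed
  \<comment> \<open>The subtracted term makes the bound inductive; it shrinks by at least the summand of the new level.\<close>
  have sum_le: "2 ^ J0 * x ^ (J0 - 1) + (\<Sum>l=J0..<J. 2 ^ l * x ^ l) \<le> 8 * x - 2 * (2 * x) ^ J"
    using J
  proof (induction J rule: dec_induct)
    case base
    have "(2::real) ^ J0 * x ^ (J0 - 1) = 2 * (2 * x) ^ (J0 - 1)"
      using J0 by (cases J0) (auto simp: power_mult_distrib)
    moreover have "(2 * x) ^ (J0 - 1) \<le> 2 * x" "(2 * x) ^ J0 \<le> 2 * x"
      using power_decreasing[of 1 "J0 - 1" "2 * x"] power_decreasing[of 1 J0 "2 * x"] J0 x by simp_all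
    ultimately have "2 ^ J0 * x ^ (J0 - 1) \<le> 8 * x - 2 * (2 * x) ^ J0" using x by linarith
    then show ?case by simp
  next
    case (step k)
    have "2 * (2 * x) ^ Suc k \<le> (2 * x) ^ k" using x by (simp add: mult_le_cancel_right2)
    moreover have "(\<Sum>l=J0..<Suc k. 2 ^ l * x ^ l) = (\<Sum>l=J0..<k. 2 ^ l * x ^ l) + (2 * x) ^ k"
      using step.hyps by (simp add: power_mult_distrib)
    ultimately show ?case using step.IH by linarith
  qed
  have "(\<Sum>i\<in>idx J0 J. 1 - normal_prob (?K * w (fst i))) \<le> (\<Sum>i\<in>idx J0 J. sqrt 2 * x ^ fst i)"
    by (intro sum_mono tail)
  also have "\<dots> = sqrt 2 * (\<Sum>i\<in>idx J0 J. x ^ fst i)" by (simp add: sum_distrib_left)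
  also have "(\<Sum>i\<in>idx J0 J. x ^ fst i) = 2 ^ J0 * x ^ (J0 - 1) + (\<Sum>l=J0..<J. 2 ^ l * x ^ l)"
    using J0 J by (intro sum_idx) auto
  also have "sqrt 2 * \<dots> \<le> 3 / 2 * (8 * x)"
  proof (rule mult_mono)
    show "sqrt 2 \<le> 3 / 2" by (rule real_le_lsqrt) (simp_all add: power2_eq_square)
    show "2 ^ J0 * x ^ (J0 - 1) + (\<Sum>l=J0..<J. 2 ^ l * x ^ l) \<le> 8 * x" using sum_le zero_le_power[of "2 * x" J] x by linarith
  qed (use x in \<open>auto intro!: sum_nonneg add_nonneg_nonneg\<close>)
  also have "\<dots> < \<alpha> / 2" using \<alpha> by (simp add: x_def)
  finally have "1 - \<alpha> / 2 < 1 - (\<Sum>i\<in>idx J0 J. 1 - normal_prob (?K * w (fst i)))" by simp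
  also have "\<dots> \<le> (\<Prod>i\<in>idx J0 J. normal_prob (?K * w (fst i)))"
    by (intro prod_ge_one_minus_sum) (auto simp: normal_prob_nonneg normal_prob_le_1)
  also have "\<dots> = box_prob J0 J w n (?K / sqrt (real n))"
    unfolding box_prob_def using n by (intro prod.cong refl arg_cong[where f=normal_prob]) auto
  finally show ?thesis .
qed

lemma w_bar_ge:
  assumes "i \<in> idx J0 J"
  shows "w (fst i) \<le> w_bar J0 w J"
proof -
  have "fst i \<in> {J0 - 1..J - 1}"
    using idx_level(1)[OF assms] idx_level(2)[OF assms J] by simp
  then show ?thesis
    unfolding w_bar_def by (intro Max_ge finite_imageI finite_atLeastAtMost imageI)
qed

lemma w_bar_pos: "0 < w_bar J0 w J"
proof -
  have "w (J0 - 1) \<le> w_bar J0 w J"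
    unfolding w_bar_def using J by (intro Max_ge) auto
  then show ?thesis using weights_pos[OF w J0, of "J0 - 1"] by simp
qed

text \<open>
  The maximum of \<open>2 ^ J\<close> standard Gaussians is unlikely to stay below \<open>sqrt J / 2\<close>: each coordinate exceeds
  this level with probability at least \<open>2 / 9 * exp (- J / 4)\<close>, and \<open>2 * exp (- 1 / 4) \<ge> 3 / 2\<close>. Replacing all
  weights by their maximum makes the coordinates comparable.
\<close>

lemma box_prob_small:
  "box_prob J0 J w n (sqrt (real J) / (2 * sqrt (real n) * w_bar J0 w J)) \<le> exp (- (2 / 9 * (3 / 2) ^ J))"
proof -
  let ?t = "sqrt (real J) / 2"
  have tail: "2 / 9 * exp (- real J / 4) \<le> 1 - normal_prob ?t"
  proof -
    have "exp 1 \<le> (3::real)" by (rule exp_le)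
    have "sqrt (2 * pi) \<le> 3"
      using pi_less_4 by (intro real_le_lsqrt) (auto simp: power2_eq_square)
    have "(?t + 1)\<^sup>2 / 2 \<le> real J / 4 + 1"
    proof -
      have "(?t + 1)\<^sup>2 \<le> 2 * ?t\<^sup>2 + 2" using zero_le_power2[of "?t - 1"] by (simp add: power2_eq_square algebra_simps)
      also have "?t\<^sup>2 = real J / 4" by (simp add: power_divide)
      finally show ?thesis by simp
    qed
    then have "exp (- (real J / 4 + 1)) \<le> exp (- (?t + 1)\<^sup>2 / 2)" by simp
    have "2 / 9 * exp (- real J / 4) = 2 * (1 / 3 * (exp (- real J / 4) * (1 / 3)))" by simp
    also have "\<dots> \<le> 2 * (1 / sqrt (2 * pi) * (exp (- real J / 4) * (1 / exp 1)))"
      using \<open>exp 1 \<le> 3\<close> \<open>sqrt (2 * pi) \<le> 3\<close>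
      by (intro mult_left_mono mult_mono divide_left_mono) (auto simp: field_simps)
    also have "exp (- real J / 4) * (1 / exp 1) = exp (- (real J / 4 + 1))"
      by (simp flip: exp_diff)
    also have "2 * (1 / sqrt (2 * pi) * \<dots>) \<le> 2 * std_normal_density (?t + 1)"
      unfolding std_normal_density_def using \<open>exp (- (real J / 4 + 1)) \<le> exp (- (?t + 1)\<^sup>2 / 2)\<close>
      by (intro mult_left_mono) auto
    also have "\<dots> \<le> 1 - normal_prob ?t" by (rule normal_prob_tail_lower) simp
    finally show ?thesis .
  qed
  have "box_prob J0 J w n (sqrt (real J) / (2 * sqrt (real n) * w_bar J0 w J))
      \<le> (\<Prod>i\<in>idx J0 J. normal_prob ?t)"
    unfolding box_prob_def
  proof (intro prod_mono conjI normal_prob_nonneg normal_prob_mono)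
    fix i assume i: "i \<in> idx J0 J"
    have "sqrt (real J) / (2 * sqrt (real n) * w_bar J0 w J) * w (fst i) * sqrt (real n)
        = ?t * (w (fst i) / w_bar J0 w J)"
    proof -
      have "a / (2 * b * c) * d * b = a / 2 * (d / c)" if "b \<noteq> 0" "c \<noteq> 0" for a b c d :: real
        using that by (simp add: field_simps)
      then show ?thesis using n w_bar_pos by (simp only: real_sqrt_eq_0_iff)
    qed
    also have "\<dots> \<le> ?t * 1"
      using w_bar_ge[OF i] w_bar_pos by (intro mult_left_mono) auto
    finally show "sqrt (real J) / (2 * sqrt (real n) * w_bar J0 w J) * w (fst i) * sqrt (real n) \<le> ?t" by simp
  qed
  also have "\<dots> = normal_prob ?t ^ 2 ^ J"
    using J0 J by (simp add: card_idx)
  also have "\<dots> \<le> exp (- (2 / 9 * exp (- real J / 4))) ^ 2 ^ J"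
  proof (rule power_mono)
    have "normal_prob ?t \<le> 1 + - (2 / 9 * exp (- real J / 4))" using tail by simp
    also have "\<dots> \<le> exp (- (2 / 9 * exp (- real J / 4)))" by (rule exp_ge_add_one_self)
    finally show "normal_prob ?t \<le> exp (- (2 / 9 * exp (- real J / 4)))" .
  qed (rule normal_prob_nonneg)
  also have "\<dots> = exp (- (2 / 9 * (2 ^ J * exp (- real J / 4))))"
    by (simp flip: exp_of_nat_mult)
  also have "\<dots> \<le> exp (- (2 / 9 * (3 / 2) ^ J))"
  proof -
    have "(3 / 4) ^ J \<le> exp (- 1 / 4 :: real) ^ J"
      using exp_ge_add_one_self[of "- 1 / 4"] by (intro power_mono) auto
    also have "\<dots> = exp (- real J / 4)" by (simp flip: exp_of_nat_mult)
    finally have "2 ^ J * (3 / 4) ^ J \<le> 2 ^ J * exp (- real J / 4)" by (intro mult_left_mono) auto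
    moreover have "2 ^ J * (3 / 4) ^ J = (3 / 2 :: real) ^ J" by (simp flip: power_mult_distrib)
    ultimately show ?thesis by simp
  qed
  finally show ?thesis .
qed

end

section \<open>White noise and the coverage of the band\<close>

lemma white_noiseD:
  assumes "white_noise M W"
  shows white_noise_prob_space: "prob_space M"
    and white_noise_measurable: "g \<in> L2_unit \<Longrightarrow> W g \<in> borel_measurable M"
    and white_noise_law: "finite G \<Longrightarrow> G \<subseteq> L2_unit \<Longrightarrow>
      distr M borel (\<lambda>\<omega>. \<Sum>g\<in>G. a g * W g \<omega>) =
      normal_measure (inner_unit (\<lambda>x. \<Sum>g\<in>G. a g * g x) (\<lambda>x. \<Sum>g\<in>G. a g * g x))"
proof -
  note wn = assms[unfolded white_noise_def]
  show "prob_space M" by (rule wn[THEN conjunct1])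
  show "W g \<in> borel_measurable M" if "g \<in> L2_unit"
    using wn[THEN conjunct2, THEN conjunct1] that by (rule bspec)
  show "distr M borel (\<lambda>\<omega>. \<Sum>g\<in>G. a g * W g \<omega>) =
      normal_measure (inner_unit (\<lambda>x. \<Sum>g\<in>G. a g * g x) (\<lambda>x. \<Sum>g\<in>G. a g * g x))"
    if "finite G" "G \<subseteq> L2_unit"
    using wn[THEN conjunct2, THEN conjunct2, rule_format, OF conjI, OF that] .
qed

text \<open>
  White noise is defined through sums over sets of functions, so the indexed family has to be injective;
  orthonormality makes it so.
\<close>

lemma white_noise_orthonormal_law:
  assumes wn: "white_noise M W" and I: "finite I" and \<Psi>: "\<And>i. i \<in> I \<Longrightarrow> \<Psi> i \<in> L2_unit"
    and orth: "\<And>i j. i \<in> I \<Longrightarrow> j \<in> I \<Longrightarrow> inner_unit (\<Psi> i) (\<Psi> j) = (if i = j then 1 else 0)"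
  shows "distr M borel (\<lambda>\<omega>. \<Sum>i\<in>I. s i * W (\<Psi> i) \<omega>) = normal_measure (\<Sum>i\<in>I. (s i)\<^sup>2)"
proof -
  have inj: "inj_on \<Psi> I"
  proof (rule inj_onI)
    fix i j assume ij: "i \<in> I" "j \<in> I" "\<Psi> i = \<Psi> j"
    show "i = j"
    proof (rule ccontr)
      assume "i \<noteq> j"
      then have "inner_unit (\<Psi> i) (\<Psi> j) = 0" using orth[OF ij(1,2)] by simp
      moreover have "inner_unit (\<Psi> i) (\<Psi> i) = 1" using orth[OF ij(1) ij(1)] by simp
      ultimately show False using ij(3) by simp
    qed
  qed
  define a where "a g = s (the_inv_into I \<Psi> g)" for g
  have a: "a (\<Psi> i) = s i" if "i \<in> I" for i
    unfolding a_def using the_inv_into_f_f[OF inj that] by simp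
  have lin: "(\<Sum>g\<in>\<Psi> ` I. a g * f g) = (\<Sum>i\<in>I. s i * f (\<Psi> i))" for f :: "(real \<Rightarrow> real) \<Rightarrow> real"
    unfolding sum.reindex[OF inj] comp_def by (intro sum.cong refl) (simp add: a)
  have L2: "(\<lambda>x. \<Sum>i\<in>I. s i * \<Psi> i x) \<in> L2_unit" by (intro L2_unit_sum \<Psi>)
  have "inner_unit (\<lambda>x. \<Sum>i\<in>I. s i * \<Psi> i x) (\<lambda>x. \<Sum>i\<in>I. s i * \<Psi> i x)
      = (\<Sum>j\<in>I. s j * inner_unit (\<lambda>x. \<Sum>i\<in>I. s i * \<Psi> i x) (\<Psi> j))"
    by (rule inner_unit_sum_right[OF \<Psi> L2])
  also have "\<dots> = (\<Sum>j\<in>I. s j * s j)"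
  proof (intro sum.cong refl arg_cong2[where f="(*)"])
    fix j assume j: "j \<in> I"
    have "inner_unit (\<lambda>x. \<Sum>i\<in>I. s i * \<Psi> i x) (\<Psi> j) = (\<Sum>i\<in>I. s i * inner_unit (\<Psi> j) (\<Psi> i))"
      unfolding inner_unit_commute[of _ "\<Psi> j"] by (rule inner_unit_sum_right[OF \<Psi> \<Psi>[OF j]])
    also have "\<dots> = (\<Sum>i\<in>I. if j = i then s i else 0)"
      using j orth by (intro sum.cong refl) simp
    also have "\<dots> = s j" using I j by simp
    finally show "inner_unit (\<lambda>x. \<Sum>i\<in>I. s i * \<Psi> i x) (\<Psi> j) = s j" .
  qed
  finally have var: "inner_unit (\<lambda>x. \<Sum>i\<in>I. s i * \<Psi> i x) (\<lambda>x. \<Sum>i\<in>I. s i * \<Psi> i x) = (\<Sum>i\<in>I. (s i)\<^sup>2)"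
    by (simp add: power2_eq_square)
  have "distr M borel (\<lambda>\<omega>. \<Sum>g\<in>\<Psi> ` I. a g * W g \<omega>)
      = normal_measure (inner_unit (\<lambda>x. \<Sum>g\<in>\<Psi> ` I. a g * g x) (\<lambda>x. \<Sum>g\<in>\<Psi> ` I. a g * g x))"
    using I \<Psi> by (intro white_noise_law[OF wn]) auto
  then show ?thesis
    unfolding lin[of "\<lambda>g. W g _"] lin[of "\<lambda>g. g _"] var .
qed

lemma white_noise_tail:
  assumes wn: "white_noise M W" and g: "g \<in> L2_unit" "inner_unit g g = 1"
  shows "measure M {\<omega> \<in> space M. t < \<bar>W g \<omega>\<bar>} = 1 - normal_prob t"
proof -
  have [measurable]: "W g \<in> borel_measurable M" by (rule white_noise_measurable[OF wn g(1)])
  have "distr M borel (W g) = std_normal_distribution"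
    using white_noise_orthonormal_law[OF wn, of "{()}" "\<lambda>_. g" "\<lambda>_. 1"] g
    by (simp add: normal_measure_def)
  moreover have "measure (distr M borel (W g)) {x. t < \<bar>x\<bar>} = measure M {\<omega> \<in> space M. t < \<bar>W g \<omega>\<bar>}"
    by (subst measure_distr) (auto intro!: arg_cong[where f="measure M"])
  ultimately show ?thesis using normal_prob_tail[of t] by simp
qed

locale sieve_model =
  fixes J0 J n :: nat and \<psi> :: "nat \<Rightarrow> nat \<Rightarrow> real \<Rightarrow> real" and f0 :: "real \<Rightarrow> real"
    and w :: "nat \<Rightarrow> real" and \<pi> :: "(nat \<times> nat \<Rightarrow> real) \<Rightarrow> real" and \<alpha> C1 :: real
    and M :: "'a measure" and W :: "(real \<Rightarrow> real) \<Rightarrow> 'a \<Rightarrow> real" and R :: "'a \<Rightarrow> real"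
  assumes J0: "2 \<le> J0" and J: "J0 \<le> J" and n: "2 \<le> n" "2 ^ J \<le> n"
    and ob: "orthonormal_basis_unit J0 \<psi>" and f0: "f0 \<in> L2_unit" and w: "weights J0 w"
    and prior: "sieve_prior J0 J \<pi>" and C1: "0 < C1" and \<alpha>: "0 < \<alpha>" "\<alpha> < 1"
    and wn: "white_noise M W"
    and radius: "credible_radius J0 \<psi> w J n \<pi> \<alpha> M (obs_coef \<psi> n f0 W) R"
    and mass: "\<pi> (restrict (coef \<psi> f0) (idx J0 J)) \<ge> real n powr (2 ^ J / 2) * real n powr (- C1 * 2 ^ J)"
    and small: "prior_modulus J0 J n \<pi> (restrict (coef \<psi> f0) (idx J0 J)) (1 / sqrt (real n)) \<le> 1 / 2"
begin

sublocale prob_space M by (rule white_noise_prob_space[OF wn])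

definition "Y = obs_coef \<psi> n f0 W"
definition "\<beta>0 = restrict (coef \<psi> f0) (idx J0 J)"
definition "r = real n powr (- (2 ^ J))"
definition "\<Phi> = prior_modulus J0 J n \<pi> \<beta>0 ((C1 + 10) * sqrt (2 ^ J * ln (real n)))"

lemma n_pos: "0 < real n" "0 < sqrt (real n)" using n by auto

lemma idx_weight_pos: "i \<in> idx_inf J0 \<Longrightarrow> 0 < w (fst i)"
  using weights_pos[OF w J0] by (cases i) (simp add: idx_inf_iff)

lemma \<psi>_L2: "(l, k) \<in> idx_inf J0 \<Longrightarrow> \<psi> l k \<in> L2_unit"
  by (rule orthonormal_basisD(1)[OF ob])

lemma Y_eq: "Y \<omega> (l, k) = coef \<psi> f0 (l, k) + W (\<psi> l k) \<omega> / sqrt (real n)"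
  unfolding Y_def obs_coef_def obs_def coef_def by simp

lemma Y_measurable: "i \<in> idx_inf J0 \<Longrightarrow> (\<lambda>\<omega>. Y \<omega> i) \<in> borel_measurable M"
proof -
  assume i: "i \<in> idx_inf J0"
  obtain l k where lk: "i = (l, k)" by (cases i)
  have [measurable]: "W (\<psi> l k) \<in> borel_measurable M"
    using i unfolding lk by (intro white_noise_measurable[OF wn] \<psi>_L2)
  show ?thesis unfolding lk Y_eq by measurable
qed

lemma R_measurable [measurable]: "R \<in> borel_measurable M"
  using radius unfolding credible_radius_def by (rule conjunct1)

lemma law_Y: "distr M (sieve_space J0 J) (\<lambda>\<omega>. restrict (Y \<omega>) (idx J0 J)) = gauss (idx J0 J) \<beta>0 (1 / sqrt (real n))"
proof -
  let ?\<Psi> = "\<lambda>i. \<psi> (fst i) (snd i)"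
  have inf: "(fst i, snd i) \<in> idx_inf J0" if "i \<in> idx J0 J" for i
    using that idx_subset_idx_inf[of J0 J] by auto
  have L2: "?\<Psi> i \<in> L2_unit" if "i \<in> idx J0 J" for i
    by (rule \<psi>_L2[OF inf[OF that]])
  have "distr M (\<Pi>\<^sub>M i\<in>idx J0 J. borel) (\<lambda>\<omega>. \<lambda>i\<in>idx J0 J. \<beta>0 i + 1 / sqrt (real n) * W (?\<Psi> i) \<omega>)
      = gauss (idx J0 J) \<beta>0 (1 / sqrt (real n))"
  proof (rule distr_gaussian_vector)
    show "W (?\<Psi> i) \<in> borel_measurable M" if "i \<in> idx J0 J" for i
      by (rule white_noise_measurable[OF wn L2[OF that]])
    show "distr M borel (\<lambda>\<omega>. \<Sum>i\<in>idx J0 J. s i * W (?\<Psi> i) \<omega>) = normal_measure (\<Sum>i\<in>idx J0 J. (s i)\<^sup>2)" for s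
    proof (rule white_noise_orthonormal_law[OF wn finite_idx L2])
      fix i j assume "i \<in> idx J0 J" "j \<in> idx J0 J"
      from orthonormal_basisD(2)[OF ob inf[OF this(1)] inf[OF this(2)]]
      show "inner_unit (?\<Psi> i) (?\<Psi> j) = (if i = j then 1 else 0)" by simp
    qed
  qed (use n_pos in auto)
  moreover have "(\<lambda>i\<in>idx J0 J. \<beta>0 i + 1 / sqrt (real n) * W (?\<Psi> i) \<omega>) = restrict (Y \<omega>) (idx J0 J)" for \<omega>
  proof (rule restrict_ext)
    fix i assume "i \<in> idx J0 J"
    then show "\<beta>0 i + 1 / sqrt (real n) * W (?\<Psi> i) \<omega> = Y \<omega> i"
      using Y_eq[of \<omega> "fst i" "snd i"] by (simp add: \<beta>0_def)
  qed
  ultimately show ?thesis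
    unfolding sieve_space_def by (simp cong: distr_cong sets_PiM_cong)
qed

lemma restrict_Y_measurable [measurable]:
  "(\<lambda>\<omega>. restrict (Y \<omega>) (idx J0 J)) \<in> measurable M (sieve_space J0 J)"
  unfolding sieve_space_def
  by (intro measurable_restrict) (use Y_measurable idx_subset_idx_inf[of J0 J] in auto)

lemma \<beta>0_space: "\<beta>0 \<in> space (sieve_space J0 J)"
  unfolding \<beta>0_def sieve_space_def by (simp add: space_PiM)

lemma Y_event:
  assumes B: "B \<in> sets (sieve_space J0 J)"
  shows "{\<omega> \<in> space M. restrict (Y \<omega>) (idx J0 J) \<in> B} \<in> sets M"
proof -
  have "{\<omega> \<in> space M. restrict (Y \<omega>) (idx J0 J) \<in> B} = (\<lambda>\<omega>. restrict (Y \<omega>) (idx J0 J)) -` B \<inter> space M"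
    by auto
  then show ?thesis using measurable_sets[OF restrict_Y_measurable B] by simp
qed

lemma prob_Y:
  assumes B: "B \<in> sets (sieve_space J0 J)"
  shows "prob {\<omega> \<in> space M. restrict (Y \<omega>) (idx J0 J) \<in> B} = measure (gauss (idx J0 J) \<beta>0 (1 / sqrt (real n))) B"
  unfolding law_Y[symmetric] using B
  by (subst measure_distr) (auto intro!: arg_cong[where f=prob])

definition "near = {\<omega> \<in> space M. real n * (\<Sum>i\<in>idx J0 J. (Y \<omega> i - \<beta>0 i)\<^sup>2) \<le> 6 * (2 ^ J * ln (real n))}"

lemma near_sets [measurable]: "near \<in> sets M"
proof -
  have [measurable]: "(\<lambda>\<omega>. \<Sum>i\<in>idx J0 J. (Y \<omega> i - \<beta>0 i)\<^sup>2) \<in> borel_measurable M"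
    using Y_measurable idx_subset_idx_inf[of J0 J]
    by (intro borel_measurable_sum borel_measurable_power borel_measurable_diff borel_measurable_const) auto
  show ?thesis unfolding near_def by measurable
qed

text \<open>
  The threshold \<open>6 * 2 ^ J * ln n\<close> is chosen so that the Chernoff bound, including its factor
  \<open>(sqrt 2) ^ (2 ^ J)\<close>, stays below \<open>r\<close>.
\<close>

lemma prob_near: "1 - r \<le> prob near"
proof -
  let ?G = "gauss (idx J0 J) \<beta>0 (1 / sqrt (real n))"
  let ?t = "6 * real (card (idx J0 J)) * ln (real n)"
  let ?B = "{x \<in> space ?G. ?t * (1 / sqrt (real n))\<^sup>2 \<le> (\<Sum>i\<in>idx J0 J. (x i - \<beta>0 i)\<^sup>2)}"
  have card: "card (idx J0 J) = 2 ^ J" using J0 J by (simp add: card_idx)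
  have B: "?B \<in> sets (sieve_space J0 J)"
    unfolding space_gauss_idx sieve_space_def by measurable
  have "prob (space M - near) \<le> prob {\<omega> \<in> space M. restrict (Y \<omega>) (idx J0 J) \<in> ?B}"
  proof (rule finite_measure_mono)
    show "{\<omega> \<in> space M. restrict (Y \<omega>) (idx J0 J) \<in> ?B} \<in> sets M"
      by (rule Y_event[OF B])
    show "space M - near \<subseteq> {\<omega> \<in> space M. restrict (Y \<omega>) (idx J0 J) \<in> ?B}"
    proof
      fix \<omega> assume \<omega>: "\<omega> \<in> space M - near"
      then have "6 * (2 ^ J * ln (real n)) \<le> real n * (\<Sum>i\<in>idx J0 J. (Y \<omega> i - \<beta>0 i)\<^sup>2)"
        unfolding near_def by auto
      then have "?t * (1 / sqrt (real n))\<^sup>2 \<le> (\<Sum>i\<in>idx J0 J. (Y \<omega> i - \<beta>0 i)\<^sup>2)"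
        using n_pos unfolding card by (simp add: power_divide pos_divide_le_eq mult_ac)
      moreover have "restrict (Y \<omega>) (idx J0 J) \<in> space (sieve_space J0 J)"
        unfolding sieve_space_def by (simp add: space_PiM)
      ultimately show "\<omega> \<in> {\<omega> \<in> space M. restrict (Y \<omega>) (idx J0 J) \<in> ?B}"
        using \<omega> by (simp add: space_gauss_idx)
    qed
  qed
  also have "\<dots> = measure ?G ?B" by (rule prob_Y[OF B])
  also have "\<dots> \<le> sqrt 2 ^ card (idx J0 J) * exp (- ?t / 4)"
    using n_pos by (intro gauss_square_tail) auto
  also have "\<dots> \<le> real n powr (- real (card (idx J0 J)))"
    by (rule sqrt2_power_exp_le[OF n(1)])
  finally show ?thesis
    using prob_compl[OF near_sets] unfolding r_def card by simp
qed

lemma gauss_box_eq: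
  "measure (gauss (idx J0 J) m (1 / sqrt (real n)))
     {\<beta> \<in> space (sieve_space J0 J). \<forall>i\<in>idx J0 J. \<bar>\<beta> i - m i\<bar> \<le> \<rho> * w (fst i)} = box_prob J0 J w n \<rho>"
  using gauss_box[of "idx J0 J" "1 / sqrt (real n)" m "\<lambda>i. \<rho> * w (fst i)"] n_pos
  unfolding space_gauss_idx box_prob_def by simp

lemma box_sets: "{\<beta> \<in> space (sieve_space J0 J). \<forall>i\<in>idx J0 J. \<bar>\<beta> i - m i\<bar> \<le> \<rho> * w (fst i)} \<in> sets (sieve_space J0 J)"
  unfolding sieve_space_def by measurable

text \<open>
  All coefficients of level at least \<open>J\<close> of both functions vanish; they only require a nonnegative
  radius, and the coordinates of the sieve require that already.
\<close>

lemma posterior_box: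
  "{\<beta> \<in> space (sieve_space J0 J). synth J0 \<psi> J \<beta> \<in> band J0 \<psi> w (coef \<psi> (synth J0 \<psi> J y)) \<rho>}
   = {\<beta> \<in> space (sieve_space J0 J). \<forall>i\<in>idx J0 J. \<bar>\<beta> i - y i\<bar> \<le> \<rho> * w (fst i)}"
proof (intro Collect_cong conj_cong refl)
  fix \<beta>
  have "(synth J0 \<psi> J \<beta> \<in> band J0 \<psi> w (coef \<psi> (synth J0 \<psi> J y)) \<rho>)
      \<longleftrightarrow> (\<forall>i\<in>idx_inf J0. \<bar>coef \<psi> (synth J0 \<psi> J \<beta>) i - coef \<psi> (synth J0 \<psi> J y) i\<bar> / w (fst i) \<le> \<rho>)"
    unfolding band_def weighted_sup_def using synth_L2[OF ob]
    by (auto simp: SUP_le_iff case_prod_beta)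
  also have "\<dots> \<longleftrightarrow> (\<forall>i\<in>idx J0 J. \<bar>\<beta> i - y i\<bar> \<le> \<rho> * w (fst i))"
  proof safe
    fix l k assume all: "\<forall>i\<in>idx_inf J0. \<bar>coef \<psi> (synth J0 \<psi> J \<beta>) i - coef \<psi> (synth J0 \<psi> J y) i\<bar> / w (fst i) \<le> \<rho>"
      and i: "(l, k) \<in> idx J0 J"
    have inf: "(l, k) \<in> idx_inf J0" using i idx_subset_idx_inf by blast
    have "\<bar>\<beta> (l, k) - y (l, k)\<bar> / w l \<le> \<rho>"
      using bspec[OF all inf] i inf by (simp add: coef_synth[OF ob])
    then show "\<bar>\<beta> (l, k) - y (l, k)\<bar> \<le> \<rho> * w (fst (l, k))"
      using idx_weight_pos[OF inf] by (simp add: pos_divide_le_eq)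
  next
    fix l k assume all: "\<forall>i\<in>idx J0 J. \<bar>\<beta> i - y i\<bar> \<le> \<rho> * w (fst i)" and i: "(l, k) \<in> idx_inf J0"
    show "\<bar>coef \<psi> (synth J0 \<psi> J \<beta>) (l, k) - coef \<psi> (synth J0 \<psi> J y) (l, k)\<bar> / w (fst (l, k)) \<le> \<rho>"
    proof (cases "(l, k) \<in> idx J0 J")
      case True
      then show ?thesis
        using bspec[OF all True] i idx_weight_pos[OF i] by (simp add: coef_synth[OF ob] pos_divide_le_eq)
    next
      case False
      have mem: "(J0 - 1, 0) \<in> idx J0 J" unfolding idx_def by simp
      then have "0 \<le> \<rho> * w (J0 - 1)" using bspec[OF all mem] abs_ge_zero order_trans by fastforce
      then have "0 \<le> \<rho>" using weights_pos[OF w J0, of "J0 - 1"] by (simp add: zero_le_mult_iff)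
      then show ?thesis using False i by (simp add: coef_synth[OF ob])
    qed
  qed
  finally show "(synth J0 \<psi> J \<beta> \<in> band J0 \<psi> w (coef \<psi> (synth J0 \<psi> J y)) \<rho>)
      = (\<forall>i\<in>idx J0 J. \<bar>\<beta> i - y i\<bar> \<le> \<rho> * w (fst i))" .
qed

text \<open>
  By definition of the radius, the band has posterior probability \<open>1 - \<alpha>\<close>; the Gaussian approximation
  replaces this probability by \<open>box_prob\<close>, which does not depend on the centre.
\<close>

lemma good_event:
  obtains A where "A \<in> sets M" "1 - r \<le> prob A"
    "\<And>\<omega>. \<omega> \<in> A \<Longrightarrow> \<bar>box_prob J0 J w n (R \<omega>) - (1 - \<alpha>)\<bar> \<le> \<Phi> + 2 * r"
proof -
  have "AE \<omega> in M. measure (posterior J0 J n \<pi> (Y \<omega>))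
      {\<beta> \<in> space (sieve_space J0 J). \<forall>i\<in>idx J0 J. \<bar>\<beta> i - Y \<omega> i\<bar> \<le> R \<omega> * w (fst i)} = 1 - \<alpha>"
    using radius unfolding credible_radius_def posterior_box Y_def by (rule conjunct2)
  then obtain N where N: "{\<omega> \<in> space M. measure (posterior J0 J n \<pi> (Y \<omega>))
      {\<beta> \<in> space (sieve_space J0 J). \<forall>i\<in>idx J0 J. \<bar>\<beta> i - Y \<omega> i\<bar> \<le> R \<omega> * w (fst i)} \<noteq> 1 - \<alpha>} \<subseteq> N"
      "N \<in> null_sets M"
    unfolding eventually_ae_filter by blast
  have N_sets: "N \<in> sets M" using N(2) by auto
  show ?thesis
  proof (rule that[of "near - N"])
    show "near - N \<in> sets M" using N_sets by auto
    have "prob (near - N) = prob near"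
      using measure_Diff_null_set[OF near_sets N(2)] .
    then show "1 - r \<le> prob (near - N)" using prob_near by simp
    fix \<omega> assume \<omega>: "\<omega> \<in> near - N"
    then have y: "real n * (\<Sum>i\<in>idx J0 J. (Y \<omega> i - \<beta>0 i)\<^sup>2) \<le> 6 * (2 ^ J * ln (real n))" and "\<omega> \<in> space M"
      unfolding near_def by auto
    then have cred: "measure (posterior J0 J n \<pi> (Y \<omega>))
      {\<beta> \<in> space (sieve_space J0 J). \<forall>i\<in>idx J0 J. \<bar>\<beta> i - Y \<omega> i\<bar> \<le> R \<omega> * w (fst i)} = 1 - \<alpha>"
      using N(1) \<omega> by blast
    have "\<bar>measure (posterior J0 J n \<pi> (Y \<omega>))
      {\<beta> \<in> space (sieve_space J0 J). \<forall>i\<in>idx J0 J. \<bar>\<beta> i - Y \<omega> i\<bar> \<le> R \<omega> * w (fst i)}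
      - measure (gauss (idx J0 J) (Y \<omega>) (1 / sqrt (real n)))
      {\<beta> \<in> space (sieve_space J0 J). \<forall>i\<in>idx J0 J. \<bar>\<beta> i - Y \<omega> i\<bar> \<le> R \<omega> * w (fst i)}\<bar> \<le> \<Phi> + 2 * r"
      unfolding \<Phi>_def r_def
      by (rule bernstein_von_mises[OF _ J n C1 prior \<beta>0_space mass[folded \<beta>0_def] small[folded \<beta>0_def] y box_sets])
         (use J0 in simp)
    then show "\<bar>box_prob J0 J w n (R \<omega>) - (1 - \<alpha>)\<bar> \<le> \<Phi> + 2 * r"
      unfolding cred gauss_box_eq by (simp add: abs_minus_commute)
  qed
qed

definition "hit = {\<omega> \<in> space M. \<forall>i\<in>idx J0 J. \<bar>coef \<psi> f0 i - Y \<omega> i\<bar> \<le> R \<omega> * w (fst i)}"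

lemma \<Phi>_nonneg: "0 \<le> \<Phi>"
proof -
  have "\<beta>0 \<in> sieve_ball J0 J n \<beta>0 ((C1 + 10) * sqrt (2 ^ J * ln (real n)))"
    unfolding sieve_ball_def using \<beta>0_space C1 n by (simp add: L2_set_def)
  from prior_modulus_flat(2)[OF prior this this] show ?thesis unfolding \<Phi>_def .
qed

lemma hit_coverage: "\<bar>prob hit - (1 - \<alpha>)\<bar> \<le> \<Phi> + 3 * r"
proof -
  define T where "T \<omega> = (MAX i\<in>idx J0 J. \<bar>Y \<omega> i - \<beta>0 i\<bar> / w (fst i))" for \<omega>
  have mem: "(J0 - 1, 0) \<in> idx J0 J" unfolding idx_def by simp
  then have ne: "idx J0 J \<noteq> {}" by blast
  have wpos: "0 < w (fst i)" if "i \<in> idx J0 J" for i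
    using that idx_subset_idx_inf[of J0 J] by (intro idx_weight_pos) auto
  have T_le: "T \<omega> \<le> \<rho> \<longleftrightarrow> (\<forall>i\<in>idx J0 J. \<bar>Y \<omega> i - \<beta>0 i\<bar> \<le> \<rho> * w (fst i))" for \<omega> \<rho>
    unfolding T_def using ne wpos by (subst Max_le_iff) (auto simp: pos_divide_le_eq)
  have T_set: "{\<omega> \<in> space M. T \<omega> \<le> \<rho>} = {\<omega> \<in> space M. restrict (Y \<omega>) (idx J0 J) \<in>
      {\<beta> \<in> space (sieve_space J0 J). \<forall>i\<in>idx J0 J. \<bar>\<beta> i - \<beta>0 i\<bar> \<le> \<rho> * w (fst i)}}" for \<rho>
    unfolding T_le sieve_space_def by (auto simp: space_PiM)
  have T_prob: "prob {\<omega> \<in> space M. T \<omega> \<le> \<rho>} = box_prob J0 J w n \<rho>" for \<rho>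
    unfolding T_set prob_Y[OF box_sets] gauss_box_eq ..
  have T_meas: "T \<in> borel_measurable M"
    unfolding borel_measurable_iff_le T_set
    by (intro allI Y_event box_sets)
  have hit: "hit = {\<omega> \<in> space M. T \<omega> \<le> R \<omega>}"
    unfolding hit_def T_le by (auto simp: \<beta>0_def abs_minus_commute)
  obtain A where A: "A \<in> sets M" "1 - r \<le> prob A"
    "\<And>\<omega>. \<omega> \<in> A \<Longrightarrow> \<bar>box_prob J0 J w n (R \<omega>) - (1 - \<alpha>)\<bar> \<le> \<Phi> + 2 * r"
    using good_event by blast
  have "\<bar>prob {\<omega> \<in> space M. T \<omega> \<le> R \<omega>} - (1 - \<alpha>)\<bar> \<le> (\<Phi> + 2 * r) + r"
    by (rule coverage_of_approximate_quantile[OF T_meas R_measurable A(1) T_prob mono_box_prob[OF J0 J n(1) w]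
          box_prob_surj[OF J0 J n(1) w] _ _ _ A(2,3)])
       (use \<alpha> \<Phi>_nonneg in \<open>auto simp: r_def\<close>)
  then show ?thesis unfolding hit by simp
qed

abbreviation "tail \<equiv> tail_event \<psi> w J f0 M Y R"

lemma tail_eq: "tail = {\<omega> \<in> space M. \<forall>l\<ge>J. \<forall>k<2 ^ l. \<bar>coef \<psi> f0 (l, k) - Y \<omega> (l, k)\<bar> \<le> R \<omega> * w l}"
proof -
  have "weighted_sup w {(l, k). J \<le> l \<and> k < 2 ^ l} (\<lambda>i. coef \<psi> f0 i - Y \<omega> i) \<le> ereal (R \<omega>) \<longleftrightarrow>
      (\<forall>l\<ge>J. \<forall>k<2 ^ l. \<bar>coef \<psi> f0 (l, k) - Y \<omega> (l, k)\<bar> \<le> R \<omega> * w l)" for \<omega>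
  proof -
    have "0 < w l" if "J \<le> l" for l using that J by (intro weights_pos[OF w J0]) auto
    then show ?thesis
      unfolding weighted_sup_def by (auto simp: SUP_le_iff pos_divide_le_eq)
  qed
  then show ?thesis unfolding tail_event_def by simp
qed

lemma sets_diff_le: "i \<in> idx_inf J0 \<Longrightarrow> {\<omega> \<in> space M. \<bar>coef \<psi> f0 i - Y \<omega> i\<bar> \<le> R \<omega> * w (fst i)} \<in> sets M"
proof -
  assume "i \<in> idx_inf J0"
  note [measurable] = Y_measurable[OF this]
  show ?thesis by measurable
qed

lemma tail_idx:
  assumes "J \<le> l" "k < 2 ^ l"
  shows "(l, k) \<in> idx_inf J0"
proof -
  have "J0 \<le> l" using assms J by simp
  then have "max l J0 = l" "J0 - 1 \<le> l" by simp_all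
  then show ?thesis using assms(2) by (simp add: idx_inf_iff)
qed

lemma tail_sets: "tail \<in> sets M"
proof -
  have "tail = {\<omega> \<in> space M. \<forall>i\<in>{(l, k). J \<le> l \<and> k < 2 ^ l}. \<bar>coef \<psi> f0 i - Y \<omega> i\<bar> \<le> R \<omega> * w (fst i)}"
    unfolding tail_eq by fastforce
  also have "\<dots> \<in> sets M"
    by (intro sets.sets_Collect_countable_All' sets_diff_le) (auto simp: tail_idx)
  finally show ?thesis .
qed

lemma hit_sets: "hit \<in> sets M"
  unfolding hit_def
proof (rule sets.sets_Collect_finite_All')
  show "{\<omega> \<in> space M. \<bar>coef \<psi> f0 i - Y \<omega> i\<bar> \<le> R \<omega> * w (fst i)} \<in> sets M" if "i \<in> idx J0 J" for i
    by (rule sets_diff_le[OF subsetD[OF idx_subset_idx_inf that]])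
  have "(J0 - 1, 0) \<in> idx J0 J" unfolding idx_def by simp
  then show "idx J0 J \<noteq> {}" by blast
qed simp

text \<open>
  The band constrains all levels: those below \<open>J\<close> form the event \<open>hit\<close>, the others the event \<open>tail\<close>.
\<close>

lemma band_event: "{\<omega> \<in> space M. f0 \<in> band J0 \<psi> w (Y \<omega>) (R \<omega>)} = hit \<inter> tail"
proof -
  have split: "idx_inf J0 = idx J0 J \<union> {(l, k). J \<le> l \<and> k < 2 ^ l}"
  proof (intro equalityI subsetI)
    fix i assume "i \<in> idx_inf J0"
    then show "i \<in> idx J0 J \<union> {(l, k). J \<le> l \<and> k < 2 ^ l}"
      unfolding idx_inf_def idx_def by auto
  next
    fix i assume "i \<in> idx J0 J \<union> {(l, k). J \<le> l \<and> k < 2 ^ l}"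
    then show "i \<in> idx_inf J0" using tail_idx idx_subset_idx_inf[of J0 J] by auto
  qed
  have "f0 \<in> band J0 \<psi> w (Y \<omega>) (R \<omega>) \<longleftrightarrow> (\<forall>i\<in>idx_inf J0. \<bar>coef \<psi> f0 i - Y \<omega> i\<bar> \<le> R \<omega> * w (fst i))" for \<omega>
  proof -
    have "f0 \<in> band J0 \<psi> w (Y \<omega>) (R \<omega>) \<longleftrightarrow> (\<forall>i\<in>idx_inf J0. \<bar>coef \<psi> f0 i - Y \<omega> i\<bar> / w (fst i) \<le> R \<omega>)"
      unfolding band_def weighted_sup_def using f0 by (auto simp: SUP_le_iff case_prod_beta)
    also have "\<dots> \<longleftrightarrow> (\<forall>i\<in>idx_inf J0. \<bar>coef \<psi> f0 i - Y \<omega> i\<bar> \<le> R \<omega> * w (fst i))"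
      by (intro ball_cong refl pos_divide_le_eq idx_weight_pos)
    finally show ?thesis .
  qed
  then have "f0 \<in> band J0 \<psi> w (Y \<omega>) (R \<omega>) \<longleftrightarrow> (\<forall>i\<in>idx J0 J. \<bar>coef \<psi> f0 i - Y \<omega> i\<bar> \<le> R \<omega> * w (fst i)) \<and>
      (\<forall>l\<ge>J. \<forall>k<2 ^ l. \<bar>coef \<psi> f0 (l, k) - Y \<omega> (l, k)\<bar> \<le> R \<omega> * w l)" for \<omega>
    unfolding split ball_Un by simp blast
  then show ?thesis
    unfolding tail_eq hit_def by auto
qed

lemma coverage:
  "\<bar>prob {\<omega> \<in> space M. f0 \<in> band J0 \<psi> w (Y \<omega>) (R \<omega>)} - (1 - \<alpha>)\<bar> \<le> \<Phi> + 3 * r + prob (space M - tail)"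
proof -
  have "prob (hit \<inter> tail) \<le> prob hit"
    by (intro finite_measure_mono hit_sets) auto
  moreover have "prob hit \<le> prob ((hit \<inter> tail) \<union> (space M - tail))"
    using hit_sets tail_sets sets.sets_into_space[OF hit_sets] by (intro finite_measure_mono) auto
  moreover have "\<dots> \<le> prob (hit \<inter> tail) + prob (space M - tail)"
    using hit_sets tail_sets by (intro measure_Un_le) auto
  ultimately show ?thesis
    using hit_coverage measure_nonneg[of M "space M - tail"] unfolding band_event by linarith
qed

text \<open>
  On the good event the radius has a \<open>box_prob\<close>-value strictly between \<open>(1 - \<alpha>) / 2\<close> and \<open>1 - \<alpha> / 2\<close>,
  so monotonicity compares it with explicit radii of value above and below this range.
\<close>

lemma radius_bounds:
  assumes \<delta>: "\<Phi> + (C1 + 10) * r < min (\<alpha> / 2) ((1 - \<alpha>) / 2)"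
    and R: "\<bar>box_prob J0 J w n (R \<omega>) - (1 - \<alpha>)\<bar> \<le> \<Phi> + 2 * r"
  shows "R \<omega> < 2 * sqrt (ln (32 / \<alpha>)) / sqrt (real n)"
    and "exp (- (2 / 9 * (3 / 2) ^ J)) < (1 - \<alpha>) / 2 \<Longrightarrow>
      sqrt (real J) / (2 * sqrt (real n) * w_bar J0 w J) < R \<omega>"
proof -
  note mono = monoD[OF mono_box_prob[OF J0 J n(1) w]]
  have "2 * r \<le> (C1 + 10) * r" using C1 by (intro mult_right_mono) (auto simp: r_def)
  then have R': "\<bar>box_prob J0 J w n (R \<omega>) - (1 - \<alpha>)\<bar> < min (\<alpha> / 2) ((1 - \<alpha>) / 2)"
    using R \<delta> by linarith
  then have R1: "\<bar>box_prob J0 J w n (R \<omega>) - (1 - \<alpha>)\<bar> < \<alpha> / 2" and R2: "\<bar>box_prob J0 J w n (R \<omega>) - (1 - \<alpha>)\<bar> < (1 - \<alpha>) / 2"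
    unfolding min_less_iff_conj min_def by (auto split: if_splits)
  show "R \<omega> < 2 * sqrt (ln (32 / \<alpha>)) / sqrt (real n)"
  proof (rule ccontr)
    assume "\<not> R \<omega> < 2 * sqrt (ln (32 / \<alpha>)) / sqrt (real n)"
    then have "box_prob J0 J w n (2 * sqrt (ln (32 / \<alpha>)) / sqrt (real n)) \<le> box_prob J0 J w n (R \<omega>)"
      by (intro mono) simp
    then show False using box_prob_large[OF J0 J n(1) w \<alpha>] R1[unfolded abs_less_iff] by linarith
  qed
  assume small: "exp (- (2 / 9 * (3 / 2) ^ J)) < (1 - \<alpha>) / 2"
  show "sqrt (real J) / (2 * sqrt (real n) * w_bar J0 w J) < R \<omega>"
  proof (rule ccontr)
    assume "\<not> sqrt (real J) / (2 * sqrt (real n) * w_bar J0 w J) < R \<omega>"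
    then have "box_prob J0 J w n (R \<omega>) \<le> box_prob J0 J w n (sqrt (real J) / (2 * sqrt (real n) * w_bar J0 w J))"
      by (intro mono) simp
    then have "box_prob J0 J w n (R \<omega>) < (1 - \<alpha>) / 2"
      using box_prob_small[OF J0 J n(1) w] small by linarith
    moreover have "(1 - \<alpha>) / 2 < box_prob J0 J w n (R \<omega>)"
      using R2 unfolding abs_less_iff by (simp add: field_simps)
    ultimately show False by simp
  qed
qed

lemma u_seq_le:
  assumes "J \<le> l"
  shows "real l * (u_seq w J)\<^sup>2 \<le> (w l)\<^sup>2"
proof -
  have pos: "0 < w m / sqrt (real m)" if "J \<le> m" for m
    using weights_pos[OF w J0, of m] that J J0 by simp
  have u0: "0 \<le> u_seq w J"
    unfolding u_seq_def using pos by (intro cINF_greatest) (auto intro: less_imp_le)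
  have "u_seq w J \<le> w l / sqrt (real l)"
    unfolding u_seq_def using pos assms by (intro cINF_lower bdd_belowI2[where m=0]) (auto intro: less_imp_le)
  then have "(u_seq w J)\<^sup>2 \<le> (w l / sqrt (real l))\<^sup>2" using u0 by (intro power_mono)
  also have "\<dots> = (w l)\<^sup>2 / real l" by (simp add: power_divide)
  finally show ?thesis using assms J J0 by (simp add: pos_le_divide_eq mult.commute)
qed

text \<open>
  Since \<open>w l \<ge> sqrt l * u_seq w J\<close>, each coordinate of level \<open>l\<close> exceeds the threshold with
  probability at most \<open>sqrt 2 * exp (- l * weight_ratio J0 w J / 16)\<close>. Half of the exponent pays for the \<open>2 ^ l\<close>
  coordinates once the ratio is at least \<open>32 * ln 2\<close>.
\<close>

lemma prob_high_level:
  assumes l: "J \<le> l" and ratio: "32 * ln 2 \<le> weight_ratio J0 w J"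
  shows "prob (\<Union>k<2 ^ l. {\<omega> \<in> space M. w l * sqrt (real J) / (2 * w_bar J0 w J) < \<bar>W (\<psi> l k) \<omega>\<bar>})
      \<le> sqrt 2 * exp (- (weight_ratio J0 w J / 32)) ^ l"
proof -
  let ?t = "w l * sqrt (real J) / (2 * w_bar J0 w J)"
  let ?\<rho> = "weight_ratio J0 w J"
  have wb: "0 < w_bar J0 w J" by (rule w_bar_pos[OF J0 J n(1) w])
  have "0 < w l" using l J by (intro weights_pos[OF w J0]) auto
  then have t0: "0 \<le> ?t" using wb by simp
  have inf: "(l, k) \<in> idx_inf J0" if "k < 2 ^ l" for k by (rule tail_idx[OF l that])
  have "prob (\<Union>k<2 ^ l. {\<omega> \<in> space M. ?t < \<bar>W (\<psi> l k) \<omega>\<bar>})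
      \<le> (\<Sum>k<(2::nat) ^ l. prob {\<omega> \<in> space M. ?t < \<bar>W (\<psi> l k) \<omega>\<bar>})"
  proof (rule finite_measure_subadditive_finite)
    have "{\<omega> \<in> space M. ?t < \<bar>W (\<psi> l k) \<omega>\<bar>} \<in> sets M" if "k < 2 ^ l" for k
    proof -
      have [measurable]: "W (\<psi> l k) \<in> borel_measurable M"
        by (intro white_noise_measurable[OF wn] \<psi>_L2 inf that)
      show ?thesis by measurable
    qed
    then show "(\<lambda>k. {\<omega> \<in> space M. ?t < \<bar>W (\<psi> l k) \<omega>\<bar>}) ` {..<2 ^ l} \<subseteq> sets M" by auto
  qed simp
  also have "\<dots> = (\<Sum>k<(2::nat) ^ l. 1 - normal_prob ?t)"
  proof (intro sum.cong refl white_noise_tail[OF wn])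
    fix k assume "k \<in> {..<(2::nat) ^ l}"
    then have k: "(l, k) \<in> idx_inf J0" using inf by simp
    show "\<psi> l k \<in> L2_unit" by (rule \<psi>_L2[OF k])
    show "inner_unit (\<psi> l k) (\<psi> l k) = 1" using orthonormal_basisD(2)[OF ob k k] by simp
  qed
  also have "\<dots> = 2 ^ l * (1 - normal_prob ?t)" by simp
  also have "\<dots> \<le> 2 ^ l * (sqrt 2 * exp (- ?t\<^sup>2 / 4))"
    by (intro mult_left_mono normal_prob_tail_upper t0) simp
  also have "\<dots> \<le> 2 ^ l * (sqrt 2 * exp (- (real l * (?\<rho> / 16))))"
  proof -
    have "real l * (?\<rho> / 16) = real J / (w_bar J0 w J)\<^sup>2 / 16 * (real l * (u_seq w J)\<^sup>2)"
      by (simp add: weight_ratio_def)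
    also have "\<dots> \<le> real J / (w_bar J0 w J)\<^sup>2 / 16 * (w l)\<^sup>2"
      by (intro mult_left_mono u_seq_le l) simp
    also have "\<dots> = ?t\<^sup>2 / 4" by (simp add: power_divide power_mult_distrib mult_ac)
    finally show ?thesis by simp
  qed
  also have "\<dots> = sqrt 2 * (2 * exp (- (?\<rho> / 16))) ^ l"
    by (simp add: power_mult_distrib flip: exp_of_nat_mult)
  also have "\<dots> \<le> sqrt 2 * exp (- (?\<rho> / 32)) ^ l"
  proof -
    have "2 = exp (ln (2::real))" by simp
    also have "\<dots> \<le> exp (?\<rho> / 32)" using ratio by (subst exp_le_cancel_iff) simp
    finally have "2 * exp (- (?\<rho> / 16)) \<le> exp (?\<rho> / 32) * exp (- (?\<rho> / 16))" by (intro mult_right_mono) auto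
    also have "\<dots> = exp (- (?\<rho> / 32))" by (simp flip: exp_add)
    finally show ?thesis by (intro mult_left_mono power_mono) auto
  qed
  finally show ?thesis .
qed

text \<open>
  The radius is at least \<open>sqrt J / (2 * sqrt n * w_bar J0 w J)\<close> with high probability, so noise of level
  \<open>l \<ge> J\<close> that leaves the band must exceed the threshold of \<open>prob_high_level\<close>. The bounds for the levels
  form a geometric series.
\<close>

lemma tail_prob_le:
  assumes \<delta>: "\<Phi> + (C1 + 10) * r < min (\<alpha> / 2) ((1 - \<alpha>) / 2)"
    and small: "exp (- (2 / 9 * (3 / 2) ^ J)) < (1 - \<alpha>) / 2"
    and ratio: "32 * ln 2 \<le> weight_ratio J0 w J"
  shows "prob (space M - tail) \<le> 3 * exp (- (real J * weight_ratio J0 w J / 32)) + r"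
proof -
  let ?q = "exp (- (weight_ratio J0 w J / 32))"
  define D where "D m = (\<Union>k<2 ^ (J + m). {\<omega> \<in> space M.
      w (J + m) * sqrt (real J) / (2 * w_bar J0 w J) < \<bar>W (\<psi> (J + m) k) \<omega>\<bar>})" for m
  have D_sets: "D m \<in> sets M" for m
  proof -
    have "{\<omega> \<in> space M. t < \<bar>W (\<psi> (J + m) k) \<omega>\<bar>} \<in> sets M" if "k < 2 ^ (J + m)" for k t
    proof -
      have [measurable]: "W (\<psi> (J + m) k) \<in> borel_measurable M"
        by (intro white_noise_measurable[OF wn] \<psi>_L2 tail_idx that) simp
      show ?thesis by measurable
    qed
    then show ?thesis unfolding D_def by (intro sets.finite_UN) auto
  qed
  have D_prob: "prob (D m) \<le> sqrt 2 * ?q ^ (J + m)" for m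
    unfolding D_def by (intro prob_high_level ratio) simp
  have q: "0 < ?q" "?q \<le> 1 / 2"
  proof -
    have "?q \<le> exp (- ln 2)" using ratio by (subst exp_le_cancel_iff) simp
    also have "\<dots> = 1 / (2::real)" by (simp add: exp_minus)
    finally show "?q \<le> 1 / 2" .
  qed simp
  have ratio0: "0 \<le> weight_ratio J0 w J" by (rule order_trans[OF _ ratio]) simp
  have geo: "(\<lambda>m. sqrt 2 * ?q ^ (J + m)) sums (sqrt 2 * ?q ^ J * (1 / (1 - ?q)))"
  proof -
    have "norm ?q < 1" using q by (simp only: real_norm_def abs_of_pos)
    from sums_mult[OF geometric_sums[OF this], of "sqrt 2 * ?q ^ J"] show ?thesis
      unfolding power_add mult.assoc .
  qed
  have summable_D: "summable (\<lambda>m. prob (D m))"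
    using D_prob by (intro summable_comparison_test'[OF sums_summable[OF geo], of 0]) simp
  have "prob (\<Union>m. D m) \<le> (\<Sum>m. prob (D m))"
    using D_sets summable_D by (intro finite_measure_subadditive_countably) auto
  also have "\<dots> \<le> sqrt 2 * ?q ^ J * (1 / (1 - ?q))"
    using suminf_le[OF D_prob summable_D sums_summable[OF geo]] geo by (simp add: sums_iff)
  also have "\<dots> \<le> 3 / 2 * ?q ^ J * 2"
  proof (intro mult_mono)
    show "sqrt 2 \<le> 3 / 2" by (rule real_le_lsqrt) (simp_all add: power2_eq_square)
    have "1 / (1 - x) \<le> 2" if "x \<le> 1 / 2" for x :: real
      using that by (simp add: field_simps)
    then show "1 / (1 - ?q) \<le> 2" using q(2) .
  qed (use q ratio0 in auto)
  also have "\<dots> = 3 * exp (- (real J * weight_ratio J0 w J / 32))"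
    by (simp flip: exp_of_nat_mult)
  finally have D_all: "prob (\<Union>m. D m) \<le> 3 * exp (- (real J * weight_ratio J0 w J / 32))" .
  obtain A where A: "A \<in> sets M" "1 - r \<le> prob A"
    "\<And>\<omega>. \<omega> \<in> A \<Longrightarrow> \<bar>box_prob J0 J w n (R \<omega>) - (1 - \<alpha>)\<bar> \<le> \<Phi> + 2 * r"
    using good_event by blast
  have "space M - tail \<subseteq> (\<Union>m. D m) \<union> (space M - A)"
  proof
    fix \<omega> assume \<omega>: "\<omega> \<in> space M - tail"
    show "\<omega> \<in> (\<Union>m. D m) \<union> (space M - A)"
    proof (cases "\<omega> \<in> A")
      case True
      have R: "sqrt (real J) / (2 * sqrt (real n) * w_bar J0 w J) < R \<omega>"
        by (rule radius_bounds(2)[OF \<delta> A(3)[OF True] small])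
      obtain l k where lk: "J \<le> l" "k < 2 ^ l" "R \<omega> * w l < \<bar>coef \<psi> f0 (l, k) - Y \<omega> (l, k)\<bar>"
        using \<omega> unfolding tail_eq by (auto simp: not_le)
      have wl: "0 < w l" using lk(1) J by (intro weights_pos[OF w J0]) auto
      have "w l * sqrt (real J) / (2 * w_bar J0 w J)
          = sqrt (real n) * (sqrt (real J) / (2 * sqrt (real n) * w_bar J0 w J) * w l)"
      proof -
        have "a * b / (2 * c) = d * (b / (2 * d * c) * a)" if "d \<noteq> 0" for a b c d :: real
          using that by simp
        from this[of "sqrt (real n)"] show ?thesis using n_pos by simp
      qed
      also have "\<dots> < sqrt (real n) * (R \<omega> * w l)"
        using R wl n_pos by (intro mult_strict_left_mono mult_strict_right_mono)
      also have "\<dots> < sqrt (real n) * \<bar>coef \<psi> f0 (l, k) - Y \<omega> (l, k)\<bar>"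
        using lk(3) n_pos by (intro mult_strict_left_mono)
      also have "\<dots> = \<bar>W (\<psi> l k) \<omega>\<bar>"
        using n_pos unfolding Y_eq by (simp add: abs_divide)
      finally have "\<omega> \<in> D (l - J)" using lk \<omega> unfolding D_def by auto
      then show ?thesis by blast
    qed (use \<omega> in auto)
  qed
  then have "prob (space M - tail) \<le> prob ((\<Union>m. D m) \<union> (space M - A))"
    using D_sets A(1) by (intro finite_measure_mono) auto
  also have "\<dots> \<le> prob (\<Union>m. D m) + prob (space M - A)"
    using D_sets A(1) by (intro measure_Un_le) auto
  also have "prob (space M - A) \<le> r" using A(2) prob_compl[OF A(1)] by simp
  finally show ?thesis using D_all by simp
qed

end

section \<open>The diameter of the band\<close>

lemma band_coef_diff:
  assumes "f \<in> band J0 \<psi> w c \<rho>" "g \<in> band J0 \<psi> w c \<rho>" "(l, k) \<in> idx_inf J0" "0 < w l"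
  shows "\<bar>coef \<psi> f (l, k) - coef \<psi> g (l, k)\<bar> \<le> 2 * \<rho> * w l"
proof -
  have "\<bar>coef \<psi> h (l, k) - c (l, k)\<bar> \<le> \<rho> * w l" if "h \<in> band J0 \<psi> w c \<rho>" for h
  proof -
    have "weighted_sup w (idx_inf J0) (\<lambda>i. coef \<psi> h i - c i) \<le> ereal \<rho>"
      using that unfolding band_def by simp
    then have "\<forall>i\<in>idx_inf J0. (case i of (l, k) \<Rightarrow> ereal (\<bar>coef \<psi> h (l, k) - c (l, k)\<bar> / w l)) \<le> ereal \<rho>"
      unfolding weighted_sup_def SUP_le_iff .
    from bspec[OF this assms(3)] show ?thesis using assms(4) by (simp add: pos_divide_le_eq)
  qed
  from this[OF assms(1)] this[OF assms(2)] show ?thesis by linarith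
qed

lemma besov_coef:
  assumes "besov_norm J0 \<psi> s f \<le> ereal B" "J0 \<le> l" "k < 2 ^ l"
  shows "\<bar>coef \<psi> f (l, k)\<bar> \<le> B * 2 powr (- (real l * (s + 1 / 2)))"
proof -
  let ?m = "MAX k\<in>{..<(2::nat) ^ J0}. \<bar>coef \<psi> f (J0 - 1, k)\<bar>"
  let ?S = "SUP (l, k) \<in> {(l, k). J0 \<le> l \<and> k < 2 ^ l}. ereal (2 powr (real l * (s + 1 / 2)) * \<bar>coef \<psi> f (l, k)\<bar>)"
  have "\<bar>coef \<psi> f (J0 - 1, 0)\<bar> \<le> ?m" by (intro Max_ge finite_imageI finite_lessThan imageI) simp
  from order_trans[OF abs_ge_zero this] have "0 \<le> ereal ?m" by simp
  from add_increasing[OF this order_refl] have "?S \<le> ereal ?m + ?S" .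
  also have "\<dots> \<le> ereal B" using assms(1) unfolding besov_norm_def .
  finally have S: "?S \<le> ereal B" .
  have "ereal (2 powr (real l * (s + 1 / 2)) * \<bar>coef \<psi> f (l, k)\<bar>) \<le> ?S"
    using assms(2,3) by (intro SUP_upper2[of "(l, k)"]) auto
  then have "2 powr (real l * (s + 1 / 2)) * \<bar>coef \<psi> f (l, k)\<bar> \<le> B"
    by (rule order_trans[OF _ S, THEN ereal_less_eq(3)[THEN iffD1]])
  then show ?thesis by (simp add: powr_minus field_simps)
qed

lemma sum_sqrt2_power_le: "(\<Sum>l<J. 2 powr (real l / 2)) \<le> 3 * 2 powr (real J / 2)"
proof (induction J)
  case (Suc J)
  have "sqrt 2 \<ge> 4 / (3::real)" by (rule real_le_rsqrt) (simp add: power2_eq_square)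
  then have "4 * 2 powr (real J / 2) \<le> 3 * (sqrt 2 * 2 powr (real J / 2))" by simp
  also have "sqrt 2 * 2 powr (real J / 2) = 2 powr (real (Suc J) / 2)"
    by (simp add: add_divide_distrib powr_add powr_half_sqrt)
  finally show ?case using Suc by simp
qed simp

lemma v_seq_nonneg:
  assumes "2 \<le> J0" "J0 \<le> J" "weights J0 w"
  shows "0 \<le> v_seq J0 w J"
proof -
  have "0 \<le> w (J0 - 1) / sqrt (real (J0 - 1))"
    using weights_pos[OF assms(3,1), of "J0 - 1"] by (intro divide_nonneg_nonneg) auto
  also have "\<dots> \<le> v_seq J0 w J"
    unfolding v_seq_def using assms(2)
    by (intro Max_ge finite_imageI imageI[of "J0 - 1" _ "\<lambda>l. w l / sqrt (real l)"]) auto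
  finally show ?thesis .
qed

text \<open>
  Levels below \<open>J\<close> are controlled by the band: coefficients differ by at most \<open>2 * \<rho> * w l\<close>, and
  \<open>w l \<le> v_seq J0 w J * sqrt J\<close>, so the level bounds grow geometrically like \<open>2 powr (l / 2)\<close>. Higher
  levels are controlled by the Besov norm, with level bounds that decay geometrically like \<open>2 powr (- l * s)\<close>.
\<close>

lemma Linf_norm_band_diff:
  assumes J0: "2 \<le> J0" and J: "J0 \<le> J" and n: "2 \<le> n"
    and ob: "orthonormal_basis_unit J0 \<psi>" and w: "weights J0 w"
    and C: "0 < C" "\<And>l x. J0 - 1 \<le> l \<Longrightarrow> x \<in> {0..1} \<Longrightarrow> (\<Sum>k<2 ^ max l J0. \<bar>\<psi> l k x\<bar>) \<le> C * 2 powr (real l / 2)"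
    and s: "0 < s" and B: "0 \<le> B"
    and f: "f \<in> band J0 \<psi> w c \<rho>" "besov_norm J0 \<psi> s f \<le> ereal B"
    and g: "g \<in> band J0 \<psi> w c \<rho>" "besov_norm J0 \<psi> s g \<le> ereal B"
    and \<rho>: "\<rho> \<le> K / sqrt (real n)" and K: "0 \<le> K"
  shows "Linf_norm (\<lambda>x. f x - g x)
    \<le> ereal (C * (6 * K * (v_seq J0 w J * sqrt (2 ^ J * real J / real n)) + 2 * B * 2 powr (- real J * s) / (1 - 2 powr (- s))))"
proof -
  \<comment> \<open>Levels below \<open>J0 - 1\<close> do not occur; there the weights need not be positive.\<close>
  define b where "b l = (if l < J0 - 1 then 0 else if l < J then 2 * (K / sqrt (real n)) * w l
      else 2 * B * 2 powr (- (real l * (s + 1 / 2))))" for l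
  define t where "t l = (if J0 - 1 \<le> l then 2 powr (real l / 2) * b l else 0)" for l
  let ?q = "2 powr (- s)"
  let ?v = "v_seq J0 w J"
  have q: "0 < ?q" "?q < 1" using s by (auto simp: powr_less_one)
  have wpos: "0 < w l" if "J0 - 1 \<le> l" for l by (rule weights_pos[OF w J0 that])
  have b0: "0 \<le> b l" for l
    unfolding b_def using wpos[of l] K B by auto
  have fL2: "f \<in> L2_unit" and gL2: "g \<in> L2_unit" using f(1) g(1) unfolding band_def by auto
  have coef_b: "\<bar>coef \<psi> (\<lambda>x. f x - g x) (l, k)\<bar> \<le> b l" if lk: "(l, k) \<in> idx_inf J0" for l k
  proof -
    have l: "J0 - 1 \<le> l" "k < 2 ^ max l J0" using lk by (auto simp: idx_inf_iff)
    have "coef \<psi> (\<lambda>x. f x - g x) (l, k) = coef \<psi> f (l, k) - coef \<psi> g (l, k)"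
      using orthonormal_basisD(1)[OF ob lk] fL2 gL2 by (intro coef_diff) auto
    moreover have "\<bar>coef \<psi> f (l, k) - coef \<psi> g (l, k)\<bar> \<le> b l"
    proof (cases "l < J")
      case True
      have "\<bar>coef \<psi> f (l, k) - coef \<psi> g (l, k)\<bar> \<le> 2 * \<rho> * w l"
        by (rule band_coef_diff[OF f(1) g(1) lk wpos[OF l(1)]])
      also have "\<dots> \<le> 2 * (K / sqrt (real n)) * w l"
        using \<rho> wpos[OF l(1)] by (intro mult_right_mono mult_left_mono) auto
      finally show ?thesis using True l(1) by (simp add: b_def)
    next
      case False
      then have "J0 \<le> l" using J by simp
      moreover from this have "k < 2 ^ l" using l(2) by (simp add: max_absorb1)
      ultimately show ?thesis
        using besov_coef[OF f(2), of l k] besov_coef[OF g(2), of l k] False l(1) by (simp add: b_def)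
    qed
    ultimately show ?thesis by simp
  qed
  have "(\<lambda>m. t (m + J)) sums (2 * B * 2 powr (- real J * s) * (1 / (1 - ?q)))"
  proof -
    have "t (m + J) = 2 * B * 2 powr (- real J * s) * ?q ^ m" for m
    proof -
      have "t (m + J) = 2 * B * (2 powr (real (m + J) / 2) * 2 powr (- (real (m + J) * (s + 1 / 2))))"
        using J by (simp add: t_def b_def)
      also have "\<dots> = 2 * B * 2 powr (- real J * s + - s * real m)"
        unfolding powr_add[symmetric] by (simp add: algebra_simps add_divide_distrib)
      also have "\<dots> = 2 * B * (2 powr (- real J * s) * 2 powr (- s * real m))"
        unfolding powr_add ..
      also have "2 powr (- s * real m) = ?q ^ m"
        by (simp add: powr_realpow[symmetric] powr_powr)
      finally show ?thesis by simp
    qed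
    then show ?thesis
      using sums_mult[OF geometric_sums[of ?q], of "2 * B * 2 powr (- real J * s)"] q by simp
  qed
  then have "t sums (2 * B * 2 powr (- real J * s) * (1 / (1 - ?q)) + (\<Sum>l<J. t l))"
    unfolding sums_iff_shift[of t J] by simp
  moreover define total where "total = 2 * B * 2 powr (- real J * s) * (1 / (1 - ?q)) + (\<Sum>l<J. t l)"
  ultimately have sums: "t sums total" by simp
  have v_ge: "w l / sqrt (real l) \<le> ?v" if "J0 - 1 \<le> l" "l < J" for l
    unfolding v_seq_def using that by (intro Max_ge) auto
  have v0: "0 \<le> ?v" by (rule v_seq_nonneg[OF J0 J w])
  have low: "(\<Sum>l<J. t l) \<le> 6 * K * (?v * sqrt (2 ^ J * real J / real n))"
  proof -
    have "t l \<le> 2 * K / sqrt (real n) * ?v * sqrt (real J) * 2 powr (real l / 2)" if l: "l < J" for l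
    proof (cases "J0 - 1 \<le> l")
      case True
      then have l0: "0 < sqrt (real l)" using J0 by simp
      have "w l \<le> ?v * sqrt (real l)" using v_ge[OF True l] l0 by (simp add: pos_divide_le_eq)
      also have "\<dots> \<le> ?v * sqrt (real J)" using l v0 by (intro mult_left_mono) auto
      finally have "w l \<le> ?v * sqrt (real J)" .
      then have "2 * K / sqrt (real n) * w l \<le> 2 * K / sqrt (real n) * (?v * sqrt (real J))"
        by (rule mult_left_mono) (use K in simp)
      then have "2 powr (real l / 2) * (2 * K / sqrt (real n) * w l)
          \<le> 2 powr (real l / 2) * (2 * K / sqrt (real n) * (?v * sqrt (real J)))"
        by (rule mult_left_mono) simp
      then show ?thesis using True l by (simp add: t_def b_def mult_ac)
    next
      case False
      then show ?thesis using K v0 by (simp add: t_def)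
    qed
    then have "(\<Sum>l<J. t l) \<le> (\<Sum>l<J. 2 * K / sqrt (real n) * ?v * sqrt (real J) * 2 powr (real l / 2))"
      by (intro sum_mono) simp
    also have "\<dots> = 2 * K / sqrt (real n) * ?v * sqrt (real J) * (\<Sum>l<J. 2 powr (real l / 2))"
      by (simp add: sum_distrib_left)
    also have "\<dots> \<le> 2 * K / sqrt (real n) * ?v * sqrt (real J) * (3 * 2 powr (real J / 2))"
      using K v0 by (intro mult_left_mono sum_sqrt2_power_le) auto
    also have "2 powr (real J / 2) = sqrt (2 ^ J)"
      by (simp add: powr_half_sqrt_powr powr_realpow)
    also have "2 * K / sqrt (real n) * ?v * sqrt (real J) * (3 * sqrt (2 ^ J)) = 6 * K * (?v * sqrt (2 ^ J * real J / real n))"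
      by (simp add: real_sqrt_mult real_sqrt_divide)
    finally show ?thesis .
  qed
  have "Linf_norm (\<lambda>x. f x - g x) \<le> ereal (C * total)"
    by (rule Linf_norm_le_of_coef[OF ob C(2) L2_unit_diff[OF fL2 gL2] coef_b b0 sums[unfolded t_def[abs_def]]])
  also have "\<dots> \<le> ereal (C * (6 * K * (?v * sqrt (2 ^ J * real J / real n)) + 2 * B * 2 powr (- real J * s) / (1 - ?q)))"
    using low C(1) unfolding total_def by (auto intro!: mult_left_mono)
  finally show ?thesis .
qed

context sieve_model
begin

lemma r_nonneg: "0 \<le> r" by (simp add: r_def)

lemma slack: "3 * r \<le> (C1 + 10) * r"
  using C1 by (intro mult_right_mono) (auto simp: r_def)

lemma diameter:
  assumes \<delta>: "\<Phi> + (C1 + 10) * r < min (\<alpha> / 2) ((1 - \<alpha>) / 2)"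
    and C: "0 < C" "\<And>l x. J0 - 1 \<le> l \<Longrightarrow> x \<in> {0..1} \<Longrightarrow> (\<Sum>k<2 ^ max l J0. \<bar>\<psi> l k x\<bar>) \<le> C * 2 powr (real l / 2)"
    and s: "0 < s" and B: "0 < B"
  shows "\<exists>A\<in>sets M. 1 - (C1 + 10) * r \<le> prob A \<and> (\<forall>\<omega>\<in>A.
      (SUP (f, g) \<in> (band J0 \<psi> w (Y \<omega>) (R \<omega>) \<inter> {f. besov_norm J0 \<psi> s f \<le> ereal B}) \<times>
                     (band J0 \<psi> w (Y \<omega>) (R \<omega>) \<inter> {f. besov_norm J0 \<psi> s f \<le> ereal B}).
         Linf_norm (\<lambda>x. f x - g x))
      \<le> ereal ((3 + C * (6 * (2 * sqrt (ln (32 / \<alpha>))) + 2 / (1 - 2 powr (- s))))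
          * (v_seq J0 w J * sqrt (2 ^ J * real J / real n) + 2 powr (- real J * s) * B)))"
proof -
  obtain A where A: "A \<in> sets M" "1 - r \<le> prob A"
    "\<And>\<omega>. \<omega> \<in> A \<Longrightarrow> \<bar>box_prob J0 J w n (R \<omega>) - (1 - \<alpha>)\<bar> \<le> \<Phi> + 2 * r"
    using good_event by blast
  define K where "K = 2 * sqrt (ln (32 / \<alpha>))"
  define q where "q = 1 - 2 powr (- s)"
  define V where "V = v_seq J0 w J * sqrt (2 ^ J * real J / real n)"
  define P where "P = 2 powr (- real J * s)"
  have K: "0 \<le> K" using \<alpha> unfolding K_def by simp
  have q: "0 < q" using s unfolding q_def by (simp add: powr_less_one)
  have V: "0 \<le> V" using v_seq_nonneg[OF J0 J w] unfolding V_def by simp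
  have P: "0 \<le> P" unfolding P_def by simp
  have const: "C * (6 * K * V + 2 * B * P / q) \<le> (3 + C * (6 * K + 2 / q)) * (V + P * B)"
  proof -
    have "(3 + C * (6 * K + 2 / q)) * (V + P * B) - C * (6 * K * V + 2 * B * P / q)
        = 3 * (V + P * B) + C * (2 / q) * V + C * (6 * K) * (P * B)"
      by (simp add: algebra_simps add_divide_distrib)
    also have "0 \<le> \<dots>"
      using K q V P B C(1) by (intro add_nonneg_nonneg mult_nonneg_nonneg) auto
    finally show ?thesis by (simp only: diff_ge_0_iff_ge)
  qed
  have "1 - (C1 + 10) * r \<le> prob A"
    using A(2) slack r_nonneg by linarith
  moreover have "(SUP (f, g) \<in> (band J0 \<psi> w (Y \<omega>) (R \<omega>) \<inter> {f. besov_norm J0 \<psi> s f \<le> ereal B}) \<times>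
                     (band J0 \<psi> w (Y \<omega>) (R \<omega>) \<inter> {f. besov_norm J0 \<psi> s f \<le> ereal B}).
         Linf_norm (\<lambda>x. f x - g x)) \<le> ereal ((3 + C * (6 * K + 2 / q)) * (V + P * B))" if \<omega>: "\<omega> \<in> A" for \<omega>
  proof (rule SUP_least, clarsimp)
    fix f g
    assume f: "f \<in> band J0 \<psi> w (Y \<omega>) (R \<omega>)" "besov_norm J0 \<psi> s f \<le> ereal B"
      and g: "g \<in> band J0 \<psi> w (Y \<omega>) (R \<omega>)" "besov_norm J0 \<psi> s g \<le> ereal B"
    have "R \<omega> \<le> K / sqrt (real n)"
      using radius_bounds(1)[OF \<delta> A(3)[OF \<omega>]] unfolding K_def by simp
    from Linf_norm_band_diff[OF J0 J n(1) ob w C s less_imp_le[OF B] f g this K]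
    have "Linf_norm (\<lambda>x. f x - g x) \<le> ereal (C * (6 * K * V + 2 * B * P / q))"
      unfolding V_def P_def q_def .
    also have "\<dots> \<le> ereal ((3 + C * (6 * K + 2 / q)) * (V + P * B))" using const by simp
    finally show "Linf_norm (\<lambda>x. f x - g x) \<le> ereal ((3 + C * (6 * K + 2 / q)) * (V + P * B))" .
  qed
  ultimately show ?thesis
    using A(1) unfolding K_def q_def V_def P_def by blast
qed

end

section \<open>Coverage and diameter of the credible band\<close>

lemma eventually_level_large:
  fixes \<alpha> :: real
  assumes "0 < \<alpha>" "\<alpha> < 1" "weights J0 w"
  shows "\<exists>N. \<forall>J\<ge>N. exp (- (2 / 9 * (3 / 2) ^ J)) < (1 - \<alpha>) / 2 \<and> 32 * ln 2 \<le> weight_ratio J0 w J"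
proof -
  have "filterlim (\<lambda>J. (3 / 2 :: real) ^ J) at_top sequentially"
  proof (rule filterlim_at_top_mono)
    show "filterlim (\<lambda>J. 1 / 2 * real J) at_top sequentially"
      by (rule filterlim_tendsto_pos_mult_at_top[OF tendsto_const _ filterlim_real_sequentially]) simp
    show "eventually (\<lambda>J. 1 / 2 * real J \<le> (3 / 2 :: real) ^ J) sequentially"
    proof (intro always_eventually allI)
      fix J
      show "1 / 2 * real J \<le> (3 / 2 :: real) ^ J"
        using Bernoulli_inequality[of "1 / 2 :: real" J] by simp
    qed
  qed
  then have "filterlim (\<lambda>J. 2 / 9 * (3 / 2 :: real) ^ J) at_top sequentially"
    by (intro filterlim_tendsto_pos_mult_at_top[OF tendsto_const]) auto
  then have "filterlim (\<lambda>J. - (2 / 9 * (3 / 2 :: real) ^ J)) at_bot sequentially"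
    by (simp add: filterlim_uminus_at_bot)
  then have "((\<lambda>J. exp (- (2 / 9 * (3 / 2 :: real) ^ J))) \<longlongrightarrow> 0) sequentially"
    by (rule filterlim_compose[OF exp_at_bot])
  then have "eventually (\<lambda>J. exp (- (2 / 9 * (3 / 2) ^ J)) < (1 - \<alpha>) / 2) sequentially"
    using assms by (intro order_tendstoD(2)) auto
  moreover have "eventually (\<lambda>J. 32 * ln 2 \<le> weight_ratio J0 w J) sequentially"
    using weight_ratio_tendsto[OF assms(3)] unfolding filterlim_at_top by blast
  ultimately have "eventually (\<lambda>J. exp (- (2 / 9 * (3 / 2) ^ J)) < (1 - \<alpha>) / 2 \<and> 32 * ln 2 \<le> weight_ratio J0 w J) sequentially"
    by (rule eventually_conj)
  then show ?thesis unfolding eventually_sequentially .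
qed

theorem proposition3p1:
  shows "\<exists>c1 c2 :: real \<Rightarrow> real. (\<forall>C1>0. 0 < c1 C1 \<and> 0 < c2 C1) \<and>
    (\<forall>(s::real) (S::nat) (J0::nat) (\<psi> :: nat \<Rightarrow> nat \<Rightarrow> real \<Rightarrow> real).
      0 < s \<and> s < real S \<and> cdv_basis S J0 \<psi> \<longrightarrow>
      (\<exists>(c3 :: real \<Rightarrow> real) (c4 :: real \<Rightarrow> real) (Jmin :: real \<Rightarrow> (nat \<Rightarrow> real) \<Rightarrow> nat).
        (\<forall>\<alpha>. 0 < \<alpha> \<and> \<alpha> < 1 \<longrightarrow> 0 < c3 \<alpha> \<and> 0 < c4 \<alpha>) \<and>
        (\<forall>(\<alpha>::real) (C1::real) (n::nat) (J::nat) (f0 :: real \<Rightarrow> real) (w :: nat \<Rightarrow> real)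
            (\<pi> :: (nat \<times> nat \<Rightarrow> real) \<Rightarrow> real)
            (M :: 'a measure) (W :: (real \<Rightarrow> real) \<Rightarrow> 'a \<Rightarrow> real) (R :: 'a \<Rightarrow> real).
          let \<beta>0 = restrict (coef \<psi> f0) (idx J0 J);
              Y = obs_coef \<psi> n f0 W;
              \<Phi> = prior_modulus J0 J n \<pi> \<beta>0;
              H = tail_event \<psi> w J f0 M Y R;
              r = real n powr (- c2 C1 * 2 ^ J);
              \<delta> = \<Phi> (c1 C1 * sqrt (2 ^ J * ln (real n))) + c1 C1 * r
          in
          0 < \<alpha> \<and> \<alpha> < 1 \<and> 0 < C1 \<and> 2 \<le> n \<and> J0 \<le> J \<and> 2 ^ J \<le> n \<and>
          f0 \<in> besov J0 \<psi> s \<and> weights J0 w \<and> sieve_prior J0 J \<pi> \<and> white_noise M W \<and>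
          credible_radius J0 \<psi> w J n \<pi> \<alpha> M Y R \<and>
          \<pi> \<beta>0 \<ge> real n powr (2 ^ J / 2) * real n powr (- C1 * 2 ^ J) \<and>
          \<Phi> (1 / sqrt (real n)) \<le> 1 / 2
          \<longrightarrow>
          \<bar>measure M {\<omega> \<in> space M. f0 \<in> band J0 \<psi> w (Y \<omega>) (R \<omega>)} - (1 - \<alpha>)\<bar>
            \<le> \<delta> + measure M (space M - H) \<and>
          (\<delta> < min (\<alpha> / 2) ((1 - \<alpha>) / 2) \<longrightarrow>
            (Jmin \<alpha> w \<le> J \<longrightarrow>
              measure M (space M - H)
                \<le> c3 \<alpha> * (exp (- c4 \<alpha> * real J * (real J / (w_bar J0 w J)\<^sup>2) * (u_seq w J)\<^sup>2) + r)) \<and>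
            (\<forall>B>0. \<exists>A\<in>sets M. measure M A \<ge> 1 - c1 C1 * r \<and>
              (\<forall>\<omega>\<in>A.
                (SUP (f, g) \<in> (band J0 \<psi> w (Y \<omega>) (R \<omega>) \<inter> {f. besov_norm J0 \<psi> s f \<le> ereal B}) \<times>
                              (band J0 \<psi> w (Y \<omega>) (R \<omega>) \<inter> {f. besov_norm J0 \<psi> s f \<le> ereal B}).
                   Linf_norm (\<lambda>x. f x - g x))
                \<le> ereal (c3 \<alpha> * (v_seq J0 w J * sqrt (2 ^ J * real J / real n)
                                 + 2 powr (- real J * s) * B))))))))"
proof (rule exI[of _ "\<lambda>C1. C1 + 10"], rule exI[of _ "\<lambda>_. 1"], rule conjI, force, intro allI impI, goal_cases)
  case (1 s S J0 \<psi>)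
  then have s: "0 < s" and S: "1 \<le> S" and cdv: "cdv_basis S J0 \<psi>" by auto
  have J0: "2 \<le> J0" by (rule cdv_basis_sup_bound(1)[OF cdv S])
  have ob: "orthonormal_basis_unit J0 \<psi>" using cdv unfolding cdv_basis_def by (rule conjunct2)
  obtain C where C: "0 < C"
    "\<And>l x. J0 - 1 \<le> l \<Longrightarrow> x \<in> {0..1} \<Longrightarrow> (\<Sum>k<2 ^ max l J0. \<bar>\<psi> l k x\<bar>) \<le> C * 2 powr (real l / 2)"
    using cdv_basis_sup_bound(2)[OF cdv S] by blast
  define c3 where "c3 \<alpha> = 3 + C * (6 * (2 * sqrt (ln (32 / \<alpha>))) + 2 / (1 - 2 powr (- s)))" for \<alpha> :: real
  have c3: "3 \<le> c3 \<alpha>" if "0 < \<alpha>" "\<alpha> < 1" for \<alpha>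
  proof -
    have "2 powr (- s) < 1" using s by (simp add: powr_less_one)
    then show ?thesis unfolding c3_def using C(1) that by simp
  qed
  have "\<forall>z :: real \<times> (nat \<Rightarrow> real). \<exists>N. 0 < fst z \<and> fst z < 1 \<and> weights J0 (snd z) \<longrightarrow> (\<forall>J\<ge>N.
      exp (- (2 / 9 * (3 / 2) ^ J)) < (1 - fst z) / 2 \<and> 32 * ln 2 \<le> weight_ratio J0 (snd z) J)"
    using eventually_level_large by blast
  from choice[OF this] obtain Jm where "\<forall>z :: real \<times> (nat \<Rightarrow> real). 0 < fst z \<and> fst z < 1 \<and> weights J0 (snd z) \<longrightarrow> (\<forall>J\<ge>Jm z.
      exp (- (2 / 9 * (3 / 2) ^ J)) < (1 - fst z) / 2 \<and> 32 * ln 2 \<le> weight_ratio J0 (snd z) J)"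
    by (elim exE)
  then have Jm: "exp (- (2 / 9 * (3 / 2) ^ J)) < (1 - \<alpha>) / 2" "32 * ln 2 \<le> weight_ratio J0 w J"
    if "0 < \<alpha>" "\<alpha> < 1" "weights J0 w" "Jm (\<alpha>, w) \<le> J" for \<alpha> w J
    using that by (metis fst_conv snd_conv)+
  show ?case
  proof (rule exI[of _ c3], rule exI[of _ "\<lambda>_. 1 / 32"], rule exI[of _ "\<lambda>\<alpha> w. Jm (\<alpha>, w)"], rule conjI,
      goal_cases)
    case 1
    then show ?case using c3 by force
  next
    case 2
    show ?case
      unfolding Let_def
    proof (intro allI impI, goal_cases)
      case (1 \<alpha> C1 n J f0 w \<pi> M W R)
      then have \<alpha>': "0 < \<alpha>" "\<alpha> < 1" and w': "weights J0 w" by auto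
      from 1 interpret sieve_model J0 J n \<psi> f0 w \<pi> \<alpha> C1 M W R
        using J0 ob by unfold_locales (auto simp: besov_def)
      have defs: "real n powr (- 1 * 2 ^ J) = r" "restrict (coef \<psi> f0) (idx J0 J) = \<beta>0" "obs_coef \<psi> n f0 W = Y"
        "prior_modulus J0 J n \<pi> \<beta>0 ((C1 + 10) * sqrt (2 ^ J * ln (real n))) = \<Phi>"
        by (simp_all add: r_def \<beta>0_def Y_def \<Phi>_def)
      show ?case
        unfolding defs
      proof (intro conjI impI allI, goal_cases)
        case 1
        show ?case using coverage slack by linarith
      next
        case 2
        have "prob (space M - tail) \<le> 3 * exp (- (real J * weight_ratio J0 w J / 32)) + r"
          using 2 by (intro tail_prob_le Jm[OF \<alpha>' w'])
        also have "\<dots> \<le> c3 \<alpha> * (exp (- (real J * weight_ratio J0 w J / 32)) + r)"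
        proof -
          have "3 * exp (- (real J * weight_ratio J0 w J / 32)) \<le> c3 \<alpha> * exp (- (real J * weight_ratio J0 w J / 32))"
            using c3[OF \<alpha>'] by (intro mult_right_mono) auto
          moreover have "1 * r \<le> c3 \<alpha> * r" using c3[OF \<alpha>'] by (intro mult_right_mono) (auto simp: r_def)
          ultimately show ?thesis unfolding distrib_left by linarith
        qed
        also have "- (real J * weight_ratio J0 w J / 32)
            = - (1 / 32) * real J * (real J / (w_bar J0 w J)\<^sup>2) * (u_seq w J)\<^sup>2"
          by (simp add: weight_ratio_def)
        finally show ?case .
      next
        case (3 B)
        then show ?case using diameter[OF _ C s, of B] unfolding c3_def by blast
      qed
    qed
  qed
qed

end
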